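(* Let $\alpha\in(0,\alpha_3^* )$ and let $V_0\subset V=\{1,\dots,n\}$ be a fixed set of vertices with $|V_0|=\alpha n$. Let $G$ be a random 3-regular multigraph on vertex set $V$ drawn from the configuration model. Then, with $\Pi_\sigma:=\prod_{v_0\in V_0}\frac{1+\sigma_{v_0}Z_{v_0}}{2}$, $$\mathbf{E}_G\left[\max_{\sigma\in\{-1,1\}^{V_0}}\frac{\langle\psi_G|\Pi_\sigma H_{\mathrm{MaxCut}}(G)\Pi_\sigma|\psi_G\rangle}{\lVert \Pi_\sigma|\psi_G\rangle\rVert^2}-\langle\psi_G|H_{\mathrm{MaxCut}}(G)|\psi_G\rangle\ \Big|\ V_0\text{ is 2-independent in }G\right]\le\frac{\alpha^2(0.18125-0.83875\,\alpha+0.99\,\alpha^2)}{(0.5-\alpha)^3}\,n+\mathcal{O}(1)$$ as $n\to\infty$.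
   Context: Configuration model: on $n$ vertices of degree $d$ ($nd$ even), attach $d$ half-edges $(i,1),\dots,(i,d)$ to each vertex $i$, draw a uniformly random perfect matching of the $nd$ half-edges, and let each matched pair of half-edges form an edge between the corresponding vertices (loops and multiple edges possible). In this model, $V_0$ is called 2-independent in $G$ if the $d|V_0|$ half-edges attached to $V_0$ are matched to half-edges belonging to pairwise distinct vertices outside $V_0$ (for simple graphs this is equivalent to any two distinct vertices of $V_0$ being at distance at least $3$). $\alpha_d^*\in(0,\frac{1}{d+1})$ is the threshold such that the expected number of 2-independent sets of size $\alpha n$ in a degree-$d$ configuration-model multigraph grows exponentially in $n$ for $\alpha<\alpha_d^*$ and decays exponentially for $\alpha>\alpha_d^*$; $\alpha_3^*\in(0.235,0.236)$. Qubits are labelled by vertices. $H_{\mathrm{MaxCut}}(G)=\sum_{\{e_0,e_1\}\in E}\frac{1-Z_{e_0}Z_{e_1}}{2}$ (edges counted with multiplicity; loops contribute $0$). The depth-1 QAOA state is $$|\psi_G\rangle=\exp\Big(-\tfrac{i\beta}{2}\sum_{v}X_v\Big)\exp\Big(-\tfrac{i\gamma}{2}\sum_{\{e_0,e_1\}\in E}Z_{e_0}Z_{e_1}\Big)|+\rangle^{\otimes n}$$ with the optimal parameters for 3-regular graphs $\beta=-\frac{\pi}{4}$, $\gamma=\arctan\frac{1}{\sqrt2}$. *)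

theory Defs
  imports "HOL-Probability.Probability" "HOL-Library.Landau_Symbols"
    "HOL-Library.Multiset" "HOL-Library.FuncSet" "HOL-Library.Disjoint_Sets"
begin

section \<open>The configuration model\<close>

type_synonym half_edge = "nat \<times> nat"

definition half_edges :: "nat set \<Rightarrow> nat \<Rightarrow> half_edge set" where
  "half_edges V d = V \<times> {1..d}"

definition perfect_matchings :: "'a set \<Rightarrow> 'a set set set" where
  "perfect_matchings A = {M. partition_on A M \<and> (\<forall>p\<in>M. card p = 2)}"

text \<open>Only meaningful for even \<open>n * d\<close>: otherwise there is no perfect matching.\<close>

definition configuration_model :: "nat \<Rightarrow> nat \<Rightarrow> half_edge set set pmf" where
  "configuration_model n d = pmf_of_set (perfect_matchings (half_edges {1..n} d))"

text \<open>An edge is the two-element multiset of its endpoints, so that a loop at \<open>v\<close> is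
  \<open>{#v, v#}\<close>; a multigraph is given by its multiset of edges.\<close>

definition multigraph_of :: "half_edge set set \<Rightarrow> nat multiset multiset" where
  "multigraph_of M = image_mset (\<lambda>p. image_mset fst (mset_set p)) (mset_set M)"

definition partner :: "'a set set \<Rightarrow> 'a \<Rightarrow> 'a" where
  "partner M h = (THE h'. {h, h'} \<in> M)"

definition two_independent :: "nat \<Rightarrow> half_edge set set \<Rightarrow> nat set \<Rightarrow> bool" where
  "two_independent d M V0 \<longleftrightarrow>
     (\<forall>h\<in>half_edges V0 d. fst (partner M h) \<notin> V0) \<and>
     inj_on (\<lambda>h. fst (partner M h)) (half_edges V0 d)"

definition expected_two_independent :: "nat \<Rightarrow> nat \<Rightarrow> nat \<Rightarrow> real" where
  "expected_two_independent d n k =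
     measure_pmf.expectation (configuration_model n d)
       (\<lambda>M. real (card {V0. V0 \<subseteq> {1..n} \<and> card V0 = k \<and> two_independent d M V0}))"

text \<open>Asymptotics in \<open>n\<close> are along those \<open>n\<close> for which \<open>n * d\<close> is even and \<open>\<alpha> * n\<close> is an
  integer \<open>k\<close>. For irrational \<open>\<alpha>\<close> there are none, but the rational \<open>\<alpha>\<close> already determine the
  threshold.\<close>

definition exponential_growth :: "nat \<Rightarrow> real \<Rightarrow> bool" where
  "exponential_growth d \<alpha> \<longleftrightarrow>
     (\<exists>c>0. \<forall>\<^sub>F n in sequentially. \<forall>k. even (n * d) \<and> real k = \<alpha> * real n \<longrightarrow>
        expected_two_independent d n k \<ge> exp (c * real n))"

definition exponential_decay :: "nat \<Rightarrow> real \<Rightarrow> bool" where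
  "exponential_decay d \<alpha> \<longleftrightarrow>
     (\<exists>c>0. \<forall>\<^sub>F n in sequentially. \<forall>k. even (n * d) \<and> real k = \<alpha> * real n \<longrightarrow>
        expected_two_independent d n k \<le> exp (- c * real n))"

definition alpha_star :: "nat \<Rightarrow> real" where
  "alpha_star d = (THE a. 0 < a \<and> a < 1 / (real d + 1) \<and>
     (\<forall>\<alpha>. 0 < \<alpha> \<and> \<alpha> < a \<longrightarrow> exponential_growth d \<alpha>) \<and>
     (\<forall>\<alpha>>a. exponential_decay d \<alpha>))"

section \<open>Qubits labelled by vertices\<close>

text \<open>The computational basis of the qubits in \<open>V\<close> is indexed by the \<open>Z\<close>-eigenvalues
  \<open>s \<in> spins V\<close>. A state is its family of amplitudes; only the amplitudes at \<open>spins V\<close> are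
  meaningful.\<close>

type_synonym qstate = "(nat \<Rightarrow> int) \<Rightarrow> complex"

definition spins :: "nat set \<Rightarrow> (nat \<Rightarrow> int) set" where
  "spins V = V \<rightarrow>\<^sub>E {-1, 1}"

definition braket :: "nat set \<Rightarrow> qstate \<Rightarrow> qstate \<Rightarrow> complex" where
  "braket V \<phi> \<psi> = (\<Sum>s\<in>spins V. cnj (\<phi> s) * \<psi> s)"

definition qnorm :: "nat set \<Rightarrow> qstate \<Rightarrow> real" where
  "qnorm V \<psi> = sqrt (Re (braket V \<psi> \<psi>))"

definition pauli_X :: "nat \<Rightarrow> qstate \<Rightarrow> qstate" where
  "pauli_X v \<psi> = (\<lambda>s. \<psi> (s(v := - s v)))"

definition pauli_Z :: "nat \<Rightarrow> qstate \<Rightarrow> qstate" where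
  "pauli_Z v \<psi> = (\<lambda>s. of_int (s v) * \<psi> s)"

text \<open>The product of the (commuting) \<open>Z\<close> operators at the two endpoints of an edge; at a loop
  this is the square of one \<open>Z\<close>, i.e. the identity.\<close>

definition ZZ :: "nat multiset \<Rightarrow> qstate \<Rightarrow> qstate" where
  "ZZ e \<psi> = fold_mset pauli_Z \<psi> e"

definition maxcut_hamiltonian :: "nat multiset multiset \<Rightarrow> qstate \<Rightarrow> qstate" where
  "maxcut_hamiltonian E \<psi> = (\<lambda>s. \<Sum>e\<in>#E. (\<psi> s - ZZ e \<psi> s) / 2)"

text \<open>The exponential series of a linear operator, which converges amplitude by amplitude.\<close>

definition op_exp :: "(qstate \<Rightarrow> qstate) \<Rightarrow> qstate \<Rightarrow> qstate" where
  "op_exp A \<psi> = (\<lambda>s. \<Sum>k. (A ^^ k) \<psi> s / fact k)"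

definition plus_state :: "nat set \<Rightarrow> qstate" where
  "plus_state V = (\<lambda>s. 1 / of_real (sqrt (2 ^ card V)))"

definition qaoa_state :: "real \<Rightarrow> real \<Rightarrow> nat set \<Rightarrow> nat multiset multiset \<Rightarrow> qstate" where
  "qaoa_state \<beta> \<gamma> V E =
     op_exp (\<lambda>\<psi> s. - (\<i> * of_real \<beta> / 2) * (\<Sum>v\<in>V. pauli_X v \<psi> s))
       (op_exp (\<lambda>\<psi> s. - (\<i> * of_real \<gamma> / 2) * (\<Sum>e\<in>#E. ZZ e \<psi> s))
         (plus_state V))"

definition projector :: "nat set \<Rightarrow> (nat \<Rightarrow> int) \<Rightarrow> qstate \<Rightarrow> qstate" where
  "projector V0 \<sigma> \<psi> =
     Finite_Set.fold (\<lambda>v \<phi> s. (\<phi> s + of_int (\<sigma> v) * pauli_Z v \<phi> s) / 2) \<psi> V0"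

definition energy :: "nat set \<Rightarrow> nat multiset multiset \<Rightarrow> qstate \<Rightarrow> real" where
  "energy V E \<psi> = Re (braket V \<psi> (maxcut_hamiltonian E \<psi>))"

definition projected_energy ::
    "nat set \<Rightarrow> nat multiset multiset \<Rightarrow> nat set \<Rightarrow> (nat \<Rightarrow> int) \<Rightarrow> qstate \<Rightarrow> real" where
  "projected_energy V E V0 \<sigma> \<psi> =
     Re (braket V \<psi> (projector V0 \<sigma> (maxcut_hamiltonian E (projector V0 \<sigma> \<psi>)))) /
       (qnorm V (projector V0 \<sigma> \<psi>))\<^sup>2"

end

theory Submission
  imports Defs "HOL-Real_Asymp.Real_Asymp"
begin

text \<open>All operators in the statement except the mixer are diagonal, so both energies are expectations
  under the distribution \<open>\<bar>\<psi> s\<bar>\<^sup>2\<close> of outcomes \<open>s\<close>, the first one conditioned on the outcomes on \<open>V0\<close>.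
  Conjugating by the mixer writes the moments of this distribution as sums over sets of flipped
  spins. Since the three-edge stars around \<open>V0\<close> are disjoint, the sum over the flips in \<open>V0\<close>
  factorizes, and the star with outcome \<open>\<sigma>\<close> at its centre acts on each of its leaves as a bias
  proportional to \<open>\<sigma>\<close>. Unless its surroundings contain a short cycle or two leaves of one star,
  an edge has a correlation that exceeds its unconditioned value by a combination of products of two
  biases, and these two come from the ends of a path of three, four or five edges between vertices of
  \<open>V0\<close>. Bounding every product by 1 gives a bound that is uniform in \<open>\<sigma>\<close>.

  Conditioned on the stars, the other half-edges are matched uniformly at random, so the expected numbers of
  such paths are explicit up to \<open>O(1)\<close>, and the expected number of exceptional edges is \<open>O(1)\<close>.
  The resulting coefficient is below the claimed one whenever \<open>\<alpha> < 1 / 4\<close>. That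
  \<open>alpha_star 3 < 1 / 4\<close> follows from the first moment \<open>n! 27\<^sup>k (3n-6k-1)!! / (k! (n-4k)! (3n-1)!!)\<close>: its
  exponential rate divided by \<open>\<alpha>\<close> is strictly decreasing with a zero below \<open>1 / 4\<close>.\<close>

section \<open>Perfect matchings\<close>

text \<open>The conditioned energies are tractable because the outcomes on \<open>V0\<close> are
  uniformly distributed (\<open>moment_agree\<close>): conditioning multiplies the integrand by
  \<open>\<Prod>x\<in>V0. 1 + B x * s x\<close>, whose mean is 1, and leaves no normalisation to
  control. Both energies are then one multilinear expression, evaluated at
  \<open>B = \<sigma>\<close> and at \<open>B = 0\<close>. In the correlation of an unexceptional
  edge, averaging over spins removes every odd degree in the biases, and only degrees zero and two
  remain. The quadratic terms of different edges partly cancel along a path, so they are added over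
  all edges before absolute values are taken; this gives the coefficients
  \<open>15/4 * \<theta>\<^sup>2\<close>, \<open>9/2 * c * \<theta>^3\<close>,
  \<open>3/2 * \<theta>^4\<close> with \<open>c = 1 / sqrt 2\<close>. The maximum over \<sigma>
  stands inside the expectation, hence the signs must disappear before the matching is averaged.
  After that only upper bounds on counts are needed, and all of them rest on one estimate: up to
  three prescribed disjoint pairs of free half-edges cost a factor of at most
  \<open>1 / (card U - 5)\<close> each.\<close>

lemma perfect_matchings_subset_Pow: "perfect_matchings A \<subseteq> Pow (Pow A)"
  by (auto simp: perfect_matchings_def partition_on_def)

lemma finite_perfect_matchings [simp, intro]: "finite A \<Longrightarrow> finite (perfect_matchings A)"
  by (rule finite_subset[OF perfect_matchings_subset_Pow]) simp

lemma perfect_matchingsD: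
  assumes "M \<in> perfect_matchings A"
  shows "\<Union>M = A" "disjoint M" "\<And>p. p \<in> M \<Longrightarrow> card p = 2" "\<And>p. p \<in> M \<Longrightarrow> p \<subseteq> A"
  using assms by (auto simp: perfect_matchings_def partition_on_def)

lemma perfect_matchings_unique:
  assumes M: "M \<in> perfect_matchings A" and "p \<in> M" "q \<in> M" "h \<in> p" "h \<in> q"
  shows "p = q"
  using disjointD[OF perfect_matchingsD(2)[OF M], of p q] assms by auto

lemma perfect_matchingsI:
  assumes "\<Union>M = A" "disjoint M" "\<And>p. p \<in> M \<Longrightarrow> card p = 2"
  shows "M \<in> perfect_matchings A"
  using assms by (fastforce simp: perfect_matchings_def partition_on_def)

lemma finite_perfect_matching:
  "M \<in> perfect_matchings A \<Longrightarrow> finite A \<Longrightarrow> finite M"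
  using perfect_matchings_subset_Pow[of A] by (metis PowD finite_Pow_iff finite_subset subsetD)

lemma perfect_matching_ex1_partner:
  assumes M: "M \<in> perfect_matchings A" and h: "h \<in> A"
  shows "\<exists>!h'. {h, h'} \<in> M"
proof -
  obtain p where p: "p \<in> M" "h \<in> p" using perfect_matchingsD(1)[OF M] h by auto
  then have "card p = 2" using perfect_matchingsD(3)[OF M] by auto
  then obtain x y where xy: "p = {x, y}" "x \<noteq> y" by (auto simp: card_2_iff)
  obtain h' where h': "p = {h, h'}" using p(2) xy by auto
  show ?thesis
  proof (rule ex1I[of _ h'])
    show "{h, h'} \<in> M" using p h' by simp
    fix g assume g: "{h, g} \<in> M"
    have "{h, g} = {h, h'}"
      using perfect_matchings_unique[OF M g p(1), of h] h' by simp
    then show "g = h'" by (auto simp: doubleton_eq_iff)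
  qed
qed

lemma partner_in:
  assumes "M \<in> perfect_matchings A" "h \<in> A"
  shows "{h, partner M h} \<in> M"
  unfolding partner_def by (rule theI'[OF perfect_matching_ex1_partner[OF assms]])

lemma partner_eq_iff:
  assumes M: "M \<in> perfect_matchings A" "h \<in> A"
  shows "partner M h = h' \<longleftrightarrow> {h, h'} \<in> M"
  using partner_in[OF assms] perfect_matching_ex1_partner[OF assms] by auto

lemma partner_neq:
  assumes M: "M \<in> perfect_matchings A" "h \<in> A"
  shows "partner M h \<noteq> h"
  using perfect_matchingsD(3)[OF M(1) partner_in[OF M]] by auto

lemma partner_mem:
  assumes M: "M \<in> perfect_matchings A" "h \<in> A"
  shows "partner M h \<in> A"
  using perfect_matchingsD(4)[OF M(1) partner_in[OF M]] by auto

lemma partner_partner: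
  assumes M: "M \<in> perfect_matchings A" "h \<in> A"
  shows "partner M (partner M h) = h"
  using partner_eq_iff[OF M(1) partner_mem[OF M]] partner_in[OF M] by (simp add: insert_commute)

lemma perfect_matching_eq_image:
  assumes M: "M \<in> perfect_matchings A"
  shows "M = (\<lambda>h. {h, partner M h}) ` A"
proof
  show "(\<lambda>h. {h, partner M h}) ` A \<subseteq> M" using partner_in[OF M] by auto
  show "M \<subseteq> (\<lambda>h. {h, partner M h}) ` A"
  proof
    fix p assume p: "p \<in> M"
    then obtain x y where xy: "p = {x, y}"
      using perfect_matchingsD(3)[OF M] by (metis card_2_iff)
    have "x \<in> A" using perfect_matchingsD(4)[OF M p] xy by auto
    moreover from this have "partner M x = y" using partner_eq_iff[OF M] p xy by auto
    ultimately show "p \<in> (\<lambda>h. {h, partner M h}) ` A" using xy by auto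
  qed
qed

lemma sum_over_perfect_matching:
  fixes f :: "'a set \<Rightarrow> 'b :: field_char_0"
  assumes M: "M \<in> perfect_matchings A" and A: "finite A"
  shows "(\<Sum>p\<in>M. f p) = (\<Sum>h\<in>A. f {h, partner M h}) / 2"
proof -
  have "(\<Sum>h\<in>A. f {h, partner M h}) = (\<Sum>p\<in>M. \<Sum>h\<in>{h\<in>A. {h, partner M h} = p}. f {h, partner M h})"
    by (rule sum.group[symmetric, OF A finite_perfect_matching[OF M A]])
       (auto simp: partner_in[OF M])
  also have "\<dots> = (\<Sum>p\<in>M. 2 * f p)"
  proof (rule sum.cong[OF refl])
    fix p assume p: "p \<in> M"
    then obtain x y where xy: "p = {x, y}" "x \<noteq> y"
      using perfect_matchingsD(3)[OF M] by (metis card_2_iff)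
    have in_A: "x \<in> A" "y \<in> A" using perfect_matchingsD(4)[OF M p] xy by auto
    have px: "partner M x = y" "partner M y = x"
      using partner_eq_iff[OF M] p xy in_A by (auto simp: insert_commute)
    have "{h\<in>A. {h, partner M h} = p} = {x, y}"
      using xy px in_A by (auto simp: insert_commute)
    then show "(\<Sum>h\<in>{h\<in>A. {h, partner M h} = p}. f {h, partner M h}) = 2 * f p"
      using xy px by (simp add: insert_commute)
  qed
  finally show ?thesis by (simp add: sum_distrib_left[symmetric])
qed

section \<open>Completions of a partial matching and their number\<close>

lemma perfect_matching_Un:
  assumes "M \<in> perfect_matchings A" "P \<in> perfect_matchings B" "A \<inter> B = {}"
  shows "M \<union> P \<in> perfect_matchings (A \<union> B)"
proof (rule perfect_matchingsI)
  show "disjoint (M \<union> P)"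
    using assms perfect_matchingsD(1,2)[OF assms(1)] perfect_matchingsD(1,2)[OF assms(2)]
    by (intro disjoint_union) auto
qed (use perfect_matchingsD[OF assms(1)] perfect_matchingsD[OF assms(2)] in auto)

lemma perfect_matching_Diff:
  assumes M: "M \<in> perfect_matchings A" and P: "P \<in> perfect_matchings B" and "P \<subseteq> M"
  shows "M - P \<in> perfect_matchings (A - B)"
proof (rule perfect_matchingsI)
  have "p \<inter> q = {}" if "p \<in> M - P" "q \<in> P" for p q
    using disjointD[OF perfect_matchingsD(2)[OF M], of p q] that assms(3) by auto
  then show "\<Union>(M - P) = A - B"
    using perfect_matchingsD(1)[OF M] perfect_matchingsD(1)[OF P] assms(3) by blast
  show "disjoint (M - P)" using perfect_matchingsD(2)[OF M] by (auto simp: disjoint_def)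
qed (use perfect_matchingsD[OF M] in auto)

text \<open>Once the pairs in \<open>P\<close> are fixed, the rest is an arbitrary matching of the
  remaining points. This is why conditioning on prescribed edges keeps the rest uniform.\<close>

lemma bij_betw_perfect_matchings_superset:
  assumes P: "P \<in> perfect_matchings B" and BA: "B \<subseteq> A"
  shows "bij_betw (\<lambda>M. M \<union> P) (perfect_matchings (A - B)) {M \<in> perfect_matchings A. P \<subseteq> M}"
proof (rule bij_betwI[where g = "\<lambda>M. M - P"])
  show "(\<lambda>M. M \<union> P) \<in> perfect_matchings (A - B) \<rightarrow> {M \<in> perfect_matchings A. P \<subseteq> M}"
    using perfect_matching_Un[OF _ P, of _ "A - B"] BA by (auto simp: Un_absorb2)
  show "(\<lambda>M. M - P) \<in> {M \<in> perfect_matchings A. P \<subseteq> M} \<rightarrow> perfect_matchings (A - B)"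
    using perfect_matching_Diff[OF _ P] by auto
  show "M \<union> P - P = M" if "M \<in> perfect_matchings (A - B)" for M
  proof -
    have "M \<inter> P = {}"
    proof (rule ccontr)
      assume "M \<inter> P \<noteq> {}"
      then obtain p where "p \<in> M" "p \<in> P" by auto
      then have "p \<subseteq> A - B" "p \<subseteq> B" "card p = 2"
        using perfect_matchingsD(4)[OF that] perfect_matchingsD(3,4)[OF P] by auto
      then have "p = {}" by auto
      then show False using \<open>card p = 2\<close> by simp
    qed
    then show ?thesis by auto
  qed
qed auto

text \<open>The double factorial (2m - 1)!!.\<close>

definition odd_fact :: "nat \<Rightarrow> nat" where
  "odd_fact m = (\<Prod>i<m. 2 * i + 1)"

lemma odd_fact_0 [simp]: "odd_fact 0 = 1"
  and odd_fact_Suc [simp]: "odd_fact (Suc m) = (2 * m + 1) * odd_fact m"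
  by (auto simp: odd_fact_def)

lemma odd_fact_pos [simp]: "odd_fact m > 0"
  by (auto simp: odd_fact_def)

lemma singleton_perfect_matching: "a \<noteq> b \<Longrightarrow> {{a, b}} \<in> perfect_matchings {a, b}"
  by (rule perfect_matchingsI) auto

lemma perfect_matchings_empty [simp]: "perfect_matchings {} = {{}}"
  by (auto simp: perfect_matchings_def partition_on_def)

lemma card_perfect_matchings:
  assumes "finite A" "card A = 2 * m"
  shows "card (perfect_matchings A) = odd_fact m"
  using assms
proof (induction m arbitrary: A)
  case 0
  then show ?case by simp
next
  case (Suc m)
  then have "A \<noteq> {}" by auto
  then obtain a where a: "a \<in> A" by auto
  \<comment> \<open>Classification by the partner of the fixed point \<open>a\<close>:
    \<open>2 * m + 1\<close> choices, each leaving \<open>2 * m\<close> points to be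
    matched.\<close>
  have eq: "perfect_matchings A = (\<Union>b\<in>A - {a}. {M \<in> perfect_matchings A. {{a, b}} \<subseteq> M})"
  proof (rule equalityI; rule subsetI)
    fix M assume M: "M \<in> perfect_matchings A"
    show "M \<in> (\<Union>b\<in>A - {a}. {M \<in> perfect_matchings A. {{a, b}} \<subseteq> M})"
      using partner_in[OF M a] partner_mem[OF M a] partner_neq[OF M a] M
      by (intro UN_I[of "partner M a"]) auto
  qed auto
  have card1: "card {M \<in> perfect_matchings A. {{a, b}} \<subseteq> M} = odd_fact m" if b: "b \<in> A - {a}" for b
  proof -
    have ab: "{{a, b}} \<in> perfect_matchings {a, b}" using b by (auto intro: singleton_perfect_matching)
    have "card {M \<in> perfect_matchings A. {{a, b}} \<subseteq> M} = card (perfect_matchings (A - {a, b}))"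
      using bij_betw_same_card[OF bij_betw_perfect_matchings_superset[OF ab]] a b by auto
    also have "\<dots> = odd_fact m"
      using Suc.prems a b by (intro Suc.IH) (auto simp: card_Diff_subset)
    finally show ?thesis .
  qed
  have "card (perfect_matchings A) = (\<Sum>b\<in>A - {a}. card {M \<in> perfect_matchings A. {{a, b}} \<subseteq> M})"
  proof (subst eq, rule card_UN_disjoint)
    show "finite (A - {a})" using Suc.prems by simp
    show "\<forall>b\<in>A - {a}. finite {M \<in> perfect_matchings A. {{a, b}} \<subseteq> M}" using Suc.prems by auto
    show "\<forall>b\<in>A - {a}. \<forall>b'\<in>A - {a}. b \<noteq> b' \<longrightarrow> {M \<in> perfect_matchings A. {{a, b}} \<subseteq> M} \<inter>
       {M \<in> perfect_matchings A. {{a, b'}} \<subseteq> M} = {}"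
    proof (intro ballI impI equals0I)
      fix b b' M assume "b \<noteq> b'" and "M \<in> {M \<in> perfect_matchings A. {{a, b}} \<subseteq> M} \<inter>
       {M \<in> perfect_matchings A. {{a, b'}} \<subseteq> M}"
      then show False using perfect_matching_ex1_partner[of M A a] a by auto
    qed
  qed
  also have "\<dots> = card (A - {a}) * odd_fact m" using card1 by simp
  also have "\<dots> = odd_fact (Suc m)" using Suc.prems a by simp
  finally show ?case .
qed

lemma card_perfect_matchings_superset:
  assumes A: "finite A" "card A = 2 * m" and P: "P \<in> perfect_matchings B" and "B \<subseteq> A"
    and "card B = 2 * j"
  shows "card {M \<in> perfect_matchings A. P \<subseteq> M} = odd_fact (m - j)"
proof -
  have "card (perfect_matchings (A - B)) = odd_fact (m - j)"
    using assms finite_subset[OF \<open>B \<subseteq> A\<close>]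
    by (intro card_perfect_matchings) (auto simp: card_Diff_subset)
  then show ?thesis
    using bij_betw_same_card[OF bij_betw_perfect_matchings_superset[OF P \<open>B \<subseteq> A\<close>]] by simp
qed

section \<open>Moments of the QAOA state\<close>

lemma finite_spins [simp]: "finite V \<Longrightarrow> finite (spins V)"
  by (simp add: spins_def finite_PiE)

lemma spins_mem: "s \<in> spins V \<Longrightarrow> v \<in> V \<Longrightarrow> s v = -1 \<or> s v = 1"
  by (auto simp: spins_def PiE_def Pi_def)

lemma spins_fun_upd: "s \<in> spins V \<Longrightarrow> v \<in> V \<Longrightarrow> s(v := - s v) \<in> spins V"
  by (auto simp: spins_def PiE_def Pi_def extensional_def)

lemma sum_spins_flip:
  assumes "v \<in> V"
  shows "(\<Sum>s\<in>spins V. f (s(v := - s v))) = (\<Sum>s\<in>spins V. f s)"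
  by (rule sum.reindex_bij_witness[of _ "\<lambda>s. s(v := - s v)" "\<lambda>s. s(v := - s v)"])
     (use assms in \<open>auto intro: spins_fun_upd\<close>)

definition flip :: "nat set \<Rightarrow> (nat \<Rightarrow> int) \<Rightarrow> nat \<Rightarrow> int" where
  "flip T s = (\<lambda>v. if v \<in> T then - s v else s v)"

lemma flip_empty [simp]: "flip {} s = s"
  by (auto simp: flip_def)

lemma ZZ_eq: "ZZ e \<psi> s = of_int (\<Prod>v\<in>#e. s v) * \<psi> s"
proof -
  interpret comp_fun_commute pauli_Z
    by unfold_locales (auto simp: pauli_Z_def fun_eq_iff)
  show ?thesis
    unfolding ZZ_def
  proof (induction e)
    case (add x e)
    have "fold_mset pauli_Z \<psi> (add_mset x e) s = of_int (s x) * fold_mset pauli_Z \<psi> e s"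
      unfolding fold_mset_add_mset by (simp add: pauli_Z_def)
    then show ?case using add by simp
  qed simp
qed

section \<open>The two layers of the circuit as explicit operators\<close>

lemma op_exp_diagonal: "op_exp (\<lambda>\<psi> s. d s * \<psi> s) \<phi> s = exp (d s) * \<phi> s"
proof -
  have "((\<lambda>\<psi> s. d s * \<psi> s) ^^ k) \<phi> s = d s ^ k * \<phi> s" for k
    by (induction k) (auto simp: mult_ac)
  then have "op_exp (\<lambda>\<psi> s. d s * \<psi> s) \<phi> s = (\<Sum>k. d s ^ k /\<^sub>R fact k * \<phi> s)"
    unfolding op_exp_def by (simp add: scaleR_conv_of_real field_simps)
  also have "\<dots> = exp (d s) * \<phi> s"
    unfolding exp_def by (rule suminf_mult2[symmetric]) (rule summable_exp_generic)
  finally show ?thesis .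
qed

text \<open>With \<open>C = cosh z\<close> and \<open>S = sinh z\<close> this is exp(z X) at qubit
  \<open>u\<close>, because X squares to the identity.\<close>

definition mix :: "complex \<Rightarrow> complex \<Rightarrow> nat \<Rightarrow> qstate \<Rightarrow> qstate" where
  "mix C S u \<psi> = (\<lambda>s. C * \<psi> s + S * \<psi> (s(u := - s u)))"

lemma fold_mix_linear:
  "fold (mix C S) us (\<lambda>s. a * \<phi> s + b * \<psi> s) =
     (\<lambda>s. a * fold (mix C S) us \<phi> s + b * fold (mix C S) us \<psi> s)"
proof (induction us arbitrary: \<phi> \<psi>)
  case (Cons u us)
  have "mix C S u (\<lambda>s. a * \<phi> s + b * \<psi> s) = (\<lambda>s. a * mix C S u \<phi> s + b * mix C S u \<psi> s)"
    by (auto simp: mix_def algebra_simps)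
  then show ?case using Cons by simp
qed simp

definition shift_gen :: "complex \<Rightarrow> nat set \<Rightarrow> complex \<Rightarrow> qstate \<Rightarrow> qstate" where
  "shift_gen z U l \<psi> = (\<lambda>s. z * (\<Sum>v\<in>U. pauli_X v \<psi> s) + l * \<psi> s)"

lemma shift_gen_pow_add:
  "(shift_gen z U l ^^ k) (\<lambda>s. \<phi> s + \<psi> s) =
     (\<lambda>s. (shift_gen z U l ^^ k) \<phi> s + (shift_gen z U l ^^ k) \<psi> s)"
proof (induction k)
  case (Suc k)
  then show ?case
    by (simp add: shift_gen_def pauli_X_def sum.distrib algebra_simps)
qed simp

text \<open>Flips commute, so the generator on \<open>U\<close> preserves each eigenspace of the
  flip at \<open>u\<close>. The second conjunct is the invariant that carries the induction on
  \<open>k\<close>.\<close>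

lemma shift_gen_pow_eigen:
  assumes "u \<notin> U" "finite U" and e: "\<And>s. \<psi> (s(u := - s u)) = e * \<psi> s"
  shows "(shift_gen z (insert u U) l ^^ k) \<psi> = (shift_gen z U (l + z * e) ^^ k) \<psi> \<and>
    (\<forall>s. (shift_gen z U (l + z * e) ^^ k) \<psi> (s(u := - s u)) = e * (shift_gen z U (l + z * e) ^^ k) \<psi> s)"
proof (induction k)
  case 0
  show ?case unfolding funpow_0 using e by blast
next
  case (Suc k)
  define \<xi> where "\<xi> = (shift_gen z U (l + z * e) ^^ k) \<psi>"
  have \<xi>: "\<xi> (s(u := - s u)) = e * \<xi> s" for s using Suc unfolding \<xi>_def by blast
  have "shift_gen z (insert u U) l \<xi> = shift_gen z U (l + z * e) \<xi>"
    using assms(1,2) \<xi> by (auto simp: shift_gen_def pauli_X_def algebra_simps fun_eq_iff)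
  moreover have "shift_gen z U (l + z * e) \<xi> (s(u := - s u)) = e * shift_gen z U (l + z * e) \<xi> s" for s
  proof -
    have "\<xi> (s(u := - s u, v := - (s(u := - s u)) v)) = e * \<xi> (s(v := - s v))" if "v \<in> U" for v
    proof -
      have "s(u := - s u, v := - (s(u := - s u)) v) = (s(v := - s v))(u := - (s(v := - s v)) u)"
        using that assms(1) by (auto simp: fun_eq_iff)
      then show ?thesis using \<xi>[of "s(v := - s v)"] by simp
    qed
    then have "(\<Sum>v\<in>U. \<xi> (s(u := - s u, v := - (s(u := - s u)) v))) = (\<Sum>v\<in>U. e * \<xi> (s(v := - s v)))"
      by (intro sum.cong) auto
    then show ?thesis
      unfolding shift_gen_def pauli_X_def
      by (simp add: \<xi> sum_distrib_left[symmetric] algebra_simps del: fun_upd_apply)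
  qed
  moreover have "(shift_gen z (insert u U) l ^^ Suc k) \<psi> = shift_gen z (insert u U) l \<xi>"
    "(shift_gen z U (l + z * e) ^^ Suc k) \<psi> = shift_gen z U (l + z * e) \<xi>"
    using Suc by (simp_all add: \<xi>_def)
  ultimately show ?case by metis
qed

text \<open>Splitting \<open>\<psi>\<close> into the two eigenvectors of the flip at \<open>u\<close> turns the generator on
  \<open>insert u U\<close> into a scalar shift of the generator on \<open>U\<close>.\<close>

lemma shift_gen_exp_sums:
  assumes "distinct us"
  shows "(\<lambda>k. (shift_gen z (set us) l ^^ k) \<psi> s / fact k) sums
           (exp l * fold (mix (cosh z) (sinh z)) us \<psi> s)"
  using assms
proof (induction us arbitrary: \<psi> l s)
  case Nil
  have "(shift_gen z {} l ^^ k) \<psi> s = l ^ k * \<psi> s" for k s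
    by (induction k arbitrary: s) (auto simp: shift_gen_def)
  moreover have "(\<lambda>k. l ^ k /\<^sub>R fact k * \<psi> s) sums (exp l * \<psi> s)"
    by (intro sums_mult2 exp_converges)
  ultimately show ?case by (simp add: scaleR_conv_of_real field_simps)
next
  case (Cons u us)
  define p where "p = (\<lambda>s. (\<psi> s + \<psi> (s(u := - s u))) / 2)"
  define m where "m = (\<lambda>s. (\<psi> s - \<psi> (s(u := - s u))) / 2)"
  have \<psi>: "\<psi> = (\<lambda>s. p s + m s)" by (auto simp: p_def m_def field_simps)
  have u: "u \<notin> set us" using Cons.prems by simp
  have p: "(shift_gen z (insert u (set us)) l ^^ k) p = (shift_gen z (set us) (l + z) ^^ k) p" for k
    using shift_gen_pow_eigen[where u = u and U = "set us" and \<psi> = p and e = 1 and z = z and l = l and k = k] u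
    by (simp add: p_def add.commute)
  have m: "(shift_gen z (insert u (set us)) l ^^ k) m = (shift_gen z (set us) (l - z) ^^ k) m" for k
    using shift_gen_pow_eigen[where u = u and U = "set us" and \<psi> = m and e = "-1" and z = z and l = l and k = k] u
    by (simp add: m_def minus_divide_left)
  have "(\<lambda>k. (shift_gen z (set us) (l + z) ^^ k) p s / fact k +
             (shift_gen z (set us) (l - z) ^^ k) m s / fact k) sums
        (exp (l + z) * fold (mix (cosh z) (sinh z)) us p s +
         exp (l - z) * fold (mix (cosh z) (sinh z)) us m s)"
    by (intro sums_add Cons.IH) (use Cons.prems in auto)
  moreover have "(shift_gen z (set (u # us)) l ^^ k) \<psi> s / fact k =
      (shift_gen z (set us) (l + z) ^^ k) p s / fact k +
      (shift_gen z (set us) (l - z) ^^ k) m s / fact k" for k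
    by (subst \<psi>) (simp add: shift_gen_pow_add p m add_divide_distrib)
  moreover have "exp (l + z) * fold (mix (cosh z) (sinh z)) us p s +
         exp (l - z) * fold (mix (cosh z) (sinh z)) us m s =
       exp l * fold (mix (cosh z) (sinh z)) (u # us) \<psi> s"
  proof -
    have "mix (cosh z) (sinh z) u \<psi> = (\<lambda>s. exp z * p s + exp (- z) * m s)"
      by (auto simp: mix_def p_def m_def cosh_def sinh_def scaleR_conv_of_real field_simps)
    then have "fold (mix (cosh z) (sinh z)) (u # us) \<psi> s =
        exp z * fold (mix (cosh z) (sinh z)) us p s + exp (- z) * fold (mix (cosh z) (sinh z)) us m s"
      by (simp only: fold_simps fold_mix_linear)
    then show ?thesis
      by (simp add: exp_add exp_diff exp_minus field_simps)
  qed
  ultimately show ?case by simp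
qed

definition ising :: "nat multiset multiset \<Rightarrow> (nat \<Rightarrow> int) \<Rightarrow> int" where
  "ising E s = (\<Sum>e\<in>#E. \<Prod>v\<in>#e. s v)"

lemma qaoa_state_eq:
  assumes "finite V"
  shows "qaoa_state \<beta> \<gamma> V E =
    fold (mix (of_real (cos (\<beta> / 2))) (- \<i> * of_real (sin (\<beta> / 2)))) (sorted_list_of_set V)
      (\<lambda>s. exp (- (\<i> * of_real \<gamma> / 2) * of_int (ising E s)) / of_real (sqrt (2 ^ card V)))"
proof -
  define z where "z = - (\<i> * of_real \<beta> / 2)"
  have z: "cosh z = of_real (cos (\<beta> / 2))" "sinh z = - \<i> * of_real (sin (\<beta> / 2))"
  proof -
    have "z = \<i> * of_real (- \<beta> / 2)" by (simp add: z_def)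
    then show "cosh z = of_real (cos (\<beta> / 2))" "sinh z = - \<i> * of_real (sin (\<beta> / 2))"
      by (auto simp: cosh_conv_cos sinh_conv_sin cos_of_real[symmetric] sin_of_real[symmetric])
  qed
  have diag: "op_exp (\<lambda>\<psi> s. - (\<i> * of_real \<gamma> / 2) * (\<Sum>e\<in>#E. ZZ e \<psi> s)) (plus_state V) =
     (\<lambda>s. exp (- (\<i> * of_real \<gamma> / 2) * of_int (ising E s)) / of_real (sqrt (2 ^ card V)))"
  proof
    fix s
    have "(\<lambda>\<psi> s. - (\<i> * of_real \<gamma> / 2) * (\<Sum>e\<in>#E. ZZ e \<psi> s)) =
      (\<lambda>\<psi> s. (- (\<i> * of_real \<gamma> / 2) * of_int (ising E s)) * \<psi> s)"
    proof (intro ext)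
      fix \<psi> s
      have "(\<Sum>e\<in>#E. ZZ e \<psi> s) = of_int (ising E s) * \<psi> s"
        unfolding ising_def by (induction E) (auto simp: ZZ_eq algebra_simps)
      then show "- (\<i> * of_real \<gamma> / 2) * (\<Sum>e\<in>#E. ZZ e \<psi> s) =
         (- (\<i> * of_real \<gamma> / 2) * of_int (ising E s)) * \<psi> s" by simp
    qed
    then show "op_exp (\<lambda>\<psi> s. - (\<i> * of_real \<gamma> / 2) * (\<Sum>e\<in>#E. ZZ e \<psi> s)) (plus_state V) s =
      exp (- (\<i> * of_real \<gamma> / 2) * of_int (ising E s)) / of_real (sqrt (2 ^ card V))"
      using op_exp_diagonal[of "\<lambda>s. - (\<i> * of_real \<gamma> / 2) * of_int (ising E s)" "plus_state V" s]
      by (simp add: plus_state_def)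
  qed
  have "op_exp (shift_gen z V 0) \<phi> s = fold (mix (cosh z) (sinh z)) (sorted_list_of_set V) \<phi> s" for \<phi> s
    using sums_unique[OF shift_gen_exp_sums[of "sorted_list_of_set V" z 0 \<phi> s]] assms
    by (simp add: op_exp_def)
  moreover have "(\<lambda>\<psi> s. - (\<i> * of_real \<beta> / 2) * (\<Sum>v\<in>V. pauli_X v \<psi> s)) = shift_gen z V 0"
    by (auto simp: shift_gen_def z_def)
  ultimately show ?thesis
    unfolding qaoa_state_def diag by (simp add: z fun_eq_iff)
qed

section \<open>Heisenberg picture: observables conjugated by the mixer\<close>

definition heis :: "real \<Rightarrow> (nat \<Rightarrow> complex) \<Rightarrow> (nat \<Rightarrow> complex) \<Rightarrow> nat \<Rightarrow> qstate \<Rightarrow> qstate" where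
  "heis \<beta> f g u \<psi> = (\<lambda>s. (f u + g u * of_real (cos \<beta>) * of_int (s u)) * \<psi> s
     - g u * \<i> * of_real (sin \<beta>) * of_int (s u) * \<psi> (s(u := - s u)))"

lemma mix_adjoint:
  assumes "u \<in> V"
  shows "(\<Sum>s\<in>spins V. cnj (mix C S u \<phi> s) * \<psi> s) =
         (\<Sum>s\<in>spins V. cnj (\<phi> s) * mix (cnj C) (cnj S) u \<psi> s)"
proof -
  have "(\<Sum>s\<in>spins V. cnj (\<phi> (s(u := - s u))) * \<psi> s) =
        (\<Sum>s\<in>spins V. cnj (\<phi> s) * \<psi> (s(u := - s u)))"
    using sum_spins_flip[OF assms, of "\<lambda>s. cnj (\<phi> s) * \<psi> (s(u := - s u))"] by simp
  then show ?thesis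
    by (simp add: mix_def algebra_simps sum.distrib sum_distrib_left[symmetric])
qed

lemma fold_mix_diagonal_commute:
  assumes "u \<notin> set us"
  shows "fold (mix C S) us (\<lambda>s. d (s u) * \<psi> s) = (\<lambda>s. d (s u) * fold (mix C S) us \<psi> s)"
  using assms
proof (induction us arbitrary: \<psi>)
  case (Cons w us)
  have "mix C S w (\<lambda>s. d (s u) * \<psi> s) = (\<lambda>s. d (s u) * mix C S w \<psi> s)"
    using Cons.prems by (auto simp: mix_def algebra_simps)
  then show ?case using Cons by simp
qed simp

lemma mix_fold_heis_commute:
  assumes "u \<notin> set us"
  shows "mix C S u (fold (heis \<beta> f g) us \<psi>) = fold (heis \<beta> f g) us (mix C S u \<psi>)"
  using assms
proof (induction us arbitrary: \<psi>)
  case (Cons w us)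
  have "u \<noteq> w" using Cons.prems by auto
  then have tw: "s(u := - s u, w := - s w) = s(w := - s w, u := - s u)" for s :: "nat \<Rightarrow> int"
    by (rule fun_upd_twist)
  have "mix C S u (heis \<beta> f g w \<psi>) = heis \<beta> f g w (mix C S u \<psi>)"
    unfolding mix_def heis_def using \<open>u \<noteq> w\<close> by (simp add: tw algebra_simps)
  then show ?case using Cons by simp
qed simp

text \<open>Conjugation by the mixer of one qubit rotates Z into cos \<beta> Z + sin \<beta> Y,
  where Y = -i Z X; \<open>heis\<close> is this operator written on amplitudes. Since
  \<open>cnj S = - S\<close>, only the three double-angle combinations below occur.\<close>

lemma mix_conjugate:
  assumes "C = of_real (cos (\<beta> / 2))" "S = - \<i> * of_real (sin (\<beta> / 2))"
  shows "mix (cnj C) (cnj S) u (\<lambda>s. (f u + g u * of_int (s u)) * mix C S u \<psi> s) = heis \<beta> f g u \<psi>"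
proof
  fix s
  have sc: "(of_real (sin x))\<^sup>2 + (of_real (cos x))\<^sup>2 = (1 :: complex)" for x :: real
    by (metis of_real_1 of_real_add of_real_power sin_cos_squared_add)
  have 1: "C * C - S * S = 1"
    using sc[of "\<beta> / 2"] by (simp add: assms power2_eq_square algebra_simps)
  have 2: "C * C + S * S = of_real (cos \<beta>)"
  proof -
    have "C * C + S * S = of_real (cos (\<beta> / 2) * cos (\<beta> / 2) - sin (\<beta> / 2) * sin (\<beta> / 2))"
      by (simp add: assms algebra_simps)
    then show ?thesis using cos_double[of "\<beta> / 2"] by (simp add: power2_eq_square del: of_real_diff of_real_mult)
  qed
  have 3: "2 * C * S = - \<i> * of_real (sin \<beta>)"
    using sin_double[of "\<beta> / 2"] by (simp add: assms algebra_simps)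
  have "mix (cnj C) (cnj S) u (\<lambda>s. (f u + g u * of_int (s u)) * mix C S u \<psi> s) s =
    f u * (C * C - S * S) * \<psi> s + g u * of_int (s u) * (C * C + S * S) * \<psi> s +
    g u * of_int (s u) * (2 * C * S) * \<psi> (s(u := - s u))"
    by (simp add: mix_def assms algebra_simps)
  also have "\<dots> = heis \<beta> f g u \<psi> s"
    unfolding 1 2 3 by (simp add: heis_def algebra_simps)
  finally show "mix (cnj C) (cnj S) u (\<lambda>s. (f u + g u * of_int (s u)) * mix C S u \<psi> s) s = heis \<beta> f g u \<psi> s" .
qed

text \<open>The factor at \<open>u\<close> commutes with the mixers of all other qubits, so the
  mixer at \<open>u\<close> can be moved across the inner product and closed around its own factor.
  Induction peels off one qubit at a time.\<close>

lemma fold_mix_moment: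
  assumes "distinct us" "set us \<subseteq> V"
    and C: "C = of_real (cos (\<beta> / 2))" "S = - \<i> * of_real (sin (\<beta> / 2))"
  shows "(\<Sum>s\<in>spins V. cnj (fold (mix C S) us \<phi> s) * ((\<Prod>v\<in>set us. f v + g v * of_int (s v)) * fold (mix C S) us \<psi> s)) =
    (\<Sum>s\<in>spins V. cnj (\<phi> s) * fold (heis \<beta> f g) us \<psi> s)"
  using assms(1,2)
proof (induction us arbitrary: \<phi> \<psi>)
  case (Cons u us)
  have u: "u \<notin> set us" "u \<in> V" using Cons.prems by auto
  define d where "d = (\<lambda>x :: int. f u + g u * of_int x)"
  define \<psi>' where "\<psi>' = (\<lambda>s. d (s u) * mix C S u \<psi> s)"
  have \<psi>': "fold (mix C S) us \<psi>' = (\<lambda>s. d (s u) * fold (mix C S) us (mix C S u \<psi>) s)"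
    unfolding \<psi>'_def by (rule fold_mix_diagonal_commute[OF u(1)])
  have "(\<Sum>s\<in>spins V. cnj (fold (mix C S) (u # us) \<phi> s) * ((\<Prod>v\<in>set (u # us). f v + g v * of_int (s v)) * fold (mix C S) (u # us) \<psi> s)) =
    (\<Sum>s\<in>spins V. cnj (fold (mix C S) us (mix C S u \<phi>) s) * ((\<Prod>v\<in>set us. f v + g v * of_int (s v)) * fold (mix C S) us \<psi>' s))"
    unfolding \<psi>' using u by (simp add: d_def mult_ac)
  also have "\<dots> = (\<Sum>s\<in>spins V. cnj (mix C S u \<phi> s) * fold (heis \<beta> f g) us \<psi>' s)"
    using Cons.prems by (intro Cons.IH) auto
  also have "\<dots> = (\<Sum>s\<in>spins V. cnj (\<phi> s) * mix (cnj C) (cnj S) u (fold (heis \<beta> f g) us \<psi>') s)"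
    by (rule mix_adjoint[OF u(2)])
  also have "mix (cnj C) (cnj S) u (fold (heis \<beta> f g) us \<psi>') = fold (heis \<beta> f g) us (mix (cnj C) (cnj S) u \<psi>')"
    by (rule mix_fold_heis_commute[OF u(1)])
  also have "mix (cnj C) (cnj S) u \<psi>' = heis \<beta> f g u \<psi>"
    unfolding \<psi>'_def d_def by (rule mix_conjugate[OF C])
  finally show ?case by simp
qed simp

lemma flip_insert: "u \<notin> T \<Longrightarrow> flip (insert u T) s = (flip T s)(u := - flip T s u)"
  by (auto simp: flip_def)

text \<open>Expansion of a product of sums: each qubit contributes either its diagonal or its
  flipping part, and \<open>T\<close> collects the qubits that flip.\<close>

lemma fold_heis_eq:
  assumes "distinct us"
  shows "fold (heis \<beta> f g) us \<psi> s =
    (\<Sum>T\<in>Pow (set us). (\<Prod>v\<in>set us. if v \<in> T then - g v * \<i> * of_real (sin \<beta>) * of_int (s v)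
        else f v + g v * of_real (cos \<beta>) * of_int (s v)) * \<psi> (flip T s))"
  using assms
proof (induction us arbitrary: \<psi> s)
  case (Cons u us)
  define W where "W = (\<lambda>T v. if v \<in> T then - g v * \<i> * of_real (sin \<beta>) * of_int (s v)
        else f v + g v * of_real (cos \<beta>) * of_int (s v))"
  have u: "u \<notin> set us" using Cons.prems by simp
  have IH: "fold (heis \<beta> f g) (u # us) \<psi> s = (\<Sum>T\<in>Pow (set us). prod (W T) (set us) * heis \<beta> f g u \<psi> (flip T s))"
    using Cons by (simp add: W_def)
  have inj: "inj_on (insert u) (Pow (set us))" using u by (auto simp: inj_on_def)
  have "(\<Sum>T\<in>Pow (set (u # us)). prod (W T) (set (u # us)) * \<psi> (flip T s)) =
     (\<Sum>T\<in>Pow (set us). prod (W T) (insert u (set us)) * \<psi> (flip T s)) +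
     (\<Sum>T\<in>insert u ` Pow (set us). prod (W T) (insert u (set us)) * \<psi> (flip T s))"
    unfolding set_simps Pow_insert using u by (intro sum.union_disjoint) auto
  also have "\<dots> = (\<Sum>T\<in>Pow (set us). prod (W T) (insert u (set us)) * \<psi> (flip T s) +
      prod (W (insert u T)) (insert u (set us)) * \<psi> (flip (insert u T) s))"
    by (simp add: sum.reindex[OF inj] sum.distrib)
  also have "\<dots> = (\<Sum>T\<in>Pow (set us). prod (W T) (set us) * heis \<beta> f g u \<psi> (flip T s))"
  proof (rule sum.cong[OF refl])
    fix T assume "T \<in> Pow (set us)"
    then have uT: "u \<notin> T" using u by auto
    have "prod (W (insert u T)) (set us) = prod (W T) (set us)"
      using u by (intro prod.cong) (auto simp: W_def)
    moreover have "W T u = f u + g u * of_real (cos \<beta>) * of_int (s u)"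
      "W (insert u T) u = - g u * \<i> * of_real (sin \<beta>) * of_int (s u)" "flip T s u = s u"
      using uT by (auto simp: W_def flip_def)
    ultimately show "prod (W T) (insert u (set us)) * \<psi> (flip T s) +
      prod (W (insert u T)) (insert u (set us)) * \<psi> (flip (insert u T) s) =
      prod (W T) (set us) * heis \<beta> f g u \<psi> (flip T s)"
      using u by (simp add: flip_insert[OF uT] heis_def algebra_simps)
  qed
  finally show ?case unfolding IH by (simp add: W_def)
qed simp

text \<open>The cost layer is diagonal, so it survives only as the phase difference between
  \<open>s\<close> and \<open>flip T s\<close>, the configurations on the two sides of the inner
  product.\<close>

lemma qaoa_moment:
  assumes V: "finite V"
  shows "(\<Sum>s\<in>spins V. (\<Prod>v\<in>V. f v + g v * of_int (s v)) * of_real ((cmod (qaoa_state \<beta> \<gamma> V E s))\<^sup>2)) =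
    (\<Sum>s\<in>spins V. \<Sum>T\<in>Pow V. (\<Prod>v\<in>V. if v \<in> T then - g v * \<i> * of_real (sin \<beta>) * of_int (s v)
        else f v + g v * of_real (cos \<beta>) * of_int (s v)) *
        exp (\<i> * of_real (\<gamma> / 2 * of_int (ising E s - ising E (flip T s))))) / 2 ^ card V"
proof -
  define us where "us = sorted_list_of_set V"
  have us: "distinct us" "set us = V" using V by (auto simp: us_def)
  define \<phi> :: qstate where
    "\<phi> = (\<lambda>s. exp (- (\<i> * of_real \<gamma> / 2) * of_int (ising E s)) / of_real (sqrt (2 ^ card V)))"
  define C S where "C = (of_real (cos (\<beta> / 2)) :: complex)" and "S = - \<i> * of_real (sin (\<beta> / 2))"
  have \<psi>: "qaoa_state \<beta> \<gamma> V E = fold (mix C S) us \<phi>"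
    unfolding qaoa_state_eq[OF V] C_def S_def \<phi>_def us_def by simp
  have ph: "cnj (\<phi> s) * \<phi> r = exp (\<i> * of_real (\<gamma> / 2 * of_int (ising E s - ising E r))) / 2 ^ card V" for s r
  proof -
    have "of_real (sqrt (2 ^ card V)) * of_real (sqrt (2 ^ card V)) = (2 ^ card V :: complex)"
      by (simp flip: of_real_mult)
    moreover have "cnj (exp (- (\<i> * of_real \<gamma> / 2) * of_int (ising E s))) = exp (\<i> * of_real \<gamma> / 2 * of_int (ising E s))"
      by (simp add: exp_cnj)
    moreover have "exp (\<i> * of_real (\<gamma> / 2 * of_int (ising E s - ising E r))) =
        exp (\<i> * of_real \<gamma> / 2 * of_int (ising E s)) * exp (- (\<i> * of_real \<gamma> / 2) * of_int (ising E r))"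
      by (subst exp_add[symmetric]) (simp add: algebra_simps diff_divide_distrib)
    ultimately show ?thesis by (simp add: \<phi>_def)
  qed
  have "(\<Sum>s\<in>spins V. (\<Prod>v\<in>V. f v + g v * of_int (s v)) * of_real ((cmod (qaoa_state \<beta> \<gamma> V E s))\<^sup>2)) =
     (\<Sum>s\<in>spins V. cnj (fold (mix C S) us \<phi> s) * ((\<Prod>v\<in>set us. f v + g v * of_int (s v)) * fold (mix C S) us \<phi> s))"
    unfolding \<psi> us complex_norm_square by (simp add: mult_ac)
  also have "\<dots> = (\<Sum>s\<in>spins V. cnj (\<phi> s) * fold (heis \<beta> f g) us \<phi> s)"
    using us by (intro fold_mix_moment[OF _ _ C_def S_def]) auto
  also have "\<dots> = (\<Sum>s\<in>spins V. \<Sum>T\<in>Pow V. (\<Prod>v\<in>V. if v \<in> T then - g v * \<i> * of_real (sin \<beta>) * of_int (s v)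
        else f v + g v * of_real (cos \<beta>) * of_int (s v)) * (cnj (\<phi> s) * \<phi> (flip T s)))"
    by (simp add: fold_heis_eq[OF us(1)] us(2) sum_distrib_left mult_ac)
  finally show ?thesis unfolding ph by (simp add: sum_divide_distrib)
qed

section \<open>Energies as moments of a classical distribution\<close>

definition moment :: "nat set \<Rightarrow> qstate \<Rightarrow> ((nat \<Rightarrow> int) \<Rightarrow> real) \<Rightarrow> real" where
  "moment V \<psi> f = (\<Sum>s\<in>spins V. f s * (cmod (\<psi> s))\<^sup>2)"

lemma moment_diff: "moment V \<psi> (\<lambda>s. f s - g s) = moment V \<psi> f - moment V \<psi> g"
  by (simp add: moment_def algebra_simps sum_subtractf)

lemma moment_sum: "moment V \<psi> (\<lambda>s. \<Sum>i\<in>I. f i s) = (\<Sum>i\<in>I. moment V \<psi> (f i))"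
  unfolding moment_def by (simp add: sum_distrib_right sum.swap[of _ I])

lemma moment_cmult: "moment V \<psi> (\<lambda>s. k * f s) = k * moment V \<psi> f"
  by (simp add: moment_def sum_distrib_left mult_ac)

lemma moment_cong:
  "(\<And>s. s \<in> spins V \<Longrightarrow> f s = g s) \<Longrightarrow> moment V \<psi> f = moment V \<psi> g"
  by (simp add: moment_def)

lemma moment_mono:
  "(\<And>s. s \<in> spins V \<Longrightarrow> f s \<le> g s) \<Longrightarrow> moment V \<psi> f \<le> moment V \<psi> g"
  unfolding moment_def by (intro sum_mono mult_right_mono) auto

definition cut_value :: "nat multiset multiset \<Rightarrow> (nat \<Rightarrow> int) \<Rightarrow> real" where
  "cut_value E s = (real (size E) - of_int (ising E s)) / 2"

lemma maxcut_hamiltonian_eq: "maxcut_hamiltonian E \<psi> s = of_real (cut_value E s) * \<psi> s"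
proof (induction E)
  case empty
  then show ?case by (simp add: maxcut_hamiltonian_def cut_value_def ising_def)
next
  case (add e E)
  have "maxcut_hamiltonian (add_mset e E) \<psi> s = (\<psi> s - ZZ e \<psi> s) / 2 + maxcut_hamiltonian E \<psi> s"
    by (simp add: maxcut_hamiltonian_def)
  also have "\<dots> = of_real (cut_value (add_mset e E) s) * \<psi> s"
    unfolding add by (simp add: ZZ_eq cut_value_def ising_def field_simps)
  finally show ?case .
qed

lemma projector_eq:
  assumes "finite V0"
  shows "projector V0 \<sigma> \<psi> s = of_real (\<Prod>v\<in>V0. (1 + of_int (\<sigma> v * s v)) / 2) * \<psi> s"
proof -
  interpret comp_fun_commute "\<lambda>v \<phi> s. (\<phi> s + of_int (\<sigma> v) * pauli_Z v \<phi> s) / 2"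
    by unfold_locales (auto simp: pauli_Z_def fun_eq_iff field_simps)
  show ?thesis
    unfolding projector_def using assms
  proof (induction V0)
    case (insert v V0)
    then show ?case by (subst fold_insert) (simp_all add: pauli_Z_def field_simps)
  qed simp
qed

lemma braket_self: "braket V \<psi> (\<lambda>s. of_real (f s) * \<psi> s) = of_real (moment V \<psi> f)"
  unfolding braket_def moment_def
  by (simp add: complex_norm_square mult_ac del: of_real_power)

lemma energy_eq: "energy V E \<psi> = moment V \<psi> (cut_value E)"
proof -
  have "maxcut_hamiltonian E \<psi> = (\<lambda>s. of_real (cut_value E s) * \<psi> s)"
    by (simp add: maxcut_hamiltonian_eq fun_eq_iff)
  then show ?thesis by (simp add: energy_def braket_self)
qed

text \<open>On \<open>spins V\<close> the product is the indicator of \<open>s\<close> agreeing with \<open>\<sigma>\<close> on \<open>V0\<close>.\<close>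

definition agree :: "nat set \<Rightarrow> (nat \<Rightarrow> int) \<Rightarrow> (nat \<Rightarrow> int) \<Rightarrow> real" where
  "agree V0 \<sigma> s = (\<Prod>v\<in>V0. (1 + of_int (\<sigma> v * s v)) / 2)"

lemma agree_idem:
  assumes "\<sigma> \<in> spins V0" "s \<in> spins V" "V0 \<subseteq> V"
  shows "agree V0 \<sigma> s * agree V0 \<sigma> s = agree V0 \<sigma> s"
  unfolding agree_def prod.distrib[symmetric]
proof (rule prod.cong[OF refl])
  fix x assume "x \<in> V0"
  then have "\<sigma> x = -1 \<or> \<sigma> x = 1" "s x = -1 \<or> s x = 1"
    using spins_mem[OF assms(1)] spins_mem[OF assms(2)] assms(3) by auto
  then show "(1 + real_of_int (\<sigma> x * s x)) / 2 * ((1 + real_of_int (\<sigma> x * s x)) / 2) = (1 + real_of_int (\<sigma> x * s x)) / 2"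
    by auto
qed

lemma agree_nonneg:
  assumes "\<sigma> \<in> spins V0" "s \<in> spins V" "V0 \<subseteq> V"
  shows "agree V0 \<sigma> s \<ge> 0"
  using agree_idem[OF assms] by (metis zero_le_square)

lemma projected_energy_eq:
  assumes "finite V0" "\<sigma> \<in> spins V0" "V0 \<subseteq> V"
  shows "projected_energy V E V0 \<sigma> \<psi> =
    moment V \<psi> (\<lambda>s. agree V0 \<sigma> s * cut_value E s) / moment V \<psi> (agree V0 \<sigma>)"
proof -
  have P: "projector V0 \<sigma> \<phi> = (\<lambda>s. of_real (agree V0 \<sigma> s) * \<phi> s)" for \<phi>
    using projector_eq[OF assms(1)] by (simp add: agree_def fun_eq_iff)
  have "projector V0 \<sigma> (maxcut_hamiltonian E (projector V0 \<sigma> \<psi>)) =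
    (\<lambda>s. of_real (agree V0 \<sigma> s * (cut_value E s * agree V0 \<sigma> s)) * \<psi> s)"
    by (simp add: P maxcut_hamiltonian_eq fun_eq_iff)
  moreover have "moment V \<psi> (\<lambda>s. agree V0 \<sigma> s * (cut_value E s * agree V0 \<sigma> s)) =
    moment V \<psi> (\<lambda>s. agree V0 \<sigma> s * cut_value E s)"
    using agree_idem[OF assms(2) _ assms(3)] by (intro moment_cong) (auto simp: mult_ac)
  moreover have "(qnorm V (projector V0 \<sigma> \<psi>))\<^sup>2 = moment V \<psi> (agree V0 \<sigma>)"
  proof -
    have "braket V (projector V0 \<sigma> \<psi>) (projector V0 \<sigma> \<psi>) =
       of_real (moment V \<psi> (\<lambda>s. agree V0 \<sigma> s * agree V0 \<sigma> s))"
      unfolding braket_self[symmetric] by (simp add: braket_def P mult_ac)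
    also have "moment V \<psi> (\<lambda>s. agree V0 \<sigma> s * agree V0 \<sigma> s) = moment V \<psi> (agree V0 \<sigma>)"
      using agree_idem[OF assms(2) _ assms(3)] by (intro moment_cong)
    finally have "braket V (projector V0 \<sigma> \<psi>) (projector V0 \<sigma> \<psi>) = of_real (moment V \<psi> (agree V0 \<sigma>))" .
    moreover have "moment V \<psi> (agree V0 \<sigma>) \<ge> 0"
      unfolding moment_def using agree_nonneg[OF assms(2) _ assms(3)] by (intro sum_nonneg) auto
    ultimately show ?thesis by (simp add: qnorm_def)
  qed
  ultimately show ?thesis
    unfolding projected_energy_def by (simp only: braket_self Re_complex_of_real)
qed

section \<open>Reduction to independent stars\<close>

locale matched_stars =
  fixes n :: nat and V0 :: "nat set" and M :: "half_edge set set" and \<beta> \<gamma> :: real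
  assumes M': "M \<in> perfect_matchings (half_edges {1..n} 3)"
    and V0': "V0 \<subseteq> {1..n}"
    and ind: "two_independent 3 M V0"
begin

definition "V = {1..n}"
definition "H = half_edges V 3"

lemma M: "M \<in> perfect_matchings H" and V0: "V0 \<subseteq> V"
  using M' V0' by (auto simp: H_def V_def)

lemma finite_V [simp, intro]: "finite V" and card_V [simp]: "card V = n"
  by (auto simp: V_def)

abbreviation "\<mu> \<equiv> partner M"
definition "nb h = fst (partner M h)"

lemma finite_V0 [simp, intro]: "finite V0"
  using V0 finite_subset by auto

lemma finite_H [simp, intro]: "finite H"
  by (simp add: H_def half_edges_def)

lemma mem_H: "h \<in> H \<longleftrightarrow> fst h \<in> V \<and> snd h \<in> {1..3}"
  by (cases h) (auto simp: H_def half_edges_def)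

lemma \<mu>_H [simp]: "h \<in> H \<Longrightarrow> \<mu> h \<in> H"
  by (rule partner_mem[OF M])

lemma \<mu>_\<mu> [simp]: "h \<in> H \<Longrightarrow> \<mu> (\<mu> h) = h"
  by (rule partner_partner[OF M])

lemma nb_\<mu> [simp]: "h \<in> H \<Longrightarrow> nb (\<mu> h) = fst h"
  by (simp add: nb_def)

lemma nb_V [simp]: "h \<in> H \<Longrightarrow> nb h \<in> V"
  using \<mu>_H[of h] unfolding nb_def mem_H by blast

lemma fst_V: "h \<in> H \<Longrightarrow> fst h \<in> V"
  using mem_H by blast

lemma nb_V0: "h \<in> H \<Longrightarrow> fst h \<in> V0 \<Longrightarrow> nb h \<notin> V0"
  using ind unfolding two_independent_def nb_def half_edges_def H_def by (cases h) auto

lemma nb_inj: "h \<in> H \<Longrightarrow> h' \<in> H \<Longrightarrow> fst h \<in> V0 \<Longrightarrow> fst h' \<in> V0 \<Longrightarrow> nb h = nb h' \<Longrightarrow> h = h'"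
  using ind unfolding two_independent_def nb_def half_edges_def H_def by (cases h, cases h') (auto simp: inj_on_def)

abbreviation "E \<equiv> multigraph_of M"
abbreviation "\<psi> \<equiv> qaoa_state \<beta> \<gamma> V E"
text \<open>For spins +1 or -1 this is exp(i \<gamma> s s'). The affine form in the product of the
  spins is chosen because averaging over one end then leaves \<open>cos \<gamma>\<close>.\<close>

definition "w s h = of_real (cos \<gamma>) + \<i> * of_real (sin \<gamma>) * of_int (s (fst h) * s (nb h))"

lemma ising_eq: "ising E s = (\<Sum>p\<in>M. \<Prod>h\<in>p. s (fst h))"
proof -
  have "ising E s = (\<Sum>p\<in>M. \<Prod>\<^sub># (image_mset s (image_mset fst (mset_set p))))"
    unfolding ising_def multigraph_of_def
    using finite_perfect_matching[OF M finite_H] by (simp add: image_mset.compositionality o_def sum_unfold_sum_mset)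
  then show ?thesis by (simp add: image_mset.compositionality o_def prod_unfold_prod_mset)
qed

lemma pair_cases:
  assumes "p \<in> M"
  obtains h where "h \<in> H" "p = {h, \<mu> h}" "\<mu> h \<noteq> h"
  using assms perfect_matching_eq_image[OF M] partner_neq[OF M] by blast

text \<open>Exactly the terms of edges with one end in \<open>T\<close> change sign. Each such edge
  is listed once, through its half-edge inside \<open>T\<close>.\<close>

lemma exp_ising_flip:
  assumes s: "s \<in> spins V"
  shows "exp (\<i> * of_real (\<gamma> / 2 * of_int (ising E s - ising E (flip T s)))) =
    (\<Prod>h\<in>{h\<in>H. fst h \<in> T \<and> nb h \<notin> T}. w s h)"
proof -
  define X where "X = {h\<in>H. fst h \<in> T \<and> nb h \<notin> T}"
  define d where "d = (\<lambda>p :: half_edge set. (\<Prod>h\<in>p. s (fst h)) - (\<Prod>h\<in>p. flip T s (fst h)))"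
  have d_pair: "d {h, \<mu> h} = s (fst h) * s (nb h) - flip T s (fst h) * flip T s (nb h)" if "h \<in> H" for h
    using partner_neq[OF M that] by (simp add: d_def nb_def)
  have inj: "inj_on (\<lambda>h. {h, \<mu> h}) X"
  proof (rule inj_onI)
    fix h h' assume "h \<in> X" "h' \<in> X" and eq: "{h, \<mu> h} = {h', \<mu> h'}"
    then show "h = h'" unfolding X_def nb_def doubleton_eq_iff by auto
  qed
  have zero: "d p = 0" if "p \<in> M - (\<lambda>h. {h, \<mu> h}) ` X" for p
  proof -
    from that obtain h where h: "h \<in> H" "p = {h, \<mu> h}" by (auto elim: pair_cases)
    have "h \<notin> X" using that h by auto
    moreover have "\<mu> h \<notin> X"
    proof
      assume "\<mu> h \<in> X"
      then have "{\<mu> h, \<mu> (\<mu> h)} \<in> (\<lambda>h. {h, \<mu> h}) ` X" by (rule imageI)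
      then show False using that h by (simp add: insert_commute)
    qed
    ultimately
    have "fst h \<in> T \<longleftrightarrow> nb h \<in> T" using h(1) by (auto simp: X_def nb_def)
    then show ?thesis unfolding h(2) d_pair[OF h(1)] by (auto simp: flip_def)
  qed
  have "ising E s - ising E (flip T s) = (\<Sum>p\<in>M. d p)"
    by (simp add: ising_eq d_def sum_subtractf)
  also have "\<dots> = (\<Sum>p\<in>(\<lambda>h. {h, \<mu> h}) ` X. d p)"
    by (rule sum.mono_neutral_right[OF finite_perfect_matching[OF M finite_H]])
       (use zero partner_in[OF M] in \<open>auto simp: X_def\<close>)
  also have "\<dots> = (\<Sum>h\<in>X. d {h, \<mu> h})" using inj by (simp add: sum.reindex)
  also have "\<dots> = (\<Sum>h\<in>X. 2 * (s (fst h) * s (nb h)))"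
    by (rule sum.cong) (auto simp: X_def d_pair flip_def)
  finally have eq: "ising E s - ising E (flip T s) = (\<Sum>h\<in>X. 2 * (s (fst h) * s (nb h)))" .
  have "exp (\<i> * of_real (\<gamma> / 2 * of_int (ising E s - ising E (flip T s)))) =
     exp (\<Sum>h\<in>X. \<i> * of_real (\<gamma> * of_int (s (fst h) * s (nb h))))"
    unfolding eq by (simp add: sum_distrib_left mult_ac)
  also have "\<dots> = (\<Prod>h\<in>X. exp (\<i> * of_real (\<gamma> * of_int (s (fst h) * s (nb h)))))"
    by (rule exp_sum) (simp add: X_def)
  also have "\<dots> = (\<Prod>h\<in>X. w s h)"
  proof (rule prod.cong[OF refl])
    fix h assume "h \<in> X"
    then have "fst h \<in> V" "nb h \<in> V" using fst_V by (auto simp: X_def)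
    then have "s (fst h) * s (nb h) = 1 \<or> s (fst h) * s (nb h) = -1"
      using spins_mem[OF s, of "fst h"] spins_mem[OF s, of "nb h"] by auto
    then show "exp (\<i> * of_real (\<gamma> * of_int (s (fst h) * s (nb h)))) = w s h"
      unfolding w_def cis_conv_exp[symmetric] by (auto simp: complex_eq_iff simp del: of_int_mult)
  qed
  finally show ?thesis by (simp add: X_def)
qed

text \<open>Contribution of the star at \<open>x\<close> when \<open>T\<close> is the set of flips
  outside \<open>V0\<close>. The first term has \<open>x\<close> unflipped, so its edges into
  \<open>T\<close> change sign; in the second \<open>x\<close> is flipped and the other edges
  do.\<close>

definition K :: "(nat \<Rightarrow> real) \<Rightarrow> (nat \<Rightarrow> real) \<Rightarrow> nat set \<Rightarrow> nat \<Rightarrow> (nat \<Rightarrow> int) \<Rightarrow> complex" where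
  "K A B T x s = (of_real (A x) + of_real (B x) * of_real (cos \<beta>) * of_int (s x)) *
       (\<Prod>i\<in>{1..3}. if nb (x, i) \<in> T then w s (x, i) else 1)
     - of_real (B x) * \<i> * of_real (sin \<beta>) * of_int (s x) *
       (\<Prod>i\<in>{1..3}. if nb (x, i) \<in> T then 1 else w s (x, i))"

lemma w_\<mu>: "h \<in> H \<Longrightarrow> w s (\<mu> h) = w s h"
  by (simp add: w_def nb_def mult.commute)

text \<open>No edge joins two vertices of \<open>V0\<close>, so a crossing edge either avoids
  \<open>V0\<close> or belongs to exactly one star.\<close>

lemma crossing_split:
  assumes T: "T \<subseteq> V - V0" and U: "U \<subseteq> V0"
  shows "(\<Prod>h\<in>{h\<in>H. fst h \<in> T \<union> U \<and> nb h \<notin> T \<union> U}. w s h) =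
    (\<Prod>h\<in>{h\<in>H. fst h \<in> T \<and> nb h \<notin> T \<union> V0}. w s h) *
    ((\<Prod>x\<in>U. \<Prod>i\<in>{1..3}. if nb (x, i) \<in> T then 1 else w s (x, i)) *
     (\<Prod>x\<in>V0 - U. \<Prod>i\<in>{1..3}. if nb (x, i) \<in> T then w s (x, i) else 1))"
proof -
  define X1 X2 X3 where "X1 = {h\<in>H. fst h \<in> T \<and> nb h \<notin> T \<union> V0}"
    and "X2 = {h\<in>H. fst h \<in> U \<and> nb h \<notin> T}" and "X3 = {h\<in>H. fst h \<in> T \<and> nb h \<in> V0 - U}"
  have fin: "finite X1" "finite X2" "finite X3" by (auto simp: X1_def X2_def X3_def)
  have "{h\<in>H. fst h \<in> T \<union> U \<and> nb h \<notin> T \<union> U} = X1 \<union> (X2 \<union> X3)"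
    using T U nb_V0 unfolding X1_def X2_def X3_def by blast
  moreover have "X1 \<inter> (X2 \<union> X3) = {}" "X2 \<inter> X3 = {}"
    using T U by (auto simp: X1_def X2_def X3_def)
  ultimately have 1: "(\<Prod>h\<in>{h\<in>H. fst h \<in> T \<union> U \<and> nb h \<notin> T \<union> U}. w s h) = prod (w s) X1 * (prod (w s) X2 * prod (w s) X3)"
    using fin by (simp add: prod.union_disjoint)
  have UV: "U \<subseteq> V" using U V0 by auto
  have finU: "finite U" using U finite_subset by auto
  have 2: "prod (w s) X2 = (\<Prod>x\<in>U. \<Prod>i\<in>{1..3}. if nb (x, i) \<in> T then 1 else w s (x, i))"
  proof -
    have "prod (w s) X2 = (\<Prod>h\<in>U \<times> {1..3}. if nb h \<in> T then 1 else w s h)"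
      using UV finU by (intro prod.mono_neutral_cong_left) (auto simp: X2_def H_def half_edges_def)
    then show ?thesis by (simp add: prod.cartesian_product split_def cong: if_cong)
  qed
  have 3: "prod (w s) X3 = (\<Prod>x\<in>V0 - U. \<Prod>i\<in>{1..3}. if nb (x, i) \<in> T then w s (x, i) else 1)"
  proof -
    have "prod (w s) X3 = prod (w s) {h\<in>H. fst h \<in> V0 - U \<and> nb h \<in> T}"
      by (rule prod.reindex_bij_witness[of _ \<mu> \<mu>]) (auto simp: X3_def w_\<mu> nb_def)
    also have "\<dots> = (\<Prod>h\<in>(V0 - U) \<times> {1..3}. if nb h \<in> T then w s h else 1)"
      using V0 by (intro prod.mono_neutral_cong_left) (auto simp: H_def half_edges_def)
    finally show ?thesis by (simp add: prod.cartesian_product split_def cong: if_cong)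
  qed
  show ?thesis unfolding 1 2 3 X1_def by simp
qed

text \<open>Summing over the part of the flipped set inside \<open>V0\<close> factorizes over the stars, since
  distinct stars share no edge.\<close>

lemma moment_stars:
  assumes D: "D \<subseteq> V - V0"
  shows "of_real (moment V \<psi> (\<lambda>s. (\<Prod>v\<in>D. of_int (s v)) * (\<Prod>x\<in>V0. A x + B x * of_int (s x)))) =
    (\<Sum>T\<in>Pow D. of_real (cos \<beta>) ^ card (D - T) * (- \<i> * of_real (sin \<beta>)) ^ card T *
      ((\<Sum>s\<in>spins V. (\<Prod>v\<in>D. of_int (s v)) * (\<Prod>h\<in>{h\<in>H. fst h \<in> T \<and> nb h \<notin> T \<union> V0}. w s h) *
         (\<Prod>x\<in>V0. K A B T x s)) / 2 ^ n))"
proof -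
  \<comment> \<open>One affine function per spin: the factor of the star on \<open>V0\<close>, the
    spin itself on \<open>D\<close>, and the constant 1 elsewhere. A constant factor has no flipping
    part, so qubits outside \<open>D\<close> and \<open>V0\<close> never flip.\<close>
  define f g :: "nat \<Rightarrow> complex" where "f = (\<lambda>v. if v \<in> V0 then of_real (A v) else if v \<in> D then 0 else 1)"
    and "g = (\<lambda>v. if v \<in> V0 then of_real (B v) else if v \<in> D then 1 else 0)"
  define c y :: complex where "c = of_real (cos \<beta>)" and "y = - \<i> * of_real (sin \<beta>)"
  have finD: "finite D" using D finite_subset[OF _ finite_V] by blast
  have split: "(\<Prod>v\<in>V. F v) = (\<Prod>v\<in>D. F v) * (\<Prod>x\<in>V0. F x)"
    if "\<And>v. v \<in> V - (D \<union> V0) \<Longrightarrow> F v = 1" for F :: "nat \<Rightarrow> complex"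
  proof -
    have "(\<Prod>v\<in>V. F v) = (\<Prod>v\<in>D \<union> V0. F v)"
      using D V0 that by (intro prod.mono_neutral_right) auto
    also have "\<dots> = (\<Prod>v\<in>D. F v) * (\<Prod>x\<in>V0. F x)"
      using D finD by (intro prod.union_disjoint) auto
    finally show ?thesis .
  qed
  define W where "W = (\<lambda>s T v. if v \<in> T then - g v * \<i> * of_real (sin \<beta>) * of_int (s v)
        else f v + g v * of_real (cos \<beta>) * of_int (s v))"
  define ex where "ex = (\<lambda>s T. exp (\<i> * of_real (\<gamma> / 2 * of_int (ising E s - ising E (flip T s)))))"
  have "of_real (moment V \<psi> (\<lambda>s. (\<Prod>v\<in>D. of_int (s v)) * (\<Prod>x\<in>V0. A x + B x * of_int (s x)))) =
    (\<Sum>s\<in>spins V. (\<Prod>v\<in>V. f v + g v * of_int (s v)) * of_real ((cmod (\<psi> s))\<^sup>2))"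
  proof -
    have "(\<Prod>v\<in>V. f v + g v * of_int (s v)) = of_real ((\<Prod>v\<in>D. of_int (s v)) * (\<Prod>x\<in>V0. A x + B x * of_int (s x)))" for s
    proof -
      have "(\<Prod>v\<in>V. f v + g v * of_int (s v)) = (\<Prod>v\<in>D. f v + g v * of_int (s v)) * (\<Prod>x\<in>V0. f x + g x * of_int (s x))"
        by (rule split) (auto simp: f_def g_def)
      also have "(\<Prod>v\<in>D. f v + g v * of_int (s v)) = (\<Prod>v\<in>D. of_int (s v))"
        using D by (intro prod.cong) (auto simp: f_def g_def)
      also have "(\<Prod>x\<in>V0. f x + g x * of_int (s x)) = (\<Prod>x\<in>V0. of_real (A x + B x * of_int (s x)))"
        by (intro prod.cong) (auto simp: f_def g_def)
      finally show ?thesis by simp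
    qed
    then show ?thesis by (simp add: moment_def)
  qed
  also have "\<dots> = (\<Sum>s\<in>spins V. \<Sum>T\<in>Pow V. prod (W s T) V * ex s T) / 2 ^ n"
    unfolding W_def ex_def by (subst qaoa_moment) auto
  also have "(\<Sum>s\<in>spins V. \<Sum>T\<in>Pow V. prod (W s T) V * ex s T) =
     (\<Sum>s\<in>spins V. \<Sum>T\<in>Pow D. \<Sum>U\<in>Pow V0. prod (W s (T \<union> U)) V * ex s (T \<union> U))"
  proof (rule sum.cong[OF refl])
    fix s
    have "(\<Sum>T\<in>Pow V. prod (W s T) V * ex s T) = (\<Sum>T\<in>Pow (D \<union> V0). prod (W s T) V * ex s T)"
    proof (rule sum.mono_neutral_right)
      show "\<forall>T\<in>Pow V - Pow (D \<union> V0). prod (W s T) V * ex s T = 0"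
      proof
        fix T assume "T \<in> Pow V - Pow (D \<union> V0)"
        then obtain v where "v \<in> V" "v \<in> T" "v \<notin> D" "v \<notin> V0" by auto
        then have "prod (W s T) V = 0" by (auto simp: W_def g_def intro!: prod_zero bexI[of _ v])
        then show "prod (W s T) V * ex s T = 0" by simp
      qed
    qed (use D V0 in auto)
    also have "\<dots> = (\<Sum>(T, U)\<in>Pow D \<times> Pow V0. prod (W s (T \<union> U)) V * ex s (T \<union> U))"
    proof (rule sum.reindex_bij_witness[of _ "\<lambda>(T, U). T \<union> U" "\<lambda>T. (T \<inter> D, T \<inter> V0)"])
      fix T assume "T \<in> Pow (D \<union> V0)"
      then have "T \<inter> D \<union> T \<inter> V0 = T" by auto
      then show "(case (T \<inter> D, T \<inter> V0) of (T, U) \<Rightarrow> T \<union> U) = T"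
        "(case (T \<inter> D, T \<inter> V0) of (T, U) \<Rightarrow> prod (W s (T \<union> U)) V * ex s (T \<union> U)) = prod (W s T) V * ex s T"
        by simp_all
    qed (use D in auto)
    also have "\<dots> = (\<Sum>T\<in>Pow D. \<Sum>U\<in>Pow V0. prod (W s (T \<union> U)) V * ex s (T \<union> U))"
      by (rule sum.cartesian_product[symmetric])
    finally show "(\<Sum>T\<in>Pow V. prod (W s T) V * ex s T) = (\<Sum>T\<in>Pow D. \<Sum>U\<in>Pow V0. prod (W s (T \<union> U)) V * ex s (T \<union> U))" .
  qed
  also have "\<dots> = (\<Sum>s\<in>spins V. \<Sum>T\<in>Pow D. c ^ card (D - T) * y ^ card T *
      ((\<Prod>v\<in>D. of_int (s v)) * (\<Prod>h\<in>{h\<in>H. fst h \<in> T \<and> nb h \<notin> T \<union> V0}. w s h) *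
         (\<Prod>x\<in>V0. K A B T x s)))"
  proof (intro sum.cong[OF refl])
    fix s T assume s: "s \<in> spins V" and T: "T \<in> Pow D"
    define R where "R = (\<Prod>h\<in>{h\<in>H. fst h \<in> T \<and> nb h \<notin> T \<union> V0}. w s h)"
    define F G where "F = (\<lambda>x. y * of_real (B x) * of_int (s x) * (\<Prod>i\<in>{1..3}. if nb (x, i) \<in> T then 1 else w s (x, i)))"
      and "G = (\<lambda>x. (of_real (A x) + of_real (B x) * c * of_int (s x)) * (\<Prod>i\<in>{1..3}. if nb (x, i) \<in> T then w s (x, i) else 1))"
    have finT: "finite T" "T \<subseteq> D" using T finD finite_subset by auto
    have "prod (W s (T \<union> U)) V * ex s (T \<union> U) =
       (c ^ card (D - T) * y ^ card T * (\<Prod>v\<in>D. of_int (s v))) * R * (prod F U * prod G (V0 - U))" if "U \<in> Pow V0" for U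
    proof -
      have U: "U \<subseteq> V0" using that by auto
      have finU: "finite U" using U finite_subset by auto
      have "prod (W s (T \<union> U)) V = prod (W s (T \<union> U)) D * prod (W s (T \<union> U)) V0"
        using U finT by (intro split) (auto simp: W_def f_def g_def)
      also have "prod (W s (T \<union> U)) D = c ^ card (D - T) * y ^ card T * (\<Prod>v\<in>D. of_int (s v))"
      proof -
        have "prod (W s (T \<union> U)) D = (\<Prod>v\<in>D. (if v \<in> T then y else c) * of_int (s v))"
          using D U by (intro prod.cong) (auto simp: W_def f_def g_def c_def y_def)
        also have "\<dots> = (\<Prod>v\<in>D. if v \<in> T then y else c) * (\<Prod>v\<in>D. of_int (s v))"
          by (rule prod.distrib)
        also have "(\<Prod>v\<in>D. if v \<in> T then y else c) = y ^ card T * c ^ card (D - T)"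
          using prod.If_cases[OF finD, of "\<lambda>v. v \<in> T" "\<lambda>_. y" "\<lambda>_. c"] finT
          by (simp add: Int_absorb1 Diff_eq)
        finally show ?thesis by (simp add: mult_ac)
      qed
      also have "prod (W s (T \<union> U)) V0 = (\<Prod>x\<in>U. y * of_real (B x) * of_int (s x)) *
         (\<Prod>x\<in>V0 - U. of_real (A x) + of_real (B x) * c * of_int (s x))"
      proof -
        have "prod (W s (T \<union> U)) V0 = prod (W s (T \<union> U)) (V0 - U) * prod (W s (T \<union> U)) U"
          by (rule prod.subset_diff[OF U finite_V0])
        also have "prod (W s (T \<union> U)) (V0 - U) = (\<Prod>x\<in>V0 - U. of_real (A x) + of_real (B x) * c * of_int (s x))"
          using D finT by (intro prod.cong) (auto simp: W_def f_def g_def c_def)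
        also have "prod (W s (T \<union> U)) U = (\<Prod>x\<in>U. y * of_real (B x) * of_int (s x))"
          using U by (intro prod.cong) (auto simp: W_def f_def g_def y_def)
        finally show ?thesis by (simp add: mult_ac)
      qed
      finally have 1: "prod (W s (T \<union> U)) V = c ^ card (D - T) * y ^ card T * (\<Prod>v\<in>D. of_int (s v)) *
        ((\<Prod>x\<in>U. y * of_real (B x) * of_int (s x)) * (\<Prod>x\<in>V0 - U. of_real (A x) + of_real (B x) * c * of_int (s x)))" .
      have "ex s (T \<union> U) = R *
        ((\<Prod>x\<in>U. \<Prod>i\<in>{1..3}. if nb (x, i) \<in> T then 1 else w s (x, i)) *
         (\<Prod>x\<in>V0 - U. \<Prod>i\<in>{1..3}. if nb (x, i) \<in> T then w s (x, i) else 1))"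
        unfolding ex_def R_def exp_ising_flip[OF s] using D finT U by (intro crossing_split) auto
      then show ?thesis unfolding 1 F_def G_def prod.distrib by (simp add: mult_ac)
    qed
    then have "(\<Sum>U\<in>Pow V0. prod (W s (T \<union> U)) V * ex s (T \<union> U)) =
      (c ^ card (D - T) * y ^ card T * (\<Prod>v\<in>D. of_int (s v))) * R * (\<Sum>U\<in>Pow V0. prod F U * prod G (V0 - U))"
      by (simp add: sum_distrib_left)
    also have "(\<Sum>U\<in>Pow V0. prod F U * prod G (V0 - U)) = (\<Prod>x\<in>V0. F x + G x)"
      by (rule prod_add[symmetric]) simp
    also have "\<dots> = (\<Prod>x\<in>V0. K A B T x s)"
      by (intro prod.cong) (auto simp: F_def G_def K_def c_def y_def)
    finally show "(\<Sum>U\<in>Pow V0. prod (W s (T \<union> U)) V * ex s (T \<union> U)) =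
      c ^ card (D - T) * y ^ card T * ((\<Prod>v\<in>D. of_int (s v)) * (\<Prod>h\<in>{h\<in>H. fst h \<in> T \<and> nb h \<notin> T \<union> V0}. w s h) *
         (\<Prod>x\<in>V0. K A B T x s))"
      by (simp add: R_def mult_ac)
  qed
  finally show ?thesis
    unfolding c_def y_def by (subst (asm) sum.swap) (simp add: sum_distrib_left sum_divide_distrib)
qed

end

section \<open>Integrating out spins\<close>

definition indep_of :: "((nat \<Rightarrow> int) \<Rightarrow> complex) \<Rightarrow> nat set \<Rightarrow> bool" where
  "indep_of f X \<longleftrightarrow> (\<forall>s. \<forall>v\<in>X. \<forall>k. f (s(v := k)) = f s)"

lemma indep_ofD: "indep_of f X \<Longrightarrow> v \<in> X \<Longrightarrow> f (s(v := k)) = f s"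
  by (auto simp: indep_of_def)

lemma indep_of_mult: "indep_of f X \<Longrightarrow> indep_of g X \<Longrightarrow> indep_of (\<lambda>s. f s * g s) X"
  by (simp add: indep_of_def)

lemma indep_of_prod: "(\<And>i. i \<in> I \<Longrightarrow> indep_of (f i) X) \<Longrightarrow> indep_of (\<lambda>s. \<Prod>i\<in>I. f i s) X"
  unfolding indep_of_def by (intro allI ballI prod.cong) auto

lemma indep_of_const [simp]: "indep_of (\<lambda>s. c) X"
  by (simp add: indep_of_def)

text \<open>\<open>same_mean V X f g\<close>: averaging over the spins in \<open>X\<close> does not distinguish \<open>f\<close> from \<open>g\<close>.\<close>

definition same_mean :: "nat set \<Rightarrow> nat set \<Rightarrow> ((nat \<Rightarrow> int) \<Rightarrow> complex) \<Rightarrow> ((nat \<Rightarrow> int) \<Rightarrow> complex) \<Rightarrow> bool" where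
  "same_mean V X f g \<longleftrightarrow>
     (\<forall>h. indep_of h X \<longrightarrow> (\<Sum>s\<in>spins V. h s * f s) = (\<Sum>s\<in>spins V. h s * g s))"

lemma same_meanD:
  "same_mean V X f g \<Longrightarrow> indep_of h X \<Longrightarrow> (\<Sum>s\<in>spins V. h s * f s) = (\<Sum>s\<in>spins V. h s * g s)"
  by (simp add: same_mean_def)

lemma same_mean_trans [trans]: "same_mean V X f g \<Longrightarrow> same_mean V X g h \<Longrightarrow> same_mean V X f h"
  by (simp add: same_mean_def)

lemma same_mean_cong: "(\<And>s. s \<in> spins V \<Longrightarrow> f s = g s) \<Longrightarrow> same_mean V X f g"
  by (simp add: same_mean_def)

lemma same_mean_step:
  assumes "v \<in> V" "v \<in> X"
  shows "same_mean V X f (\<lambda>s. (f (s(v := 1)) + f (s(v := -1))) / 2)"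
  unfolding same_mean_def
proof (intro allI impI)
  fix h :: "(nat \<Rightarrow> int) \<Rightarrow> complex" assume h: "indep_of h X"
  have "(\<Sum>s\<in>spins V. h s * f s) = (\<Sum>s\<in>spins V. h s * f (s(v := - s v)))"
    using sum_spins_flip[OF assms(1), of "\<lambda>s. h s * f s"] indep_ofD[OF h assms(2)] by simp
  then have "2 * (\<Sum>s\<in>spins V. h s * f s) = (\<Sum>s\<in>spins V. h s * f s) + (\<Sum>s\<in>spins V. h s * f (s(v := - s v)))"
    by simp
  also have "\<dots> = (\<Sum>s\<in>spins V. h s * (f s + f (s(v := - s v))))"
    by (simp add: sum.distrib algebra_simps)
  also have "\<dots> = (\<Sum>s\<in>spins V. h s * (f (s(v := 1)) + f (s(v := -1))))"
  proof (rule sum.cong[OF refl])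
    fix s assume "s \<in> spins V"
    then have "s v = -1 \<or> s v = 1" using assms by (auto dest: spins_mem)
    moreover have "s(v := s v) = s" by simp
    ultimately show "h s * (f s + f (s(v := - s v))) = h s * (f (s(v := 1)) + f (s(v := -1)))"
      by (metis add.commute minus_minus)
  qed
  finally show "(\<Sum>s\<in>spins V. h s * f s) = (\<Sum>s\<in>spins V. h s * ((f (s(v := 1)) + f (s(v := -1))) / 2))"
    by (simp add: sum_divide_distrib[symmetric] algebra_simps)
qed

lemma same_mean_odd:
  assumes "v \<in> V" "v \<in> X" "indep_of P {v}" "indep_of Q {v}"
  shows "same_mean V X (\<lambda>s. P s + Q s * of_int (s v)) P"
  using same_mean_step[OF assms(1,2), of "\<lambda>s. P s + Q s * of_int (s v)"] assms(3,4)
  by (simp add: indep_of_def)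

text \<open>The factors are replaced one at a time. All other factors, replaced or not, ignore the
  spins over which the current one is averaged.\<close>

lemma sum_prod_same_mean:
  assumes "finite I"
    and "\<And>i. i \<in> I \<Longrightarrow> same_mean V (X i) (f i) (g i)"
    and "\<And>i j. i \<in> I \<Longrightarrow> j \<in> I \<Longrightarrow> i \<noteq> j \<Longrightarrow> indep_of (f i) (X j)"
    and "\<And>i j. i \<in> I \<Longrightarrow> j \<in> I \<Longrightarrow> i \<noteq> j \<Longrightarrow> indep_of (g i) (X j)"
    and "\<And>i. i \<in> I \<Longrightarrow> indep_of R (X i)"
  shows "(\<Sum>s\<in>spins V. R s * (\<Prod>i\<in>I. f i s)) = (\<Sum>s\<in>spins V. R s * (\<Prod>i\<in>I. g i s))"
  using assms
proof (induction I arbitrary: R)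
  case (insert j J)
  have "(\<Sum>s\<in>spins V. R s * (\<Prod>i\<in>insert j J. f i s)) = (\<Sum>s\<in>spins V. (R s * (\<Prod>i\<in>J. f i s)) * f j s)"
    using insert.hyps by (simp add: mult_ac)
  also have "\<dots> = (\<Sum>s\<in>spins V. (R s * (\<Prod>i\<in>J. f i s)) * g j s)"
    using insert.hyps by (intro same_meanD[where X = "X j"] indep_of_mult indep_of_prod insert.prems) auto
  also have "\<dots> = (\<Sum>s\<in>spins V. (R s * g j s) * (\<Prod>i\<in>J. f i s))"
    by (simp add: mult_ac)
  also have "\<dots> = (\<Sum>s\<in>spins V. (R s * g j s) * (\<Prod>i\<in>J. g i s))"
  proof (rule insert.IH)
    fix i assume "i \<in> J"
    then show "indep_of (\<lambda>s. R s * g j s) (X i)"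
      using insert.hyps by (intro indep_of_mult insert.prems) auto
  qed (use insert.prems in auto)
  finally show ?case using insert.hyps by (simp add: mult_ac)
qed simp

lemma card_spins: "finite V \<Longrightarrow> card (spins V) = 2 ^ card V"
  by (simp add: spins_def card_PiE card_insert_if numeral_2_eq_2)

lemma mean_one:
  assumes "finite V" "u \<in> V"
  shows "(\<Sum>s\<in>spins V. F (s u)) / 2 ^ card V = (F 1 + F (-1)) / (2 :: complex)"
  using same_meanD[OF same_mean_step[OF assms(2), of "{u}" "\<lambda>s. F (s u)"], of "\<lambda>_. 1"] assms
  by (simp add: card_spins)

lemma mean_two:
  assumes "finite V" "u \<in> V" "v \<in> V" "u \<noteq> v"
  shows "(\<Sum>s\<in>spins V. F (s u) (s v)) / 2 ^ card V =
    (F 1 1 + F 1 (-1) + F (-1) 1 + F (-1) (-1)) / (4 :: complex)"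
proof -
  have "(\<Sum>s\<in>spins V. F (s u) (s v)) = (\<Sum>s\<in>spins V. (F 1 (s v) + F (-1) (s v)) / 2)"
    using same_meanD[OF same_mean_step[OF assms(2), of "{u}" "\<lambda>s. F (s u) (s v)"], of "\<lambda>_. 1"] assms
    by simp
  also have "\<dots> / 2 ^ card V = ((F 1 1 + F (-1) 1) / 2 + (F 1 (-1) + F (-1) (-1)) / 2) / 2"
    using mean_one[OF assms(1,3), of "\<lambda>k. (F 1 k + F (-1) k) / 2"] by simp
  also have "\<dots> = (F 1 1 + F 1 (-1) + F (-1) 1 + F (-1) (-1)) / 4"
    by (simp add: field_simps)
  finally show ?thesis .
qed

section \<open>Averages over the spins of a single star\<close>

context matched_stars begin

text \<open>The strength of the bias: with coefficient \<open>B\<close> at its centre, a star leaves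
  the factor \<open>1 + \<theta> * B * s\<close> at an unflipped leaf with spin \<open>s\<close>,
  once its other spins are averaged.\<close>

definition "\<theta> = sin \<beta> * sin \<gamma> * (cos \<gamma>)\<^sup>2"

lemma nb_neq: "h \<in> H \<Longrightarrow> fst h \<in> V0 \<Longrightarrow> nb h \<noteq> fst h"
  using nb_V0 by metis

lemma star_half_edge: "x \<in> V0 \<Longrightarrow> i \<in> {1..3} \<Longrightarrow> (x, i) \<in> H"
  using V0 by (auto simp: mem_H)

lemma same_mean_w:
  assumes "h \<in> H" "nb h \<in> X" "fst h \<noteq> nb h" "indep_of P {nb h}" "indep_of Q {nb h}"
  shows "same_mean V X (\<lambda>s. P s + Q s * w s h) (\<lambda>s. P s + Q s * of_real (cos \<gamma>))"
proof -
  have "(\<lambda>s. (P (s(nb h := 1)) + Q (s(nb h := 1)) * w (s(nb h := 1)) h +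
      (P (s(nb h := -1)) + Q (s(nb h := -1)) * w (s(nb h := -1)) h)) / 2) =
    (\<lambda>s. P s + Q s * of_real (cos \<gamma>))"
    using assms by (simp add: fun_eq_iff indep_of_def w_def field_simps)
  then show ?thesis
    using same_mean_step[of "nb h" V X "\<lambda>s. P s + Q s * w s h"] assms by simp
qed

lemma triple_prod:
  assumes "{1..3 :: nat} = {i, j, k}" "distinct [i, j, k]"
  shows "(\<Prod>l\<in>{1..3}. f l) = f i * f j * (f k :: complex)"
  unfolding assms(1) using assms(2) by (simp add: mult_ac)

lemma indep_w: "fst h \<notin> X \<Longrightarrow> nb h \<notin> X \<Longrightarrow> indep_of (\<lambda>s. w s h) X"
  by (auto simp: indep_of_def w_def)

lemma indep_spin: "v \<notin> X \<Longrightarrow> indep_of (\<lambda>s. of_int (s v)) X"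
  by (auto simp: indep_of_def)

lemma indep_of_add: "indep_of f X \<Longrightarrow> indep_of g X \<Longrightarrow> indep_of (\<lambda>s. f s + g s) X"
  by (simp add: indep_of_def)

lemma indep_of_diff: "indep_of f X \<Longrightarrow> indep_of g X \<Longrightarrow> indep_of (\<lambda>s. f s - g s) X"
  by (simp add: indep_of_def)

lemma indep_of_uminus: "indep_of f X \<Longrightarrow> indep_of (\<lambda>s. - f s) X"
  by (simp add: indep_of_def)

lemmas indep_intros = indep_of_add indep_of_diff indep_of_uminus indep_of_mult indep_w indep_spin indep_of_const

text \<open>At most one leaf, the one behind half-edge \<open>i\<close>, lies in \<open>D\<close>.
  Averaging over each leaf outside \<open>D\<close> turns its edge factor into
  \<open>cos \<gamma>\<close> where that factor is present. Averaging over the centre keeps the part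
  even in its spin, and this part couples \<open>B x\<close> to the leaf in
  \<open>D\<close>.\<close>

lemma star_mean:
  assumes x: "x \<in> V0" and T: "T \<subseteq> D"
    and ijk: "{1..3} = {i, j, k}" "distinct [i, j, k]"
    and jk: "nb (x, j) \<notin> D" "nb (x, k) \<notin> D"
    and X: "X = insert x ((\<lambda>i. nb (x, i)) ` {1..3} - D)"
  defines "a \<equiv> of_real (sin \<gamma>) :: complex" and "b \<equiv> of_real (cos \<gamma>) :: complex" and "c \<equiv> of_real (cos \<beta>) :: complex"
  shows "same_mean V X (K A B T x)
    (\<lambda>s. if nb (x, i) \<in> T then of_real (A x) * b + \<i> * a * c * of_real (B x) * of_int (s (nb (x, i)))
         else if nb (x, i) \<in> D then of_real (A x) + of_real \<theta> * of_real (B x) * of_int (s (nb (x, i)))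
         else of_real (A x))"
proof -
  define A' B' d :: complex where "A' = of_real (A x)" and "B' = of_real (B x)" and "d = of_real (sin \<beta>)"
  have H: "(x, i) \<in> H" "(x, j) \<in> H" "(x, k) \<in> H"
    using star_half_edge[OF x] ijk(1) by blast+
  have nx: "nb (x, i) \<noteq> x" "nb (x, j) \<noteq> x" "nb (x, k) \<noteq> x"
    using nb_neq[OF H(1)] nb_neq[OF H(2)] nb_neq[OF H(3)] x by auto
  have nn: "nb (x, i) \<noteq> nb (x, j)" "nb (x, i) \<noteq> nb (x, k)" "nb (x, j) \<noteq> nb (x, k)"
    using nb_inj[OF H(1,2)] nb_inj[OF H(1,3)] nb_inj[OF H(2,3)] ijk(2) x by auto
  have xV: "x \<in> V" using x V0 by auto
  have XX: "x \<in> X" "nb (x, j) \<in> X" "nb (x, k) \<in> X" using X jk unfolding ijk(1) by auto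
  have jT: "nb (x, j) \<notin> T" "nb (x, k) \<notin> T" using jk T by auto
  note ind = indep_intros nx nn nx[symmetric] nn[symmetric]
  show ?thesis
  proof (cases "nb (x, i) \<in> T")
    case True
    have "same_mean V X (K A B T x) (\<lambda>s. (A' + B' * c * of_int (s x)) * w s (x, i) - B' * \<i> * d * of_int (s x) * w s (x, k) * w s (x, j))"
      by (rule same_mean_cong) (simp only: K_def triple_prod[OF ijk] True jT A'_def B'_def c_def d_def if_True if_False, simp add: mult_ac)
    also have "(\<lambda>s. (A' + B' * c * of_int (s x)) * w s (x, i) - B' * \<i> * d * of_int (s x) * w s (x, k) * w s (x, j)) =
       (\<lambda>s. (A' + B' * c * of_int (s x)) * w s (x, i) + (- B' * \<i> * d * of_int (s x) * w s (x, k)) * w s (x, j))"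
      by (simp add: algebra_simps)
    also have "same_mean V X \<dots> (\<lambda>s. (A' + B' * c * of_int (s x)) * w s (x, i) + (- B' * \<i> * d * of_int (s x) * w s (x, k)) * b)"
      unfolding b_def using H XX by (intro same_mean_w) (auto intro!: ind simp: nx nn nx[symmetric] nn[symmetric])
    also have "(\<lambda>s. (A' + B' * c * of_int (s x)) * w s (x, i) + (- B' * \<i> * d * of_int (s x) * w s (x, k)) * b) =
        (\<lambda>s. (A' + B' * c * of_int (s x)) * w s (x, i) + (- B' * \<i> * d * b * of_int (s x)) * w s (x, k))"
      by (simp add: algebra_simps)
    also have "same_mean V X \<dots> (\<lambda>s. (A' + B' * c * of_int (s x)) * w s (x, i) + (- B' * \<i> * d * b * of_int (s x)) * b)"
      unfolding b_def using H XX by (intro same_mean_w) (auto intro!: ind simp: nx nn nx[symmetric] nn[symmetric])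
    also have "same_mean V X \<dots> (\<lambda>s. (A' * b + \<i> * a * c * B' * of_int (s (nb (x, i)))) +
         (A' * \<i> * a * of_int (s (nb (x, i))) + B' * c * b - B' * \<i> * d * b * b) * of_int (s x))"
    proof (rule same_mean_cong)
      fix s assume "s \<in> spins V"
      then have "s x = -1 \<or> s x = 1" using xV by (auto dest: spins_mem)
      then show "(A' + B' * c * of_int (s x)) * w s (x, i) + (- B' * \<i> * d * b * of_int (s x)) * b =
         (A' * b + \<i> * a * c * B' * of_int (s (nb (x, i)))) +
         (A' * \<i> * a * of_int (s (nb (x, i))) + B' * c * b - B' * \<i> * d * b * b) * of_int (s x)"
        by (auto simp: w_def a_def[symmetric] b_def[symmetric] algebra_simps)
    qed
    also have "same_mean V X \<dots> (\<lambda>s. A' * b + \<i> * a * c * B' * of_int (s (nb (x, i))))"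
      using xV XX by (intro same_mean_odd) (auto intro!: ind simp: nx nn nx[symmetric] nn[symmetric])
    finally show ?thesis using True by (simp add: A'_def B'_def)
  next
    case F: False
    have "same_mean V X (K A B T x) (\<lambda>s. (A' + B' * c * of_int (s x)) - B' * \<i> * d * of_int (s x) * w s (x, i) * w s (x, k) * w s (x, j))"
      by (rule same_mean_cong) (simp only: K_def triple_prod[OF ijk] F jT A'_def B'_def c_def d_def if_True if_False, simp add: mult_ac)
    also have "(\<lambda>s. (A' + B' * c * of_int (s x)) - B' * \<i> * d * of_int (s x) * w s (x, i) * w s (x, k) * w s (x, j)) =
       (\<lambda>s. (A' + B' * c * of_int (s x)) + (- B' * \<i> * d * of_int (s x) * w s (x, i) * w s (x, k)) * w s (x, j))"
      by (simp add: algebra_simps)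
    also have "same_mean V X \<dots> (\<lambda>s. (A' + B' * c * of_int (s x)) + (- B' * \<i> * d * of_int (s x) * w s (x, i) * w s (x, k)) * b)"
      unfolding b_def using H XX by (intro same_mean_w) (auto intro!: ind simp: nx nn nx[symmetric] nn[symmetric])
    also have "(\<lambda>s. (A' + B' * c * of_int (s x)) + (- B' * \<i> * d * of_int (s x) * w s (x, i) * w s (x, k)) * b) =
        (\<lambda>s. (A' + B' * c * of_int (s x)) + (- B' * \<i> * d * b * of_int (s x) * w s (x, i)) * w s (x, k))"
      by (simp add: algebra_simps)
    also have "same_mean V X \<dots> (\<lambda>s. (A' + B' * c * of_int (s x)) + (- B' * \<i> * d * b * of_int (s x) * w s (x, i)) * b)"
      unfolding b_def using H XX by (intro same_mean_w) (auto intro!: ind simp: nx nn nx[symmetric] nn[symmetric])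
    finally have step: "same_mean V X (K A B T x) (\<lambda>s. (A' + B' * c * of_int (s x)) + (- B' * \<i> * d * b * of_int (s x) * w s (x, i)) * b)" .
    show ?thesis
    proof (cases "nb (x, i) \<in> D")
      case True
      note step
      also have "same_mean V X (\<lambda>s. (A' + B' * c * of_int (s x)) + (- B' * \<i> * d * b * of_int (s x) * w s (x, i)) * b)
         (\<lambda>s. (A' + of_real \<theta> * B' * of_int (s (nb (x, i)))) + (B' * c - B' * \<i> * d * b * b * b) * of_int (s x))"
      proof (rule same_mean_cong)
        fix s assume "s \<in> spins V"
        then have "s x = -1 \<or> s x = 1" using xV by (auto dest: spins_mem)
        moreover have "of_real \<theta> = d * a * b * b"
          by (simp add: \<theta>_def a_def b_def d_def power2_eq_square)
        moreover have "\<i> * (\<i> * z) = - z" for z by (simp flip: mult.assoc)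
        ultimately show "(A' + B' * c * of_int (s x)) + (- B' * \<i> * d * b * of_int (s x) * w s (x, i)) * b =
           (A' + of_real \<theta> * B' * of_int (s (nb (x, i)))) + (B' * c - B' * \<i> * d * b * b * b) * of_int (s x)"
          by (auto simp: w_def a_def[symmetric] b_def[symmetric] algebra_simps)
      qed
      also have "same_mean V X \<dots> (\<lambda>s. A' + of_real \<theta> * B' * of_int (s (nb (x, i))))"
        using xV XX by (intro same_mean_odd) (auto intro!: ind simp: nx nn nx[symmetric] nn[symmetric])
      finally show ?thesis using F True by (simp add: A'_def B'_def)
    next
      case False
      note step
      also have "(\<lambda>s. (A' + B' * c * of_int (s x)) + (- B' * \<i> * d * b * of_int (s x) * w s (x, i)) * b) =
        (\<lambda>s. (A' + B' * c * of_int (s x)) + (- B' * \<i> * d * b * b * of_int (s x)) * w s (x, i))"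
        by (simp add: algebra_simps)
      also have "same_mean V X \<dots> (\<lambda>s. (A' + B' * c * of_int (s x)) + (- B' * \<i> * d * b * b * of_int (s x)) * b)"
        unfolding b_def using H XX X False ijk by (intro same_mean_w) (auto intro!: ind simp: nx nn nx[symmetric] nn[symmetric])
      also have "\<dots> = (\<lambda>s. A' + (B' * c - B' * \<i> * d * b * b * b) * of_int (s x))"
        by (simp add: algebra_simps)
      also have "same_mean V X \<dots> (\<lambda>s. A')"
        using xV XX by (intro same_mean_odd) (auto intro!: ind simp: nx nn nx[symmetric] nn[symmetric])
      finally show ?thesis using F False by (simp add: A'_def B'_def)
    qed
  qed
qed

section \<open>Averages over all stars and over the free edges leaving a core\<close>

definition "N = nb ` {h\<in>H. fst h \<in> V0}"
definition "par u = fst (THE h. h \<in> H \<and> fst h \<in> V0 \<and> nb h = u)"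

lemma par_nb: 
  assumes "h \<in> H" "fst h \<in> V0"
  shows "par (nb h) = fst h"
proof -
  have "(THE h'. h' \<in> H \<and> fst h' \<in> V0 \<and> nb h' = nb h) = h"
    using assms nb_inj by (intro the_equality) auto
  then show ?thesis by (simp add: par_def)
qed

lemma nb_N: "h \<in> H \<Longrightarrow> fst h \<in> V0 \<Longrightarrow> nb h \<in> N"
  by (auto simp: N_def)

lemma N_E:
  assumes "u \<in> N"
  obtains h where "h \<in> H" "fst h \<in> V0" "nb h = u" "par u = fst h"
  using assms par_nb by (auto simp: N_def)

lemma N_subset: "N \<subseteq> V - V0"
  using nb_V0 by (auto simp: N_def)

lemma par_V0: "u \<in> N \<Longrightarrow> par u \<in> V0"
  by (auto elim: N_E)

text \<open>The factor that \<open>star_mean\<close> leaves at a leaf. Vertices that are not leaves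
  carry 1, so that products may range over all of \<open>D\<close>.\<close>

definition \<kappa> :: "(nat \<Rightarrow> real) \<Rightarrow> (nat \<Rightarrow> real) \<Rightarrow> nat set \<Rightarrow> nat \<Rightarrow> (nat \<Rightarrow> int) \<Rightarrow> complex" where
  "\<kappa> A B T u s = (if u \<notin> N then 1 else
     if u \<in> T then of_real (A (par u)) * of_real (cos \<gamma>) +
         \<i> * of_real (sin \<gamma>) * of_real (cos \<beta>) * of_real (B (par u)) * of_int (s u)
     else of_real (A (par u)) + of_real \<theta> * of_real (B (par u)) * of_int (s u))"

lemma indep_of_if: "indep_of f X \<Longrightarrow> indep_of g X \<Longrightarrow> indep_of (\<lambda>s. if c then f s else g s) X"
  by (simp add: indep_of_def)

lemma indep_K:
  assumes "x \<notin> X" "(\<lambda>i. nb (x, i)) ` {1..3} \<inter> X = {}"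
  shows "indep_of (K A B T x) X"
proof -
  have wi: "indep_of (\<lambda>s. w s (x, i)) X" if "i \<in> {1..3}" for i
    using assms(1) disjoint_iff[THEN iffD1, OF assms(2)] that by (intro indep_w) auto
  show ?thesis
    unfolding K_def using assms(1) by (intro indep_of_diff indep_of_mult indep_of_add indep_spin indep_of_const indep_of_prod indep_of_if wi) auto
qed

lemma index_cases:
  assumes "i \<in> {1..3 :: nat}"
  obtains j k where "{1..3} = {i, j, k}" "distinct [i, j, k]"
proof -
  have "i = 1 \<or> i = 2 \<or> i = 3" using assms by auto
  moreover have "{1..3 :: nat} = {1, 2, 3}" "{1..3 :: nat} = {2, 1, 3}" "{1..3 :: nat} = {3, 1, 2}" by auto
  ultimately show ?thesis
    using that[of 2 3] that[of 1 3] that[of 1 2] by auto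
qed

text \<open>Injectivity of \<open>par\<close> means that every star meets \<open>D\<close> in at
  most one leaf, so \<open>star_mean\<close> applies to each. The spins averaged in different stars
  are disjoint by two-independence, and a star that misses \<open>D\<close> leaves the factor
  \<open>A x = 1\<close>.\<close>

lemma sum_stars:
  assumes D: "D \<subseteq> V - V0" and T: "T \<subseteq> D" and inj: "inj_on par (D \<inter> N)"
    and R: "indep_of R (V - D)" and A: "\<And>x. x \<in> V0 - par ` (D \<inter> N) \<Longrightarrow> A x = 1"
  shows "(\<Sum>s\<in>spins V. R s * (\<Prod>x\<in>V0. K A B T x s)) = (\<Sum>s\<in>spins V. R s * (\<Prod>u\<in>D. \<kappa> A B T u s))"
proof -
  define k where "k = (\<lambda>x s. \<Prod>u\<in>{u\<in>D \<inter> N. par u = x}. \<kappa> A B T u s)"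
  define X where "X = (\<lambda>x. insert x ((\<lambda>i. nb (x, i)) ` {1..3} - D))"
  have finD: "finite D" using D finite_subset[OF _ finite_V] by blast
  have nbD: "nb (x, i) \<in> D \<inter> N" "par (nb (x, i)) = x" if "x \<in> V0" "i \<in> {1..3}" "nb (x, i) \<in> D" for x i
    using that nb_N[of "(x, i)"] par_nb[of "(x, i)"] star_half_edge[OF that(1,2)] by auto
  have "(\<Sum>s\<in>spins V. R s * (\<Prod>x\<in>V0. K A B T x s)) = (\<Sum>s\<in>spins V. R s * (\<Prod>x\<in>V0. k x s))"
  proof (rule sum_prod_same_mean[where X = X])
    fix x assume x: "x \<in> V0"
    show "same_mean V (X x) (K A B T x) (k x)"
    proof (cases "\<exists>i\<in>{1..3}. nb (x, i) \<in> D")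
      case True
      then obtain i where i: "i \<in> {1..3}" "nb (x, i) \<in> D" by auto
      obtain i2 i3 where ijk: "{1..3} = {i, i2, i3}" "distinct [i, i2, i3]" using index_cases[OF i(1)] .
      have other: "nb (x, j) \<notin> D" if "j \<in> {1..3}" "j \<noteq> i" for j
      proof
        assume j: "nb (x, j) \<in> D"
        have "nb (x, i) = nb (x, j)"
          using inj_onD[OF inj _ nbD(1)[OF x i] nbD(1)[OF x that(1) j]] nbD(2)[OF x i] nbD(2)[OF x that(1) j] by simp
        then show False using nb_inj[of "(x, i)" "(x, j)"] star_half_edge[OF x] i(1) that x by auto
      qed
      have "i2 \<in> {1..3}" "i3 \<in> {1..3}" unfolding ijk(1) by auto
      then have i23: "nb (x, i2) \<notin> D" "nb (x, i3) \<notin> D" using other[of i2] other[of i3] ijk(2) by auto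
      have "{u\<in>D \<inter> N. par u = x} = {nb (x, i)}"
        using nbD[OF x i] inj_onD[OF inj] by auto
      then have k: "k x s = \<kappa> A B T (nb (x, i)) s" for s by (simp add: k_def)
      have "nb (x, i) \<in> N" "par (nb (x, i)) = x" using nbD[OF x i] by auto
      note \<kappa> = this
      have X: "X x = insert x ((\<lambda>i. nb (x, i)) ` {1..3} - D)" by (simp only: X_def)
      show ?thesis
      proof (rule same_mean_trans[OF star_mean[OF x T ijk i23 X, of A B] same_mean_cong])
        fix s
        show "(if nb (x, i) \<in> T then of_real (A x) * of_real (cos \<gamma>) + \<i> * of_real (sin \<gamma>) * of_real (cos \<beta>) * of_real (B x) * of_int (s (nb (x, i)))
         else if nb (x, i) \<in> D then of_real (A x) + of_real \<theta> * of_real (B x) * of_int (s (nb (x, i)))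
         else of_real (A x)) = k x s"
          unfolding k \<kappa>_def using i(2) \<kappa> by simp
      qed
    next
      case False
      then have ijk: "{1..3 :: nat} = {1, 2, 3}" "nb (x, 2) \<notin> D" "nb (x, 3) \<notin> D" "nb (x, 1) \<notin> D" by auto
      have empty: "{u\<in>D \<inter> N. par u = x} = {}"
      proof (rule equals0I)
        fix u assume u: "u \<in> {u\<in>D \<inter> N. par u = x}"
        then have "u \<in> N" by simp
        then obtain h where h: "h \<in> H" "fst h \<in> V0" "nb h = u" "par u = fst h" by (rule N_E)
        have "h = (x, snd h)" using u h(4) by (simp add: prod_eq_iff)
        moreover have "snd h \<in> {1..3}" using h(1) mem_H by blast
        ultimately show False using False u h(3) by (metis (no_types, lifting) IntE mem_Collect_eq)
      qed
      have "k x = (\<lambda>s. 1)" by (simp only: k_def empty prod.empty)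
      moreover have "x \<notin> par ` (D \<inter> N)" using empty by auto
      then have "A x = 1" using A x by blast
      moreover have "nb (x, 1) \<notin> T" using ijk(4) T by blast
      ultimately show ?thesis
        using star_mean[OF x T ijk(1) _ ijk(2,3), of "X x" A B] ijk(4)
        by (simp only: X_def if_False) simp
    qed
  next
    fix x y assume xy: "x \<in> V0" "y \<in> V0" "x \<noteq> y"
    have "nb (x, i) \<notin> X y" if i: "i \<in> {1..3}" for i
    proof
      assume "nb (x, i) \<in> X y"
      then have "nb (x, i) = y \<or> (\<exists>j\<in>{1..3}. nb (x, i) = nb (y, j))" by (auto simp: X_def)
      then show False
        using xy nb_V0[OF star_half_edge[OF xy(1) i]] nb_inj[OF star_half_edge[OF xy(1) i] star_half_edge[OF xy(2)]] by fastforce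
    qed
    moreover have "x \<notin> X y"
      using xy nb_V0[OF star_half_edge[OF xy(2)]] by (auto simp: X_def)
    ultimately show "indep_of (K A B T x) (X y)" by (intro indep_K) auto
    have "u \<notin> X y" if "u \<in> D" for u using that D xy by (auto simp: X_def)
    then show "indep_of (k x) (X y)" unfolding k_def \<kappa>_def
      by (intro indep_of_prod) (auto intro!: indep_intros simp: indep_of_def)
  next
    fix x assume x: "x \<in> V0"
    have "X x \<subseteq> V - D" using D x V0 nb_V star_half_edge[OF x] by (auto simp: X_def)
    then show "indep_of R (X x)" using R by (auto simp: indep_of_def)
  qed simp
  moreover have "(\<Prod>x\<in>V0. k x s) = (\<Prod>u\<in>D. \<kappa> A B T u s)" for s
  proof -
    have "(\<Prod>x\<in>V0. k x s) = (\<Prod>u\<in>D \<inter> N. \<kappa> A B T u s)"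
      unfolding k_def using finD par_V0 by (intro prod.group) auto
    also have "\<dots> = (\<Prod>u\<in>D. \<kappa> A B T u s)"
      using finD by (intro prod.mono_neutral_left) (auto simp: \<kappa>_def)
    finally show ?thesis .
  qed
  ultimately show ?thesis by simp
qed

definition "P B u = (if u \<in> N then B (par u) else (0 :: real))"

text \<open>After integrating out the stars, every free edge leaving the core \<open>C\<close> only contributes a
  function of the spin at its endpoint in the core.\<close>

lemma sum_core:
  assumes C: "C \<subseteq> V - V0" and T: "T \<subseteq> C"
    and F: "F = {h\<in>H. fst h \<in> C \<and> nb h \<notin> C \<union> V0}"
    and nbF: "inj_on nb F" and inj: "inj_on par ((C \<union> nb ` F) \<inter> N)"
    and A: "\<And>x. x \<in> V0 - par ` (C \<inter> N) \<Longrightarrow> A x = 1"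
  shows "(\<Sum>s\<in>spins V. (\<Prod>v\<in>C. of_int (s v)) * (\<Prod>h\<in>{h\<in>H. fst h \<in> T \<and> nb h \<notin> T \<union> V0}. w s h) *
         (\<Prod>x\<in>V0. K A B T x s)) =
    (\<Sum>s\<in>spins V. (\<Prod>v\<in>C. of_int (s v)) * (\<Prod>h\<in>{h\<in>H. fst h \<in> T \<and> nb h \<in> C - T}. w s h) *
       (\<Prod>u\<in>C. \<kappa> A B T u s) *
       (\<Prod>h\<in>F. if fst h \<in> T then of_real (cos \<gamma>) + \<i> * of_real (sin \<gamma>) * of_real (\<theta> * P B (nb h)) * of_int (s (fst h)) else 1))"
proof -
  \<comment> \<open>The far ends of the free edges are added to \<open>D\<close>: the bias of their
    stars must be kept until the edge factors have been averaged over these ends too.\<close>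
  define D where "D = C \<union> nb ` F"
  define W where "W = (\<lambda>s. \<Prod>h\<in>{h\<in>H. fst h \<in> T \<and> nb h \<in> C - T}. w s h)"
  define R where "R = (\<lambda>s. (\<Prod>v\<in>C. of_int (s v)) * W s * (\<Prod>h\<in>F. if fst h \<in> T then w s h else 1))"
  have finC: "finite C" using C finite_subset[OF _ finite_V] by blast
  have finF: "finite F" by (simp add: F)
  have D: "D \<subseteq> V - V0" using C nb_V by (auto simp: D_def F)
  have TD: "T \<subseteq> D" using T by (auto simp: D_def)
  have cross: "(\<Prod>h\<in>{h\<in>H. fst h \<in> T \<and> nb h \<notin> T \<union> V0}. w s h) = W s * (\<Prod>h\<in>F. if fst h \<in> T then w s h else 1)" for s
  proof -
    have "{h\<in>H. fst h \<in> T \<and> nb h \<notin> T \<union> V0} = {h\<in>H. fst h \<in> T \<and> nb h \<in> C - T} \<union> {h\<in>F. fst h \<in> T}"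
      using T C by (auto simp: F)
    moreover have "{h\<in>H. fst h \<in> T \<and> nb h \<in> C - T} \<inter> {h\<in>F. fst h \<in> T} = {}"
      by (auto simp: F)
    ultimately have "(\<Prod>h\<in>{h\<in>H. fst h \<in> T \<and> nb h \<notin> T \<union> V0}. w s h) = W s * (\<Prod>h\<in>{h\<in>F. fst h \<in> T}. w s h)"
      unfolding W_def using finF by (simp add: prod.union_disjoint)
    also have "(\<Prod>h\<in>{h\<in>F. fst h \<in> T}. w s h) = (\<Prod>h\<in>F. if fst h \<in> T then w s h else 1)"
      using finF by (simp add: prod.inter_filter)
    finally show ?thesis .
  qed
  have indR: "indep_of R (V - D)"
  proof -
    have "indep_of (\<lambda>s. if fst h \<in> T then w s h else 1) (V - D)" if "h \<in> F" for h
      using that T by (intro indep_of_if indep_w) (auto simp: D_def F)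
    moreover have "indep_of W (V - D)" unfolding W_def
      using T by (intro indep_of_prod indep_w) (auto simp: D_def)
    ultimately show ?thesis unfolding R_def
      by (intro indep_of_mult indep_of_prod indep_spin) (auto simp: D_def)
  qed
  have "(\<Sum>s\<in>spins V. (\<Prod>v\<in>C. of_int (s v)) * (\<Prod>h\<in>{h\<in>H. fst h \<in> T \<and> nb h \<notin> T \<union> V0}. w s h) *
         (\<Prod>x\<in>V0. K A B T x s)) = (\<Sum>s\<in>spins V. R s * (\<Prod>x\<in>V0. K A B T x s))"
    unfolding cross R_def by (simp add: mult_ac)
  also have "\<dots> = (\<Sum>s\<in>spins V. R s * (\<Prod>u\<in>D. \<kappa> A B T u s))"
  proof (rule sum_stars[OF D TD _ indR])
    show "inj_on par (D \<inter> N)" using inj by (simp add: D_def)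
    show "A x = 1" if "x \<in> V0 - par ` (D \<inter> N)" for x
      using that by (intro A) (auto simp: D_def)
  qed
  also have "\<dots> = (\<Sum>s\<in>spins V. ((\<Prod>v\<in>C. of_int (s v)) * W s * (\<Prod>u\<in>C. \<kappa> A B T u s)) *
      (\<Prod>h\<in>F. (if fst h \<in> T then w s h else 1) * (1 + of_real (\<theta> * P B (nb h)) * of_int (s (nb h)))))"
  proof (rule sum.cong[OF refl])
    fix s
    have "(\<Prod>u\<in>D. \<kappa> A B T u s) = (\<Prod>u\<in>C. \<kappa> A B T u s) * (\<Prod>u\<in>nb ` F. \<kappa> A B T u s)"
      unfolding D_def using finC finF by (intro prod.union_disjoint) (auto simp: F)
    also have "(\<Prod>u\<in>nb ` F. \<kappa> A B T u s) = (\<Prod>h\<in>F. \<kappa> A B T (nb h) s)"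
      using nbF by (simp add: prod.reindex)
    also have "\<dots> = (\<Prod>h\<in>F. 1 + of_real (\<theta> * P B (nb h)) * of_int (s (nb h)))"
    proof (rule prod.cong[OF refl])
      fix h assume h: "h \<in> F"
      have "nb h \<notin> T" using h T by (auto simp: F)
      moreover have "A (par (nb h)) = 1" if N: "nb h \<in> N"
      proof (rule A)
        have "par (nb h) \<noteq> par u" if "u \<in> C \<inter> N" for u
        proof
          assume "par (nb h) = par u"
          then have "nb h = u" using inj_onD[OF inj] h that N by blast
          then show False using h that by (auto simp: F)
        qed
        then show "par (nb h) \<in> V0 - par ` (C \<inter> N)" using par_V0[OF N] by auto
      qed
      ultimately show "\<kappa> A B T (nb h) s = 1 + of_real (\<theta> * P B (nb h)) * of_int (s (nb h))"
        by (auto simp: \<kappa>_def P_def)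
    qed
    finally show "R s * (\<Prod>u\<in>D. \<kappa> A B T u s) = ((\<Prod>v\<in>C. of_int (s v)) * W s * (\<Prod>u\<in>C. \<kappa> A B T u s)) *
      (\<Prod>h\<in>F. (if fst h \<in> T then w s h else 1) * (1 + of_real (\<theta> * P B (nb h)) * of_int (s (nb h))))"
      by (simp add: R_def prod.distrib mult_ac)
  qed
  also have "\<dots> = (\<Sum>s\<in>spins V. ((\<Prod>v\<in>C. of_int (s v)) * W s * (\<Prod>u\<in>C. \<kappa> A B T u s)) *
     (\<Prod>h\<in>F. if fst h \<in> T then of_real (cos \<gamma>) + \<i> * of_real (sin \<gamma>) * of_real (\<theta> * P B (nb h)) * of_int (s (fst h)) else 1))"
  proof (rule sum_prod_same_mean[where X = "\<lambda>h. {nb h}"])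
    fix h assume h: "h \<in> F"
    have hh: "fst h \<noteq> nb h" "nb h \<in> V" using h by (auto simp: F)
    show "same_mean V {nb h} (\<lambda>s. (if fst h \<in> T then w s h else 1) * (1 + of_real (\<theta> * P B (nb h)) * of_int (s (nb h))))
      (\<lambda>s. if fst h \<in> T then of_real (cos \<gamma>) + \<i> * of_real (sin \<gamma>) * of_real (\<theta> * P B (nb h)) * of_int (s (fst h)) else 1)"
      (is "same_mean V _ ?f ?g")
    proof -
      have "(\<lambda>s. (?f (s(nb h := 1)) + ?f (s(nb h := -1))) / 2) = ?g"
        using hh by (auto simp: fun_eq_iff w_def field_simps)
      then show ?thesis using same_mean_step[of "nb h" V "{nb h}" ?f] hh by simp
    qed
    show "indep_of (\<lambda>s. (\<Prod>v\<in>C. of_int (s v)) * W s * (\<Prod>u\<in>C. \<kappa> A B T u s)) {nb h}"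
    proof -
      have nC: "nb h \<notin> C" using h by (auto simp: F)
      have "indep_of W {nb h}" unfolding W_def
        using T nC by (intro indep_of_prod indep_w) auto
      moreover have "indep_of (\<lambda>s. \<Prod>u\<in>C. \<kappa> A B T u s) {nb h}"
        unfolding \<kappa>_def using nC by (intro indep_of_prod) (auto simp: indep_of_def)
      moreover have "indep_of (\<lambda>s. \<Prod>v\<in>C. of_int (s v)) {nb h}"
        using nC by (intro indep_of_prod) (auto simp: indep_of_def)
      ultimately show ?thesis by (intro indep_of_mult)
    qed
    fix j assume j: "j \<in> F" "h \<noteq> j"
    have nj: "nb h \<noteq> nb j" "fst h \<noteq> nb j" using inj_onD[OF nbF _ h j(1)] h j by (auto simp: F)
    then show "indep_of (\<lambda>s. (if fst h \<in> T then w s h else 1) * (1 + of_real (\<theta> * P B (nb h)) * of_int (s (nb h)))) {nb j}"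
      by (auto simp: indep_of_def w_def)
    show "indep_of (\<lambda>s. if fst h \<in> T then of_real (cos \<gamma>) + \<i> * of_real (sin \<gamma>) * of_real (\<theta> * P B (nb h)) * of_int (s (fst h)) else 1) {nb j}"
      using nj by (auto simp: indep_of_def)
  qed (rule finF)
  finally show ?thesis by (simp add: W_def mult_ac)
qed

end

section \<open>Edge correlations given the outcomes on \<open>V0\<close>\<close>

context matched_stars begin

section \<open>Factors at the two ends of an edge\<close>

definition "oth h = {h'\<in>H. fst h' = fst h \<and> h' \<noteq> h}"

lemma card_half_edges_at: 
  assumes "u \<in> V"
  shows "card {h\<in>H. fst h = u} = 3"
proof -
  have "{h\<in>H. fst h = u} = {u} \<times> {1..3}" using assms by (auto simp: H_def half_edges_def)
  then show ?thesis by (simp add: card_cartesian_product)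
qed

lemma card_oth: "h \<in> H \<Longrightarrow> card (oth h) = 2"
proof -
  assume h: "h \<in> H"
  have "oth h = {h'\<in>H. fst h' = fst h} - {h}" by (auto simp: oth_def)
  then show ?thesis using card_half_edges_at[OF fst_V[OF h]] h by (simp add: card_Diff_subset)
qed

lemma finite_oth [simp]: "finite (oth h)"
  by (simp add: oth_def)

text \<open>The bias seen through the half-edge \<open>h\<close>. The case split lets a flipped end
  with spin \<open>s\<close> receive the factor
  \<open>cos \<gamma> + i * sin \<gamma> * s * \<xi> B h\<close> in both cases, whether the far end
  is a star centre or an ordinary vertex.\<close>

definition "\<xi> B h = (if nb h \<in> V0 then cos \<beta> * B (nb h) else \<theta> * P B (nb h))"
definition "\<xi>sum B h = (\<Sum>h'\<in>oth h. \<xi> B h')"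
definition "\<xi>prod B h = (\<Prod>h'\<in>oth h. \<xi> B h')"

lemma prod_oth:
  assumes "h \<in> H"
  shows "(\<Prod>h'\<in>oth h. b + z * of_real (\<xi> B h')) = b\<^sup>2 + b * z * of_real (\<xi>sum B h) + z\<^sup>2 * (of_real (\<xi>prod B h) :: complex)"
proof -
  obtain h1 h2 where "oth h = {h1, h2}" "h1 \<noteq> h2"
    using card_oth[OF assms] by (metis card_2_iff)
  then show ?thesis by (simp add: \<xi>sum_def \<xi>prod_def power2_eq_square algebra_simps)
qed

lemma V0_half_edge_at:
  assumes "h \<in> H" "nb h \<in> V0"
  shows "fst h \<in> N" "par (fst h) = nb h" "fst h \<notin> V0"
proof -
  have "\<mu> h \<in> H" "fst (\<mu> h) = nb h" "nb (\<mu> h) = fst h" using assms by (auto simp: nb_def)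
  then show "fst h \<in> N" "par (fst h) = nb h" "fst h \<notin> V0"
    using nb_N[of "\<mu> h"] par_nb[of "\<mu> h"] nb_V0[of "\<mu> h"] assms by auto
qed

lemma N_half_edge:
  assumes "u \<in> N"
  obtains h where "h \<in> H" "fst h = u" "nb h = par u" "nb h \<in> V0"
proof -
  obtain h where h: "h \<in> H" "fst h \<in> V0" "nb h = u" "par u = fst h" using assms by (rule N_E)
  show ?thesis by (rule that[of "\<mu> h"]) (use h in \<open>auto simp: nb_def\<close>)
qed

lemma V0_half_edge_unique:
  assumes "h \<in> H" "h' \<in> H" "fst h = fst h'" "nb h \<in> V0" "nb h' \<in> V0"
  shows "h = h'"
proof -
  have "\<mu> h = \<mu> h'"
    using assms nb_\<mu> by (intro nb_inj) (auto simp: nb_def)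
  then show ?thesis using assms \<mu>_\<mu> by metis
qed

text \<open>If the flipped end is a leaf, \<open>\<kappa>\<close> is exactly the factor missing for
  its half-edge into \<open>V0\<close>. Hence the two half-edges of \<open>oth g\<close> enter
  symmetrically.\<close>

lemma end_factor:
  assumes g: "g \<in> H" "nb g \<notin> V0"
  defines "F \<equiv> {h\<in>oth g. nb h \<notin> V0}"
  shows "\<kappa> (\<lambda>_. 1) B T (fst g) s *
      (\<Prod>h\<in>F. if fst h \<in> T then of_real (cos \<gamma>) + \<i> * of_real (sin \<gamma>) * of_real (\<theta> * P B (nb h)) * of_int (s (fst h)) else 1) =
    (if fst g \<in> T then \<Prod>h\<in>oth g. of_real (cos \<gamma>) + \<i> * of_real (sin \<gamma>) * of_int (s (fst g)) * of_real (\<xi> B h)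
     else 1 + of_real (\<theta> * P B (fst g)) * of_int (s (fst g)))"
proof (cases "fst g \<in> T")
  case False
  have "(\<Prod>h\<in>F. if fst h \<in> T then of_real (cos \<gamma>) + \<i> * of_real (sin \<gamma>) * of_real (\<theta> * P B (nb h)) * of_int (s (fst h)) else (1 :: complex)) = 1"
    using False by (intro prod.neutral) (auto simp: F_def oth_def)
  then show ?thesis using False by (simp add: \<kappa>_def P_def)
next
  case True
  define q where "q = (\<lambda>h. of_real (cos \<gamma>) + \<i> * of_real (sin \<gamma>) * of_int (s (fst g)) * (of_real (\<xi> B h) :: complex))"
  have F: "(\<Prod>h\<in>F. if fst h \<in> T then of_real (cos \<gamma>) + \<i> * of_real (sin \<gamma>) * of_real (\<theta> * P B (nb h)) * of_int (s (fst h)) else 1) = prod q F"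
    using True by (intro prod.cong) (auto simp: F_def oth_def q_def \<xi>_def)
  have "\<kappa> (\<lambda>_. 1) B T (fst g) s * prod q F = prod q (oth g)"
  proof (cases "fst g \<in> N")
    case N: True
    obtain h where h: "h \<in> H" "fst h = fst g" "nb h = par (fst g)" "nb h \<in> V0" using N by (rule N_half_edge)
    have "oth g = insert h F"
    proof
      show "oth g \<subseteq> insert h F"
      proof
        fix h' assume h': "h' \<in> oth g"
        show "h' \<in> insert h F"
        proof (cases "nb h' \<in> V0")
          case True
          then have "h = h'" using V0_half_edge_unique[OF h(1) _ _ h(4)] h' h(2) by (auto simp: oth_def)
          then show ?thesis by simp
        qed (use h' in \<open>auto simp: F_def\<close>)
      qed
      have "h \<noteq> g" using h(4) g(2) by auto
      then show "insert h F \<subseteq> oth g" using h by (auto simp: oth_def F_def)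
    qed
    moreover have "h \<notin> F" "finite F" using h by (auto simp: F_def)
    moreover have "\<kappa> (\<lambda>_. 1) B T (fst g) s = q h"
      using N True h by (simp add: \<kappa>_def q_def \<xi>_def)
    ultimately show ?thesis by simp
  next
    case False
    have "F = oth g" using False V0_half_edge_at(1) by (fastforce simp: F_def oth_def)
    then show ?thesis using False by (simp add: \<kappa>_def)
  qed
  then show ?thesis using True F by (simp add: q_def)
qed

definition core_edges :: "nat set \<Rightarrow> half_edge set" where
  "core_edges C = {h\<in>H. fst h \<in> C \<and> nb h \<notin> C \<union> V0}"

text \<open>Tree-likeness around the core: no two edges leaving it meet, and no star is reached at
  two leaves. These are the injectivity assumptions of \<open>sum_core\<close>.\<close>

definition clean :: "nat set \<Rightarrow> bool" where
  "clean C \<longleftrightarrow> inj_on nb (core_edges C) \<and> inj_on par ((C \<union> nb ` core_edges C) \<inter> N)"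

text \<open>The core consists of the two ends, so there are four flip sets. Each gives a function of
  two spins, and its mean is read off from four values. The assumption \<open>only\<close> excludes
  loops and parallel edges at the core.\<close>

lemma free_edge_moment:
  assumes g: "g \<in> H" "fst g \<notin> V0" "nb g \<notin> V0" and neq: "fst g \<noteq> nb g"
    and only: "\<And>h. h \<in> H \<Longrightarrow> fst h \<in> {fst g, nb g} \<Longrightarrow> nb h \<in> {fst g, nb g} \<Longrightarrow> h = g \<or> h = \<mu> g"
    and clean: "clean {fst g, nb g}"
  shows "moment V \<psi> (\<lambda>s. of_int (s (fst g) * s (nb g)) * (\<Prod>x\<in>V0. 1 + B x * of_int (s x))) =
    (cos \<beta>)\<^sup>2 * \<theta>\<^sup>2 * P B (fst g) * P B (nb g) +
    cos \<beta> * sin \<beta> * sin \<gamma> * (2 * (cos \<gamma>)\<^sup>2 - (sin \<gamma>)\<^sup>2 * (\<xi>prod B g + \<xi>prod B (\<mu> g)) +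
      (cos \<gamma>)\<^sup>2 * \<theta> * (P B (nb g) * \<xi>sum B g + P B (fst g) * \<xi>sum B (\<mu> g))) +
    (sin \<beta>)\<^sup>2 * (sin \<gamma>)\<^sup>2 * (cos \<gamma>)\<^sup>2 * \<xi>sum B g * \<xi>sum B (\<mu> g)"
proof -
  define u v where "u = fst g" and "v = nb g"
  define a b :: complex where "a = of_real (sin \<gamma>)" and "b = of_real (cos \<gamma>)"
  define pu pv xu xv yu yv where "pu = P B u" and "pv = P B v" and "xu = \<xi>sum B g" and "xv = \<xi>sum B (\<mu> g)"
    and "yu = \<xi>prod B g" and "yv = \<xi>prod B (\<mu> g)"
  note defs = pu_def pv_def xu_def xv_def yu_def yv_def
  define C where "C = {u, v}"
  have uv: "u \<noteq> v" "u \<in> V" "v \<in> V" "u \<notin> V0" "v \<notin> V0"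
    using g neq fst_V by (auto simp: u_def v_def)
  have C: "C \<subseteq> V - V0" using uv by (auto simp: C_def)
  have \<mu>g: "\<mu> g \<in> H" "fst (\<mu> g) = v" "nb (\<mu> g) = u" "\<mu> g \<noteq> g"
    using g partner_neq[OF M g(1)] by (auto simp: u_def v_def nb_def)
  define F where "F = core_edges C"
  define Fu Fv where "Fu = {h\<in>oth g. nb h \<notin> V0}" and "Fv = {h\<in>oth (\<mu> g). nb h \<notin> V0}"
  have F: "F = Fu \<union> Fv" "Fu \<inter> Fv = {}"
  proof -
    show "F = Fu \<union> Fv"
    proof
      show "F \<subseteq> Fu \<union> Fv"
        using \<mu>g by (auto simp: F_def core_edges_def Fu_def Fv_def oth_def C_def u_def v_def)
      show "Fu \<union> Fv \<subseteq> F"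
      proof
        fix h assume h: "h \<in> Fu \<union> Fv"
        then have hH: "h \<in> H" "fst h \<in> C" "nb h \<notin> V0" "(fst h = u \<and> h \<noteq> g) \<or> (fst h = v \<and> h \<noteq> \<mu> g)"
          using \<mu>g by (auto simp: Fu_def Fv_def oth_def C_def u_def)
        have "nb h \<notin> C"
        proof
          assume "nb h \<in> C"
          then have "h = g \<or> h = \<mu> g" using only[of h] hH by (simp add: C_def u_def v_def)
          then show False using hH(4) uv \<mu>g by (auto simp: u_def)
        qed
        then show "h \<in> F" using hH by (auto simp: F_def core_edges_def)
      qed
    qed
    show "Fu \<inter> Fv = {}" using uv \<mu>g by (auto simp: Fu_def Fv_def oth_def u_def)
  qed
  \<comment> \<open>\<open>e\<close> is the factor of one end as a function of its spin.
    \<open>G\<close> below is the whole integrand; the edge itself enters when exactly one of its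
    ends is flipped.\<close>
  define e where "e = (\<lambda>(T :: nat set) k (x :: int) p X Y. if k \<in> T then b\<^sup>2 + b * (\<i> * a * of_int x) * of_real X + (\<i> * a * of_int x)\<^sup>2 * of_real Y
     else 1 + of_real (\<theta> * p) * of_int x :: complex)"
  define G where "G = (\<lambda>T x y. of_int x * of_int y * (if T = {u} \<or> T = {v} then b + \<i> * a * of_int (x * y) else 1) *
     (e T u x pu xu yu * e T v y pv xv yv))"
  have core: "(\<Sum>s\<in>spins V. (\<Prod>k\<in>C. of_int (s k)) * (\<Prod>h\<in>{h\<in>H. fst h \<in> T \<and> nb h \<notin> T \<union> V0}. w s h) *
         (\<Prod>x\<in>V0. K (\<lambda>_. 1) B T x s)) / 2 ^ n = (G T 1 1 + G T 1 (-1) + G T (-1) 1 + G T (-1) (-1)) / 4"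
    if T: "T \<subseteq> C" for T
  proof -
    have "(\<Sum>s\<in>spins V. (\<Prod>k\<in>C. of_int (s k)) * (\<Prod>h\<in>{h\<in>H. fst h \<in> T \<and> nb h \<notin> T \<union> V0}. w s h) *
         (\<Prod>x\<in>V0. K (\<lambda>_. 1) B T x s)) =
      (\<Sum>s\<in>spins V. (\<Prod>k\<in>C. of_int (s k)) * (\<Prod>h\<in>{h\<in>H. fst h \<in> T \<and> nb h \<in> C - T}. w s h) *
       (\<Prod>k\<in>C. \<kappa> (\<lambda>_. 1) B T k s) *
       (\<Prod>h\<in>F. if fst h \<in> T then of_real (cos \<gamma>) + \<i> * of_real (sin \<gamma>) * of_real (\<theta> * P B (nb h)) * of_int (s (fst h)) else 1))"
      using clean C T by (intro sum_core) (auto simp: F_def core_edges_def clean_def C_def u_def v_def)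
    also have "\<dots> = (\<Sum>s\<in>spins V. G T (s u) (s v))"
    proof (rule sum.cong[OF refl])
      fix s
      have w: "(\<Prod>h\<in>{h\<in>H. fst h \<in> T \<and> nb h \<in> C - T}. w s h) = (if T = {u} \<or> T = {v} then b + \<i> * a * of_int (s u * s v) else 1)"
      proof -
        have h1: "h = g" if "h \<in> H" "fst h = u" "nb h = v" for h
          using only[of h] that uv(1) \<mu>g(2) by (auto simp: u_def v_def)
        have h2: "h = \<mu> g" if "h \<in> H" "fst h = v" "nb h = u" for h
          using only[of h] that uv(1) by (auto simp: u_def v_def)
        consider "T = {u}" | "T = {v}" | "T = {}" | "T = {u, v}" using T unfolding C_def by blast
        then show ?thesis
        proof cases
          case 1
          have "{h\<in>H. fst h \<in> T \<and> nb h \<in> C - T} = {g}"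
          proof (rule set_eqI)
            fix h
            have "fst h \<in> T \<and> nb h \<in> C - T \<longleftrightarrow> fst h = u \<and> nb h = v" using 1 uv(1) by (auto simp: C_def)
            then show "h \<in> {h\<in>H. fst h \<in> T \<and> nb h \<in> C - T} \<longleftrightarrow> h \<in> {g}"
              using h1[of h] g(1) u_def v_def by blast
          qed
          then show ?thesis using 1 by (simp add: w_def a_def b_def u_def v_def)
        next
          case 2
          have "{h\<in>H. fst h \<in> T \<and> nb h \<in> C - T} = {\<mu> g}"
          proof (rule set_eqI)
            fix h
            have "fst h \<in> T \<and> nb h \<in> C - T \<longleftrightarrow> fst h = v \<and> nb h = u" using 2 uv(1) by (auto simp: C_def)
            then show "h \<in> {h\<in>H. fst h \<in> T \<and> nb h \<in> C - T} \<longleftrightarrow> h \<in> {\<mu> g}"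
              using h2[of h] \<mu>g by blast
          qed
          then show ?thesis using 2 g by (simp add: w_\<mu>) (simp add: w_def a_def b_def u_def v_def)
        next
          case 3
          then show ?thesis by simp
        next
          case 4
          then have "{h\<in>H. fst h \<in> T \<and> nb h \<in> C - T} = {}" by (auto simp: C_def)
          moreover have "\<not> (T = {u} \<or> T = {v})" using 4 uv by auto
          ultimately show ?thesis by (simp only: prod.empty if_False)
        qed
      qed
      define q where "q = (\<lambda>h. if fst h \<in> T then of_real (cos \<gamma>) + \<i> * of_real (sin \<gamma>) * of_real (\<theta> * P B (nb h)) * of_int (s (fst h)) else (1 :: complex))"
      have "finite Fu" "finite Fv" by (auto simp: Fu_def Fv_def)
      then have "prod q F = prod q Fu * prod q Fv"
        unfolding F(1) using F(2) by (rule prod.union_disjoint)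
      moreover have "\<kappa> (\<lambda>_. 1) B T u s * prod q Fu = e T u (s u) pu xu yu"
        using end_factor[OF g(1,3), of B T s]
        by (simp only: prod_oth[OF g(1)] Fu_def[symmetric] q_def u_def[symmetric] e_def a_def[symmetric] b_def[symmetric] defs)
      moreover have "\<kappa> (\<lambda>_. 1) B T v s * prod q Fv = e T v (s v) pv xv yv"
        using end_factor[OF \<mu>g(1), of B T s] uv
        by (simp only: prod_oth[OF \<mu>g(1)] \<mu>g(2,3) Fv_def[symmetric] q_def e_def a_def[symmetric] b_def[symmetric] defs) simp
      ultimately have "(\<Prod>k\<in>C. \<kappa> (\<lambda>_. 1) B T k s) * prod q F = e T u (s u) pu xu yu * e T v (s v) pv xv yv"
        using uv by (simp add: C_def)
          (metis (no_types, lifting) mult.assoc mult.left_commute)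
      then show "(\<Prod>k\<in>C. of_int (s k)) * (\<Prod>h\<in>{h\<in>H. fst h \<in> T \<and> nb h \<in> C - T}. w s h) *
       (\<Prod>k\<in>C. \<kappa> (\<lambda>_. 1) B T k s) *
       (\<Prod>h\<in>F. if fst h \<in> T then of_real (cos \<gamma>) + \<i> * of_real (sin \<gamma>) * of_real (\<theta> * P B (nb h)) * of_int (s (fst h)) else 1) = G T (s u) (s v)"
        unfolding w q_def[symmetric] G_def using uv by (simp add: C_def mult.assoc)
    qed
    finally show ?thesis
      using mean_two[OF finite_V uv(2,3,1), of "G T"] by simp
  qed
  have "of_real (moment V \<psi> (\<lambda>s. (\<Prod>k\<in>C. of_int (s k)) * (\<Prod>x\<in>V0. 1 + B x * of_int (s x)))) =
     (\<Sum>T\<in>Pow C. of_real (cos \<beta>) ^ card (C - T) * (- \<i> * of_real (sin \<beta>)) ^ card T * ((G T 1 1 + G T 1 (-1) + G T (-1) 1 + G T (-1) (-1)) / 4))"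
    unfolding moment_stars[OF C, of "\<lambda>_. 1" B]
    by (intro sum.cong refl arg_cong2[where f = "(*)"] core) auto
  also have "Pow C = {{}, {u}, {v}, {u, v}}" by (auto simp: C_def)
  also have "(\<Sum>T\<in>\<dots>. of_real (cos \<beta>) ^ card (C - T) * (- \<i> * of_real (sin \<beta>)) ^ card T * ((G T 1 1 + G T 1 (-1) + G T (-1) 1 + G T (-1) (-1)) / 4)) =
    (of_real (cos \<beta>))\<^sup>2 * ((G {} 1 1 + G {} 1 (-1) + G {} (-1) 1 + G {} (-1) (-1)) / 4) +
    of_real (cos \<beta>) * (- \<i> * of_real (sin \<beta>)) * ((G {u} 1 1 + G {u} 1 (-1) + G {u} (-1) 1 + G {u} (-1) (-1)) / 4) +
    of_real (cos \<beta>) * (- \<i> * of_real (sin \<beta>)) * ((G {v} 1 1 + G {v} 1 (-1) + G {v} (-1) 1 + G {v} (-1) (-1)) / 4) +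
    (- \<i> * of_real (sin \<beta>))\<^sup>2 * ((G {u, v} 1 1 + G {u, v} 1 (-1) + G {u, v} (-1) 1 + G {u, v} (-1) (-1)) / 4)"
  proof -
    have ne: "{u} \<noteq> {v}" "{u} \<noteq> {u, v}" "{v} \<noteq> {u, v}" "{u, v} - {u} = {v}" "{u, v} - {v} = {u}" using uv by auto
    show ?thesis using uv ne by (simp add: C_def card_insert_if add.assoc power2_eq_square)
  qed
  also have "(G {} 1 1 + G {} 1 (-1) + G {} (-1) 1 + G {} (-1) (-1)) / 4 = of_real (\<theta>\<^sup>2 * pu * pv)"
    by (simp add: G_def e_def field_simps power2_eq_square)
  also have "(G {u} 1 1 + G {u} 1 (-1) + G {u} (-1) 1 + G {u} (-1) (-1)) / 4 =
     (\<i> * a * (b\<^sup>2 - a\<^sup>2 * of_real yu) + b * of_real (\<theta> * pv) * (\<i> * a * b * of_real xu))"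
    using uv by (simp add: G_def e_def field_simps power2_eq_square)
  also have "(G {v} 1 1 + G {v} 1 (-1) + G {v} (-1) 1 + G {v} (-1) (-1)) / 4 =
     (\<i> * a * (b\<^sup>2 - a\<^sup>2 * of_real yv) + b * of_real (\<theta> * pu) * (\<i> * a * b * of_real xv))"
    using uv by (simp add: G_def e_def field_simps power2_eq_square)
  also have "(G {u, v} 1 1 + G {u, v} 1 (-1) + G {u, v} (-1) 1 + G {u, v} (-1) (-1)) / 4 =
     - (a\<^sup>2 * b\<^sup>2 * of_real (xu * xv))"
    using uv by (simp add: G_def e_def field_simps power2_eq_square doubleton_eq_iff)
  finally have "of_real (moment V \<psi> (\<lambda>s. (\<Prod>k\<in>C. of_int (s k)) * (\<Prod>x\<in>V0. 1 + B x * of_int (s x)))) =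
    (of_real ((cos \<beta>)\<^sup>2 * \<theta>\<^sup>2 * pu * pv +
    cos \<beta> * sin \<beta> * sin \<gamma> * (2 * (cos \<gamma>)\<^sup>2 - (sin \<gamma>)\<^sup>2 * (yu + yv) +
      (cos \<gamma>)\<^sup>2 * \<theta> * (pv * xu + pu * xv)) +
    (sin \<beta>)\<^sup>2 * (sin \<gamma>)\<^sup>2 * (cos \<gamma>)\<^sup>2 * xu * xv) :: complex)"
    by (simp add: a_def b_def power2_eq_square algebra_simps)
  then show ?thesis
    unfolding of_real_eq_iff using uv by (simp add: C_def defs u_def v_def mult.assoc)
qed

text \<open>Only the leaf is in the core; the centre is integrated out as part of its star. The
  value of \<open>A\<close> at the centre is left general so that the spin of the centre can be
  absorbed into the factor of its star.\<close>

lemma star_edge_moment: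
  assumes g: "g \<in> H" "nb g \<in> V0"
    and no_loop: "\<And>h. h \<in> H \<Longrightarrow> fst h = fst g \<Longrightarrow> nb h \<noteq> fst g"
    and clean: "clean {fst g}" and A: "\<And>x. x \<in> V0 \<Longrightarrow> x \<noteq> nb g \<Longrightarrow> A x = 1"
  shows "moment V \<psi> (\<lambda>s. of_int (s (fst g)) * (\<Prod>x\<in>V0. A x + B x * of_int (s x))) =
    cos \<beta> * \<theta> * B (nb g) + sin \<beta> * sin \<gamma> * (cos \<beta> * B (nb g) * (cos \<gamma>)\<^sup>2
      + A (nb g) * (cos \<gamma>)\<^sup>2 * \<xi>sum B g - (sin \<gamma>)\<^sup>2 * cos \<beta> * B (nb g) * \<xi>prod B g)"
proof -
  define u x where "u = fst g" and "x = nb g"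
  define a b :: complex where "a = of_real (sin \<gamma>)" and "b = of_real (cos \<gamma>)"
  define X Y where "X = \<xi>sum B g" and "Y = \<xi>prod B g"
  have u: "u \<in> V" "u \<in> N" "par u = x" "u \<notin> V0"
    using g V0_half_edge_at[OF g] fst_V by (auto simp: u_def x_def)
  define F where "F = core_edges {u}"
  have F: "F = oth g"
  proof
    show "F \<subseteq> oth g" using g by (auto simp: F_def core_edges_def oth_def u_def)
    show "oth g \<subseteq> F"
    proof
      fix h assume h: "h \<in> oth g"
      then have "nb h \<notin> V0" using V0_half_edge_unique[OF _ g(1) _ _ g(2), of h] by (auto simp: oth_def)
      then show "h \<in> F" using h no_loop[of h] by (auto simp: F_def core_edges_def oth_def u_def)
    qed
  qed
  define G where "G = (\<lambda>T z. of_int z * (if u \<in> T then (of_real (A x) * b + \<i> * a * of_real (cos \<beta> * B x) * of_int z) *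
       (b\<^sup>2 + b * (\<i> * a * of_int z) * of_real X + (\<i> * a * of_int z)\<^sup>2 * of_real Y)
     else of_real (A x) + of_real (\<theta> * B x) * of_int z))"
  have core: "(\<Sum>s\<in>spins V. (\<Prod>k\<in>{u}. of_int (s k)) * (\<Prod>h\<in>{h\<in>H. fst h \<in> T \<and> nb h \<notin> T \<union> V0}. w s h) *
         (\<Prod>x\<in>V0. K A B T x s)) / 2 ^ n = (G T 1 + G T (-1)) / 2"
    if T: "T \<subseteq> {u}" for T
  proof -
    have "(\<Sum>s\<in>spins V. (\<Prod>k\<in>{u}. of_int (s k)) * (\<Prod>h\<in>{h\<in>H. fst h \<in> T \<and> nb h \<notin> T \<union> V0}. w s h) *
         (\<Prod>x\<in>V0. K A B T x s)) =
      (\<Sum>s\<in>spins V. (\<Prod>k\<in>{u}. of_int (s k)) * (\<Prod>h\<in>{h\<in>H. fst h \<in> T \<and> nb h \<in> {u} - T}. w s h) *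
       (\<Prod>k\<in>{u}. \<kappa> A B T k s) *
       (\<Prod>h\<in>F. if fst h \<in> T then of_real (cos \<gamma>) + \<i> * of_real (sin \<gamma>) * of_real (\<theta> * P B (nb h)) * of_int (s (fst h)) else 1))"
      using clean u T A by (intro sum_core) (auto simp: F_def core_edges_def clean_def u_def x_def)
    also have "\<dots> = (\<Sum>s\<in>spins V. G T (s u))"
    proof (rule sum.cong[OF refl])
      fix s
      have w: "(\<Prod>h\<in>{h\<in>H. fst h \<in> T \<and> nb h \<in> {u} - T}. w s h) = 1"
        using T by (intro prod.neutral) auto
      have q: "(\<Prod>h\<in>F. if fst h \<in> T then of_real (cos \<gamma>) + \<i> * of_real (sin \<gamma>) * of_real (\<theta> * P B (nb h)) * of_int (s (fst h)) else 1) =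
        (if u \<in> T then b\<^sup>2 + b * (\<i> * a * of_int (s u)) * of_real X + (\<i> * a * of_int (s u))\<^sup>2 * of_real Y else 1)"
      proof (cases "u \<in> T")
        case True
        have "(\<Prod>h\<in>F. if fst h \<in> T then of_real (cos \<gamma>) + \<i> * of_real (sin \<gamma>) * of_real (\<theta> * P B (nb h)) * of_int (s (fst h)) else 1) =
          (\<Prod>h\<in>oth g. b + (\<i> * a * of_int (s u)) * of_real (\<xi> B h))"
        proof (rule prod.cong[OF F])
          fix h assume "h \<in> oth g"
          then have "fst h = u" "nb h \<notin> V0" using F by (auto simp: F_def core_edges_def)
          then show "(if fst h \<in> T then of_real (cos \<gamma>) + \<i> * of_real (sin \<gamma>) * of_real (\<theta> * P B (nb h)) * of_int (s (fst h)) else 1) =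
            b + (\<i> * a * of_int (s u)) * of_real (\<xi> B h)"
            using True by (simp add: a_def b_def \<xi>_def)
        qed
        then show ?thesis using True by (simp add: prod_oth[OF g(1)] X_def Y_def)
      next
        case False
        have "fst h \<notin> T" if "h \<in> F" for h using that False by (auto simp: F_def core_edges_def)
        then show ?thesis using False by (simp cong: prod.cong)
      qed
      show "(\<Prod>k\<in>{u}. of_int (s k)) * (\<Prod>h\<in>{h\<in>H. fst h \<in> T \<and> nb h \<in> {u} - T}. w s h) *
       (\<Prod>k\<in>{u}. \<kappa> A B T k s) *
       (\<Prod>h\<in>F. if fst h \<in> T then of_real (cos \<gamma>) + \<i> * of_real (sin \<gamma>) * of_real (\<theta> * P B (nb h)) * of_int (s (fst h)) else 1) = G T (s u)"
        unfolding w q G_def using u by (simp add: \<kappa>_def a_def b_def mult_ac)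
    qed
    finally show ?thesis
      using mean_one[OF finite_V u(1), of "G T"] by simp
  qed
  have "of_real (moment V \<psi> (\<lambda>s. (\<Prod>k\<in>{u}. of_int (s k)) * (\<Prod>x\<in>V0. A x + B x * of_int (s x)))) =
     (\<Sum>T\<in>Pow {u}. of_real (cos \<beta>) ^ card ({u} - T) * (- \<i> * of_real (sin \<beta>)) ^ card T * ((G T 1 + G T (-1)) / 2))"
  proof -
    have C: "{u} \<subseteq> V - V0" using u by auto
    show ?thesis unfolding moment_stars[OF C, of A B]
      by (intro sum.cong refl arg_cong2[where f = "(*)"] core) auto
  qed
  also have "\<dots> = of_real (cos \<beta>) * ((G {} 1 + G {} (-1)) / 2) + (- \<i> * of_real (sin \<beta>)) * ((G {u} 1 + G {u} (-1)) / 2)"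
    by (simp add: Pow_insert)
  also have "(G {} 1 + G {} (-1)) / 2 = of_real (\<theta> * B x)"
    by (simp add: G_def)
  also have "(G {u} 1 + G {u} (-1)) / 2 = (\<i> * a * of_real (cos \<beta> * B x) * (b\<^sup>2 - a\<^sup>2 * of_real Y) + of_real (A x) * b * (b * \<i> * a * of_real X))"
    by (simp add: G_def field_simps power2_eq_square)
  finally have "of_real (moment V \<psi> (\<lambda>s. (\<Prod>k\<in>{u}. of_int (s k)) * (\<Prod>x\<in>V0. A x + B x * of_int (s x)))) =
     (of_real (cos \<beta> * \<theta> * B x + sin \<beta> * sin \<gamma> * (cos \<beta> * B x * (cos \<gamma>)\<^sup>2
      + A x * (cos \<gamma>)\<^sup>2 * X - (sin \<gamma>)\<^sup>2 * cos \<beta> * B x * Y)) :: complex)"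
    by (simp add: a_def b_def power2_eq_square algebra_simps)
  then show ?thesis
    unfolding of_real_eq_iff by (simp add: u_def x_def X_def Y_def)
qed

text \<open>The case of an empty core. With \<open>B = \<sigma>\<close> it says that every outcome
  on \<open>V0\<close> has probability \<open>1 / 2 ^ card V0\<close>.\<close>

lemma moment_agree: "moment V \<psi> (\<lambda>s. \<Prod>x\<in>V0. 1 + B x * of_int (s x)) = 1"
proof -
  have "of_real (moment V \<psi> (\<lambda>s. (\<Prod>v\<in>{}. of_int (s v)) * (\<Prod>x\<in>V0. 1 + B x * of_int (s x)))) =
    (\<Sum>s\<in>spins V. 1 * (\<Prod>x\<in>V0. K (\<lambda>_. 1) B {} x s)) / 2 ^ n"
    by (subst moment_stars) auto
  also have "(\<Sum>s\<in>spins V. 1 * (\<Prod>x\<in>V0. K (\<lambda>_. 1) B {} x s)) = (\<Sum>s\<in>spins V. 1 * (\<Prod>u\<in>{}. \<kappa> (\<lambda>_. 1) B {} u s))"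
    by (rule sum_stars) auto
  finally have "of_real (moment V \<psi> (\<lambda>s. (\<Prod>v\<in>{}. of_int (s v)) * (\<Prod>x\<in>V0. 1 + B x * of_int (s x)))) = (1 :: complex)"
    by (simp add: card_spins)
  then show ?thesis by simp
qed

end

section \<open>The energy gap as a sum over short paths between stars\<close>

locale qaoa_stars = matched_stars +
  assumes \<beta>: "\<beta> = - pi / 4" and \<gamma>: "\<gamma> = arctan (1 / sqrt 2)"
begin

abbreviation "c \<equiv> 1 / sqrt (2 :: real)"

lemma cos_\<beta>: "cos \<beta> = c" and sin_\<beta>: "sin \<beta> = - c"
  by (simp_all add: \<beta> cos_45 sin_45 real_div_sqrt real_sqrt_divide field_simps)

lemma sin_\<gamma>: "sin \<gamma> = 1 / sqrt 3" and cos_\<gamma>: "cos \<gamma> = sqrt (2 / 3)"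
proof -
  have "sqrt (1 + (1 / sqrt 2)\<^sup>2) = sqrt 3 / sqrt 2"
    by (simp add: power_divide real_sqrt_divide[symmetric])
  then show "sin \<gamma> = 1 / sqrt 3" "cos \<gamma> = sqrt (2 / 3)"
    by (simp_all add: \<gamma> sin_arctan cos_arctan real_sqrt_divide)
qed

lemma \<theta>_eq: "\<theta> = - (2 / 3) * c / sqrt 3"
  unfolding \<theta>_def sin_\<beta> sin_\<gamma> cos_\<gamma> by simp

lemma \<theta>_sq: "\<theta>\<^sup>2 = 2 / 27"
  unfolding \<theta>_eq by (simp add: power_mult_distrib power_divide)

definition U where "U = {h\<in>H. fst h \<notin> V0 \<and> nb h \<notin> V0}"
definition HS where "HS = {h\<in>H. nb h \<in> V0}"

lemma finite_U [simp, intro]: "finite U" and finite_HS [simp, intro]: "finite HS"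
  by (auto simp: U_def HS_def)

lemma \<mu>_U: "h \<in> U \<Longrightarrow> \<mu> h \<in> U"
  by (auto simp: U_def nb_def)

lemma sum_U_\<mu>: "(\<Sum>h\<in>U. f (\<mu> h)) = (\<Sum>h\<in>U. f h)"
  by (rule sum.reindex_bij_witness[of _ \<mu> \<mu>]) (auto simp: \<mu>_U, auto simp: U_def)

text \<open>What \<open>free_edge_moment\<close> demands of the surroundings of an edge.\<close>

definition good :: "half_edge \<Rightarrow> bool" where
  "good g \<longleftrightarrow> fst g \<noteq> nb g \<and>
     (\<forall>h\<in>H. fst h \<in> {fst g, nb g} \<longrightarrow> nb h \<in> {fst g, nb g} \<longrightarrow> h = g \<or> h = \<mu> g) \<and>
     clean {fst g, nb g}"

text \<open>The product over \<open>V0\<close> has mean 1, so \<open>B = \<sigma>\<close> gives the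
  correlation conditioned on \<sigma> and \<open>B = 0\<close> the unconditioned one.\<close>

definition cor :: "(nat \<Rightarrow> real) \<Rightarrow> half_edge \<Rightarrow> real" where
  "cor B h = moment V \<psi> (\<lambda>s. of_int (s (fst h) * s (nb h)) * (\<Prod>x\<in>V0. 1 + B x * of_int (s x)))"

text \<open>The 4 combines the factor 1/2 of the Hamiltonian with the double count of edges by
  half-edges.\<close>

lemma energy_gap:
  assumes \<sigma>: "\<sigma> \<in> spins V0"
  shows "projected_energy V E V0 \<sigma> \<psi> - energy V E \<psi> = (\<Sum>h\<in>H. cor (\<lambda>_. 0) h - cor (\<lambda>x. of_int (\<sigma> x)) h) / 4"
proof -
  define B where "B = (\<lambda>x. real_of_int (\<sigma> x))"
  define Q where "Q = (\<lambda>B s. \<Prod>x\<in>V0. 1 + B x * real_of_int (s x))"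
  have finM: "finite M" by (rule finite_perfect_matching[OF M finite_H])
  have size: "size E = card M" by (simp add: multigraph_of_def)
  have cut: "cut_value E s = (real (card M) - (\<Sum>h\<in>H. of_int (s (fst h) * s (nb h))) / 2) / 2" for s
  proof -
    have "real_of_int (ising E s) = (\<Sum>p\<in>M. of_int (\<Prod>h\<in>p. s (fst h)))"
      by (simp add: ising_eq)
    also have "\<dots> = (\<Sum>h\<in>H. of_int (\<Prod>h\<in>{h, \<mu> h}. s (fst h))) / 2"
      by (rule sum_over_perfect_matching[OF M finite_H])
    also have "(\<Sum>h\<in>H. real_of_int (\<Prod>h\<in>{h, \<mu> h}. s (fst h))) = (\<Sum>h\<in>H. of_int (s (fst h) * s (nb h)))"
    proof (rule sum.cong[OF refl])
      fix h assume "h \<in> H"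
      then have "\<mu> h \<noteq> h" using partner_neq[OF M] by auto
      then show "real_of_int (\<Prod>h\<in>{h, \<mu> h}. s (fst h)) = of_int (s (fst h) * s (nb h))"
        by (simp add: nb_def)
    qed
    finally show ?thesis by (simp add: cut_value_def size)
  qed
  have mean: "moment V \<psi> (\<lambda>s. Q B s * cut_value E s) = (real (card M) - (\<Sum>h\<in>H. cor B h) / 2) / 2" for B
  proof -
    have "moment V \<psi> (\<lambda>s. Q B s * cut_value E s) =
      moment V \<psi> (\<lambda>s. (real (card M) / 2) * Q B s - (1 / 4) * (\<Sum>h\<in>H. of_int (s (fst h) * s (nb h)) * Q B s))"
      by (intro moment_cong) (simp add: cut sum_distrib_left[symmetric] sum_distrib_right[symmetric] field_simps)
    also have "\<dots> = (real (card M) / 2) * moment V \<psi> (Q B) - (1 / 4) * (\<Sum>h\<in>H. cor B h)"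
      unfolding moment_diff moment_cmult moment_sum cor_def Q_def by simp
    also have "moment V \<psi> (Q B) = 1" unfolding Q_def by (rule moment_agree)
    finally show ?thesis by (simp add: field_simps)
  qed
  have agree: "agree V0 \<sigma> = (\<lambda>s. (1 / 2 ^ card V0) * Q B s)"
    by (simp add: agree_def Q_def B_def prod_dividef fun_eq_iff)
  have pe: "projected_energy V E V0 \<sigma> \<psi> = moment V \<psi> (\<lambda>s. Q B s * cut_value E s)"
  proof -
    have "moment V \<psi> (agree V0 \<sigma>) = 1 / 2 ^ card V0"
      unfolding agree moment_cmult using moment_agree[of B] by (simp add: Q_def)
    moreover have "moment V \<psi> (\<lambda>s. agree V0 \<sigma> s * cut_value E s) = (1 / 2 ^ card V0) * moment V \<psi> (\<lambda>s. Q B s * cut_value E s)"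
      unfolding agree moment_cmult[symmetric] by (simp add: mult.assoc)
    ultimately show ?thesis
      using projected_energy_eq[OF finite_V0 \<sigma> V0, of E \<psi>] by simp
  qed
  have en: "energy V E \<psi> = moment V \<psi> (\<lambda>s. Q (\<lambda>_. 0) s * cut_value E s)"
    unfolding energy_eq by (simp add: Q_def)
  show ?thesis unfolding pe en mean B_def by (simp add: sum_subtractf field_simps)
qed

lemma oth_HS: "h \<in> HS \<Longrightarrow> oth h \<subseteq> U"
proof
  fix h' assume h: "h \<in> HS" and h': "h' \<in> oth h"
  have "nb h' \<notin> V0" using V0_half_edge_unique[of h' h] h h' by (auto simp: HS_def oth_def)
  moreover have "fst h \<notin> V0" using V0_half_edge_at(3)[of h] h by (auto simp: HS_def)
  ultimately show "h' \<in> U" using h' by (auto simp: oth_def U_def)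
qed

end

section \<open>Exact change of the correlations for a fixed outcome\<close>

locale qaoa_outcome = qaoa_stars +
  fixes \<sigma> :: "nat \<Rightarrow> int"
  assumes \<sigma>: "\<sigma> \<in> spins V0"
begin

definition "S x = real_of_int (\<sigma> x)"

lemma S_abs: "x \<in> V0 \<Longrightarrow> \<bar>S x\<bar> = 1"
  using spins_mem[OF \<sigma>, of x] by (auto simp: S_def)

abbreviation "p \<equiv> P S"
abbreviation "x \<equiv> \<xi> S"
abbreviation "xs \<equiv> \<xi>sum S"
abbreviation "xp \<equiv> \<xi>prod S"

lemma p_abs: "\<bar>p u\<bar> = (if u \<in> N then 1 else 0)"
  using S_abs[OF par_V0] by (auto simp: P_def)

lemma \<theta>_abs: "\<bar>\<theta>\<bar> \<le> 1"
proof -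
  have "\<theta>\<^sup>2 \<le> 1" by (simp add: \<theta>_sq)
  then show ?thesis by (simp add: abs_square_le_1)
qed

lemma c_abs: "\<bar>c\<bar> \<le> 1"
  by (simp add: field_simps)

lemma x_abs: "\<bar>x h\<bar> \<le> 1"
proof (cases "nb h \<in> V0")
  case True
  then show ?thesis using S_abs c_abs by (simp add: \<xi>_def abs_mult cos_\<beta>)
next
  case False
  have "\<bar>\<theta>\<bar> * \<bar>p (nb h)\<bar> \<le> 1 * 1" using \<theta>_abs by (intro mult_mono) (auto simp: p_abs)
  then show ?thesis using False by (simp add: \<xi>_def abs_mult)
qed

lemma xs_abs: "h \<in> H \<Longrightarrow> \<bar>xs h\<bar> \<le> 2"
proof -
  assume h: "h \<in> H"
  have "\<bar>xs h\<bar> \<le> (\<Sum>h'\<in>oth h. \<bar>x h'\<bar>)" unfolding \<xi>sum_def by (rule sum_abs)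
  also have "\<dots> \<le> (\<Sum>h'\<in>oth h. 1)" by (intro sum_mono x_abs)
  finally show ?thesis using card_oth[OF h] by simp
qed

lemma xp_abs: "\<bar>xp h\<bar> \<le> 1"
  unfolding \<xi>prod_def abs_prod by (intro prod_le_1) (auto simp: x_abs)

text \<open>The bias-dependent part of \<open>free_edge_moment\<close>. At the given angles
  \<open>sin \<beta> * sin \<gamma> = 3 / 2 * \<theta>\<close> and
  \<open>1 / 9 = 3 / 2 * \<theta>\<^sup>2\<close>, so everything is expressed through
  \<open>\<theta>\<close> and \<open>c = cos \<beta>\<close>.\<close>

definition "form h = \<theta>\<^sup>2 / 2 * p (fst h) * p (nb h) - c * \<theta> / 2 * (xp h + xp (\<mu> h)) +
   c * \<theta>\<^sup>2 * (p (nb h) * xs h + p (fst h) * xs (\<mu> h)) + 3 / 2 * \<theta>\<^sup>2 * xs h * xs (\<mu> h)"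

definition "formS h = \<theta> * p (fst h) * xs h - c * \<theta> / 2 * xp h"

lemma cor_good:
  assumes h: "h \<in> U" and "good h"
  shows "cor S h - cor (\<lambda>_. 0) h = form h"
proof -
  have zero: "P (\<lambda>_. 0) u = 0" "\<xi> (\<lambda>_. 0) h = 0" for u h by (simp_all add: P_def \<xi>_def)
  have card: "card (oth h) = 2" "card (oth (\<mu> h)) = 2" using h card_oth by (auto simp: U_def)
  have sums: "\<xi>sum (\<lambda>_. 0) h = 0" "\<xi>sum (\<lambda>_. 0) (\<mu> h) = 0" "\<xi>prod (\<lambda>_. 0) h = 0" "\<xi>prod (\<lambda>_. 0) (\<mu> h) = 0"
    using card by (simp_all add: \<xi>sum_def \<xi>prod_def zero)
  have th: "- c * (1 / sqrt 3) = 3 / 2 * \<theta>" by (simp add: \<theta>_eq)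
  have eq: "cor B h = (1 / 2) * \<theta>\<^sup>2 * P B (fst h) * P B (nb h) +
    c * (- c * (1 / sqrt 3)) * (2 * (2 / 3) - (1 / 3) * (\<xi>prod B h + \<xi>prod B (\<mu> h)) +
      (2 / 3) * \<theta> * (P B (nb h) * \<xi>sum B h + P B (fst h) * \<xi>sum B (\<mu> h))) +
    (1 / 9) * \<xi>sum B h * \<xi>sum B (\<mu> h)" for B
  proof -
    have hU: "h \<in> H" "fst h \<notin> V0" "nb h \<notin> V0" using h by (auto simp: U_def)
    have gd: "fst h \<noteq> nb h" "clean {fst h, nb h}"
      "\<And>h'. h' \<in> H \<Longrightarrow> fst h' \<in> {fst h, nb h} \<Longrightarrow> nb h' \<in> {fst h, nb h} \<Longrightarrow> h' = h \<or> h' = \<mu> h"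
      using assms(2) unfolding good_def by blast+
    have "cor B h = moment V \<psi> (\<lambda>s. of_int (s (fst h) * s (nb h)) * (\<Prod>x\<in>V0. 1 + B x * of_int (s x)))"
      by (simp only: cor_def)
    also note free_edge_moment[OF hU gd(1,3,2)]
    finally show ?thesis
      unfolding cos_\<beta> sin_\<beta> cos_\<gamma> sin_\<gamma>
      by (simp add: power_divide power_mult_distrib mult.assoc)
  qed
  have ninth: "1 / 9 = 3 / 2 * \<theta>\<^sup>2" by (simp add: \<theta>_sq)
  show ?thesis
    unfolding eq th ninth sums zero form_def by (simp add: algebra_simps power2_eq_square)
qed

text \<open>One good free edge at a leaf certifies the surroundings of the leaf. A star edge can
  therefore be exceptional only if all free edges at its leaf are bad.\<close>

lemma good_oth_HS:
  assumes h: "h \<in> HS" and g: "g \<in> oth h" "good g"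
  shows "clean {fst h}" and "\<And>h'. h' \<in> H \<Longrightarrow> fst h' = fst h \<Longrightarrow> nb h' \<noteq> fst h"
proof -
  have fg: "fst g = fst h" "g \<in> H" "nb g \<notin> V0" using g oth_HS[OF h] by (auto simp: oth_def U_def)
  define u v where "u = fst h" and "v = nb g"
  have neq: "u \<noteq> v" using g(2) fg by (auto simp: good_def u_def v_def)
  have only: "h' = g \<or> h' = \<mu> g" if "h' \<in> H" "fst h' \<in> {u, v}" "nb h' \<in> {u, v}" for h'
    using g(2) that unfolding good_def u_def v_def fg(1)[symmetric] by blast
  have fm: "fst (\<mu> g) = v" by (simp add: v_def nb_def)
  show no_loop: "nb h' \<noteq> fst h" if "h' \<in> H" "fst h' = fst h" for h'
  proof
    assume "nb h' = fst h"
    then have "h' = g \<or> h' = \<mu> g" using only[of h'] that by (simp add: u_def)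
    then show False using \<open>nb h' = fst h\<close> that fm neq by (auto simp: u_def v_def)
  qed
  have cl: "inj_on nb (core_edges {u, v})" "inj_on par (({u, v} \<union> nb ` core_edges {u, v}) \<inter> N)"
    using g(2) fg(1) by (auto simp: good_def clean_def u_def v_def)
  have core: "core_edges {u} \<subseteq> insert g (core_edges {u, v})"
  proof
    fix h' assume h': "h' \<in> core_edges {u}"
    show "h' \<in> insert g (core_edges {u, v})"
    proof (cases "nb h' = v")
      case True
      then have "h' = g \<or> h' = \<mu> g" using only[of h'] h' by (auto simp: core_edges_def)
      then show ?thesis using fm neq h' by (auto simp: core_edges_def)
    qed (use h' in \<open>auto simp: core_edges_def\<close>)
  qed
  have "inj_on nb (core_edges {u})"
  proof (rule inj_onI)
    fix h1 h2 assume h: "h1 \<in> core_edges {u}" "h2 \<in> core_edges {u}" "nb h1 = nb h2"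
    then have "h1 \<in> core_edges {u, v} \<or> h1 = g" "h2 \<in> core_edges {u, v} \<or> h2 = g" using core by auto
    then show "h1 = h2"
      using h(3) inj_onD[OF cl(1) h(3)] by (auto simp: core_edges_def v_def)
  qed
  moreover have "({u} \<union> nb ` core_edges {u}) \<inter> N \<subseteq> ({u, v} \<union> nb ` core_edges {u, v}) \<inter> N"
    using core by (auto simp: v_def)
  then have "inj_on par (({u} \<union> nb ` core_edges {u}) \<inter> N)" using inj_on_subset[OF cl(2)] by blast
  ultimately show "clean {fst h}" by (simp add: clean_def u_def)
qed

lemma cor_star:
  assumes h: "h \<in> HS" and g: "g \<in> oth h" "good g"
  shows "cor S h - cor (\<lambda>_. 0) h = formS h"
proof -
  define v where "v = nb h"
  have v: "v \<in> V0" and hH: "h \<in> H" using h by (auto simp: HS_def v_def)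
  have u: "fst h \<in> N" "par (fst h) = v" using V0_half_edge_at[of h] h by (auto simp: HS_def v_def)
  note cl = good_oth_HS[OF h g]
  \<comment> \<open>Since \<open>s v * s v = 1\<close>, the factor
    \<open>s v * (1 + B v * s v)\<close> equals \<open>B v + s v\<close>: the spin of the centre is
    absorbed by exchanging the two coefficients at \<open>v\<close>.\<close>
  have shift: "moment V \<psi> (\<lambda>s. of_int (s (fst h)) * (\<Prod>x\<in>V0. (if x = v then B v else 1) + (if x = v then 1 else B x) * of_int (s x))) = cor B h"
    for B
  proof -
    have "of_int (s (fst h)) * (\<Prod>x\<in>V0. (if x = v then B v else 1) + (if x = v then 1 else B x) * of_int (s x)) =
      of_int (s (fst h) * s (nb h)) * (\<Prod>x\<in>V0. 1 + B x * of_int (s x))" if s: "s \<in> spins V" for s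
    proof -
      have "(\<Prod>x\<in>V0. (if x = v then B v else 1) + (if x = v then 1 else B x) * of_int (s x)) =
        (B v + of_int (s v)) * (\<Prod>x\<in>V0 - {v}. 1 + B x * of_int (s x))"
        using v by (subst prod.remove[of _ v]) (auto intro!: prod.cong)
      moreover have "(\<Prod>x\<in>V0. 1 + B x * of_int (s x)) = (1 + B v * of_int (s v)) * (\<Prod>x\<in>V0 - {v}. 1 + B x * of_int (s x))"
        using v by (intro prod.remove) auto
      moreover have "s v = 1 \<or> s v = -1" using spins_mem[OF s, of v] v V0 by auto
      ultimately show ?thesis by (auto simp: v_def[symmetric] algebra_simps)
    qed
    then show ?thesis unfolding cor_def by (intro moment_cong) auto
  qed
  have th: "- c * (1 / sqrt 3) = 3 / 2 * \<theta>" by (simp add: \<theta>_eq)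
  \<comment> \<open>The exchange at \<open>v\<close> is invisible to the other edges of the leaf: a
    second leaf of the star \<open>v\<close> among their far ends would contradict
    \<open>clean\<close>.\<close>
  have same: "\<xi> (\<lambda>x. if x = v then 1 else B x) h' = \<xi> B h'" if h': "h' \<in> oth h" for B h'
  proof -
    have h'U: "h' \<in> U" using oth_HS[OF h] h' by auto
    have "par (nb h') \<noteq> v" if "nb h' \<in> N"
    proof
      assume eq: "par (nb h') = v"
      have hh: "h' \<in> H" "fst h' = fst h" using h' by (auto simp: oth_def)
      have "h' \<in> core_edges {fst h}"
        using cl(2)[OF hh] hh h'U by (auto simp: core_edges_def U_def)
      then have "nb h' = fst h"
        using inj_onD[OF conjunct2[OF cl(1)[unfolded clean_def]], of "nb h'" "fst h"] u eq that by auto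
      then show False using cl(2)[OF hh] by simp
    qed
    then show ?thesis using h'U by (auto simp: \<xi>_def P_def U_def)
  qed
  have sums: "\<xi>sum (\<lambda>x. if x = v then 1 else B x) h = \<xi>sum B h" "\<xi>prod (\<lambda>x. if x = v then 1 else B x) h = \<xi>prod B h" for B
    unfolding \<xi>sum_def \<xi>prod_def using same by (auto intro!: sum.cong prod.cong)
  have eq: "cor B h = c * \<theta> + - c * (1 / sqrt 3) * (c * (2 / 3) + B v * (2 / 3) * \<xi>sum B h - (1 / 3) * c * \<xi>prod B h)" for B
    unfolding shift[symmetric]
      star_edge_moment[OF hH v[unfolded v_def] cl(2) cl(1), where A = "\<lambda>x. if x = v then B v else 1"
        and B = "\<lambda>x. if x = v then 1 else B x", unfolded v_def[symmetric], simplified]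
      sums cos_\<beta> sin_\<beta> cos_\<gamma> sin_\<gamma>
    by (simp add: power_divide)
  have "\<xi> (\<lambda>_. 0) h' = 0" for h' by (simp add: \<xi>_def P_def)
  then have zero: "\<xi>sum (\<lambda>_. 0) h = 0" "\<xi>prod (\<lambda>_. 0) h = 0"
    using card_oth[OF hH] by (simp_all add: \<xi>sum_def \<xi>prod_def)
  have "p (fst h) = S v" using u by (simp add: P_def)
  then show ?thesis unfolding eq th zero formS_def by (simp add: algebra_simps)
qed

end

lemma abs_mult_le: "\<bar>x\<bar> \<le> a \<Longrightarrow> \<bar>y\<bar> \<le> b \<Longrightarrow> \<bar>x * y\<bar> \<le> a * (b :: real)"
  by (simp add: abs_mult mult_mono)

section \<open>Path sums and their combinatorics\<close>

context qaoa_stars begin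

definition "Bad = {g\<in>U. \<not> good g}"

definition "ind u = (if u \<in> N then 1 else 0 :: real)"
text \<open>Here and in the next two definitions every path between two vertices of
  \<open>V0\<close> is counted once per direction. Degenerate walks are included, which is harmless
  for upper bounds.\<close>

definition "paths3 = (\<Sum>g\<in>U. ind (fst g) * ind (nb g))"
definition "paths4 = (\<Sum>g\<in>U. \<Sum>h\<in>oth g \<inter> U. ind (nb g) * ind (nb h))"
definition "paths5 = (\<Sum>g\<in>U. \<Sum>h\<in>oth g \<inter> U. \<Sum>h'\<in>oth (\<mu> g) \<inter> U. ind (nb h) * ind (nb h'))"

lemma finite_Bad [simp]: "finite Bad"
  by (simp add: Bad_def)

lemma HS_nonV0: "h \<in> HS \<Longrightarrow> fst h \<notin> V0"
  using V0_half_edge_at(3)[of h] by (simp add: HS_def)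

lemma U_HS: "{h\<in>H. fst h \<notin> V0} = U \<union> HS" "U \<inter> HS = {}"
  using HS_nonV0 by (auto simp: U_def HS_def)

lemma sum_H:
  fixes f :: "half_edge \<Rightarrow> real"
  assumes "\<And>h. h \<in> H \<Longrightarrow> f (\<mu> h) = f h"
  shows "(\<Sum>h\<in>H. f h) = (\<Sum>h\<in>U. f h) + 2 * (\<Sum>h\<in>HS. f h)"
proof -
  have "H = {h\<in>H. fst h \<notin> V0} \<union> {h\<in>H. fst h \<in> V0}" by auto
  then have "(\<Sum>h\<in>H. f h) = (\<Sum>h\<in>{h\<in>H. fst h \<notin> V0}. f h) + (\<Sum>h\<in>{h\<in>H. fst h \<in> V0}. f h)"
    using finite_H by (metis (no_types, lifting) Collect_disj_eq disjoint_iff finite_Un mem_Collect_eq sum.union_disjoint)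
  also have "(\<Sum>h\<in>{h\<in>H. fst h \<notin> V0}. f h) = (\<Sum>h\<in>U. f h) + (\<Sum>h\<in>HS. f h)"
    unfolding U_HS(1) by (rule sum.union_disjoint) (auto simp: U_HS(2))
  also have "(\<Sum>h\<in>{h\<in>H. fst h \<in> V0}. f h) = (\<Sum>h\<in>HS. f h)"
    by (rule sum.reindex_bij_witness[of _ \<mu> \<mu>]) (auto simp: HS_def nb_def assms)
  finally show ?thesis by simp
qed

lemma bij_fst_HS: "bij_betw fst HS N"
proof (rule bij_betw_imageI)
  show "inj_on fst HS"
    using V0_half_edge_unique by (intro inj_onI) (auto simp: HS_def)
  show "fst ` HS = N"
  proof
    show "fst ` HS \<subseteq> N" using V0_half_edge_at(1) by (auto simp: HS_def)
    show "N \<subseteq> fst ` HS"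
    proof
      fix u assume "u \<in> N"
      then obtain h where "h \<in> H" "fst h = u" "nb h \<in> V0" using N_half_edge by metis
      then show "u \<in> fst ` HS" by (auto simp: HS_def)
    qed
  qed
qed

lemma finite_N [simp]: "finite N"
  using finite_subset[OF N_subset] by simp

text \<open>Each leaf has exactly one half-edge into \<open>V0\<close>, so a sum over
  \<open>HS\<close> is a sum over leaves.\<close>

lemma sum_HS_oth:
  fixes f :: "half_edge \<Rightarrow> real"
  assumes "\<And>g. g \<in> U \<Longrightarrow> fst g \<notin> N \<Longrightarrow> f g = 0"
  shows "(\<Sum>h\<in>HS. \<Sum>g\<in>oth h \<inter> U. f g) = (\<Sum>g\<in>U. f g)"
proof -
  have "(\<Sum>h\<in>HS. \<Sum>g\<in>oth h \<inter> U. f g) = (\<Sum>h\<in>HS. \<Sum>g\<in>{g\<in>{g\<in>U. fst g \<in> N}. fst g = fst h}. f g)"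
  proof (intro sum.cong refl)
    fix h assume h: "h \<in> HS"
    then have "fst h \<in> N" using bij_fst_HS by (auto simp: bij_betw_def)
    moreover have "h \<notin> U" using h U_HS(2) by auto
    ultimately show "oth h \<inter> U = {g\<in>{g\<in>U. fst g \<in> N}. fst g = fst h}"
      by (auto simp: oth_def U_def)
  qed
  also have "\<dots> = (\<Sum>u\<in>N. \<Sum>g\<in>{g\<in>{g\<in>U. fst g \<in> N}. fst g = u}. f g)"
    by (rule sum.reindex_bij_betw[OF bij_fst_HS])
  also have "\<dots> = (\<Sum>g\<in>{g\<in>U. fst g \<in> N}. f g)"
    by (rule sum.group) auto
  also have "\<dots> = (\<Sum>g\<in>U. f g)"
    by (rule sum.mono_neutral_left) (auto intro: assms)
  finally show ?thesis .
qed

text \<open>At each vertex both sides are the second elementary symmetric polynomial of the values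
  at its three half-edges.\<close>

lemma sum_prod_oth:
  fixes f :: "half_edge \<Rightarrow> real"
  shows "(\<Sum>h\<in>U \<union> HS. \<Prod>h'\<in>oth h. f h') = (\<Sum>h\<in>U \<union> HS. f h * (\<Sum>h'\<in>oth h. f h')) / 2"
proof -
  have group: "(\<Sum>h\<in>U \<union> HS. F h) = (\<Sum>v\<in>V - V0. \<Sum>h\<in>{h\<in>U \<union> HS. fst h = v}. F h)" for F :: "half_edge \<Rightarrow> real"
  proof (rule sum.group[symmetric])
    show "fst ` (U \<union> HS) \<subseteq> V - V0"
    proof (rule image_subsetI)
      fix h assume "h \<in> U \<union> HS"
      then show "fst h \<in> V - V0" unfolding U_HS(1)[symmetric] using fst_V[of h] by simp
    qed
  qed auto
  have "(\<Sum>h\<in>{h\<in>U \<union> HS. fst h = v}. \<Prod>h'\<in>oth h. f h') = (\<Sum>h\<in>{h\<in>U \<union> HS. fst h = v}. f h * (\<Sum>h'\<in>oth h. f h')) / 2"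
    if v: "v \<in> V - V0" for v
  proof -
    have eq: "{h\<in>U \<union> HS. fst h = v} = {h\<in>H. fst h = v}" using v by (auto simp: U_HS(1)[symmetric])
    obtain h1 h2 h3 where h: "{h\<in>H. fst h = v} = {h1, h2, h3}" "h1 \<noteq> h2" "h1 \<noteq> h3" "h2 \<noteq> h3"
      using card_half_edges_at[of v] v by (auto simp: card_3_iff)
    have mem: "h' \<in> H \<and> fst h' = v \<longleftrightarrow> h' \<in> {h1, h2, h3}" for h' using h(1) by blast
    have o: "oth h' = {h1, h2, h3} - {h'}" if "h' \<in> {h1, h2, h3}" for h'
      using mem[of h'] that mem unfolding oth_def by blast
    have "oth h1 = {h2, h3}" "oth h2 = {h1, h3}" "oth h3 = {h1, h2}"
      using o[of h1] o[of h2] o[of h3] h by auto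
    then show ?thesis unfolding eq h(1) using h by (simp add: algebra_simps)
  qed
  then show ?thesis unfolding group by (simp add: sum_divide_distrib)
qed

end

context qaoa_outcome begin

definition "X h = (\<Sum>h'\<in>oth h \<inter> U. p (nb h'))"

lemma x_U: "h \<in> U \<Longrightarrow> x h = \<theta> * p (nb h)"
  by (simp add: \<xi>_def U_def)

lemma x_HS: "h \<in> HS \<Longrightarrow> x h = c * p (fst h)"
  using V0_half_edge_at[of h] by (simp add: \<xi>_def HS_def P_def cos_\<beta>)

lemma xs_HS: "h \<in> HS \<Longrightarrow> xs h = \<theta> * X h"
  unfolding \<xi>sum_def X_def sum_distrib_left using oth_HS[of h] x_U
  by (intro sum.cong) auto

lemma xs_U:
  assumes h: "h \<in> U"
  shows "xs h = c * p (fst h) + \<theta> * X h"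
proof -
  have "xs h = sum x (oth h \<inter> U) + sum x (oth h - U)"
    unfolding \<xi>sum_def by (rule sum.Int_Diff) simp
  moreover have "sum x (oth h \<inter> U) = \<theta> * X h"
    unfolding X_def sum_distrib_left using x_U by (intro sum.cong) auto
  moreover have "sum x (oth h - U) = c * p (fst h)"
  proof (cases "fst h \<in> N")
    case True
    then obtain h0 where h0: "h0 \<in> H" "fst h0 = fst h" "nb h0 \<in> V0" using N_half_edge by metis
    have "oth h - U = {h0}"
    proof
      show "oth h - U \<subseteq> {h0}"
        using h V0_half_edge_unique[OF _ h0(1) _ _ h0(3)] h0(2) by (auto simp: oth_def U_def)
      show "{h0} \<subseteq> oth h - U" using h h0 by (auto simp: oth_def U_def)
    qed
    then show ?thesis using x_HS[of h0] h0 by (simp add: HS_def)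
  next
    case False
    have "oth h - U = {}"
      using False h V0_half_edge_at(1) by (fastforce simp: oth_def U_def)
    then have "sum x (oth h - U) = 0" by (simp only: sum.empty)
    then show ?thesis using False by (simp add: P_def)
  qed
  ultimately show ?thesis by simp
qed

lemma X_abs: "\<bar>X h\<bar> \<le> (\<Sum>h'\<in>oth h \<inter> U. ind (nb h'))"
  unfolding X_def ind_def using sum_abs[of "\<lambda>h'. p (nb h')" "oth h \<inter> U"] by (simp add: p_abs)

text \<open>\<open>Q3\<close>, \<open>Q4\<close> and \<open>Q5\<close> are the signed path counts:
  each path carries the product of the outcomes at its two ends.\<close>

definition "Q3 = (\<Sum>g\<in>U. p (fst g) * p (nb g))"
definition "Q4 = (\<Sum>g\<in>U. p (nb g) * X g)"
definition "Q5 = (\<Sum>g\<in>U. X g * X (\<mu> g))"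

lemma sum_HS_pX: "(\<Sum>h\<in>HS. p (fst h) * X h) = Q3"
proof -
  have "(\<Sum>h\<in>HS. p (fst h) * X h) = (\<Sum>h\<in>HS. \<Sum>g\<in>oth h \<inter> U. p (fst g) * p (nb g))"
    unfolding X_def sum_distrib_left by (intro sum.cong) (auto simp: oth_def)
  also have "\<dots> = Q3" unfolding Q3_def by (rule sum_HS_oth) (simp add: P_def)
  finally show ?thesis .
qed

lemma sum_xp: "(\<Sum>h\<in>U. xp h) + (\<Sum>h\<in>HS. xp h) = c * \<theta> * Q3 + \<theta>\<^sup>2 / 2 * Q4"
proof -
  have "(\<Sum>h\<in>U. xp h) + (\<Sum>h\<in>HS. xp h) = (\<Sum>h\<in>U \<union> HS. xp h)"
    by (rule sum.union_disjoint[symmetric]) (auto simp: U_HS(2))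
  also have "\<dots> = (\<Sum>h\<in>U \<union> HS. x h * xs h) / 2"
    unfolding \<xi>prod_def \<xi>sum_def by (rule sum_prod_oth)
  also have "(\<Sum>h\<in>U \<union> HS. x h * xs h) = (\<Sum>h\<in>U. x h * xs h) + (\<Sum>h\<in>HS. x h * xs h)"
    by (rule sum.union_disjoint) (auto simp: U_HS(2))
  also have "(\<Sum>h\<in>U. x h * xs h) = (\<Sum>h\<in>U. c * \<theta> * (p (fst h) * p (nb h)) + \<theta>\<^sup>2 * (p (nb h) * X h))"
    by (intro sum.cong) (auto simp: x_U xs_U algebra_simps power2_eq_square)
  also have "(\<Sum>h\<in>HS. x h * xs h) = (\<Sum>h\<in>HS. c * \<theta> * (p (fst h) * X h))"
    by (intro sum.cong) (auto simp: x_HS xs_HS)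
  finally show ?thesis
    by (simp only: sum.distrib sum_distrib_left[symmetric] sum_HS_pX Q3_def[symmetric] Q4_def[symmetric])
       (simp add: field_simps)
qed

lemma \<mu>\<mu>_U: "h \<in> U \<Longrightarrow> \<mu> (\<mu> h) = h" "h \<in> U \<Longrightarrow> nb (\<mu> h) = fst h" "fst (\<mu> h) = nb h"
  by (auto simp: U_def nb_def)

text \<open>A path collects terms from several edges, and the products \<open>xp\<close> enter with
  the opposite sign. Thus 15/4 is 1/2 - 1/2 + 1 + 3/4 + 2, the last summand coming from the star
  edges, and 9/2 is -1/2 + 2 + 3.\<close>

lemma sum_forms: "(\<Sum>h\<in>U. form h) + 2 * (\<Sum>h\<in>HS. formS h) =
   15 / 4 * \<theta>\<^sup>2 * Q3 + 9 / 2 * c * \<theta> ^ 3 * Q4 + 3 / 2 * \<theta> ^ 4 * Q5"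
proof -
  have cc: "c * (c * z) = z / 2" for z by simp
  have 1: "(\<Sum>h\<in>U. form h) = \<theta>\<^sup>2 / 2 * Q3 - c * \<theta> / 2 * ((\<Sum>h\<in>U. xp h) + (\<Sum>h\<in>U. xp (\<mu> h))) +
      c * \<theta>\<^sup>2 * ((\<Sum>h\<in>U. p (nb h) * xs h) + (\<Sum>h\<in>U. p (fst h) * xs (\<mu> h))) + 3 / 2 * \<theta>\<^sup>2 * (\<Sum>h\<in>U. xs h * xs (\<mu> h))"
    unfolding form_def Q3_def
    by (simp add: sum.distrib sum_subtractf sum_distrib_left algebra_simps)
  have 2: "(\<Sum>h\<in>U. xp (\<mu> h)) = (\<Sum>h\<in>U. xp h)" by (rule sum_U_\<mu>)
  have 3: "(\<Sum>h\<in>U. p (fst h) * xs (\<mu> h)) = (\<Sum>h\<in>U. p (nb h) * xs h)"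
    using sum_U_\<mu>[of "\<lambda>h. p (fst h) * xs (\<mu> h)"] by (simp add: \<mu>\<mu>_U cong: sum.cong)
  have 4: "(\<Sum>h\<in>U. p (nb h) * xs h) = c * Q3 + \<theta> * Q4"
    by (simp add: xs_U Q3_def Q4_def sum.distrib sum_distrib_left algebra_simps cong: sum.cong)
  have 5: "(\<Sum>h\<in>U. p (fst h) * X (\<mu> h)) = Q4"
    using sum_U_\<mu>[of "\<lambda>h. p (fst h) * X (\<mu> h)"] by (simp add: \<mu>\<mu>_U Q4_def cong: sum.cong)
  have "(\<Sum>h\<in>U. xs h * xs (\<mu> h)) = (\<Sum>h\<in>U. c * c * (p (fst h) * p (nb h)) + c * \<theta> * (p (fst h) * X (\<mu> h)) +
     c * \<theta> * (p (nb h) * X h) + \<theta>\<^sup>2 * (X h * X (\<mu> h)))"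
    using \<mu>_U by (intro sum.cong refl) (simp add: xs_U \<mu>\<mu>_U algebra_simps power2_eq_square)
  then have 6: "(\<Sum>h\<in>U. xs h * xs (\<mu> h)) = c * c * Q3 + 2 * c * \<theta> * Q4 + \<theta>\<^sup>2 * Q5"
    by (simp only: sum.distrib sum_distrib_left[symmetric] 5 Q3_def[symmetric] Q4_def[symmetric] Q5_def[symmetric])
  have "(\<Sum>h\<in>HS. formS h) = (\<Sum>h\<in>HS. \<theta>\<^sup>2 * (p (fst h) * X h) - c * \<theta> / 2 * xp h)"
    by (intro sum.cong refl) (simp add: formS_def xs_HS power2_eq_square)
  then have 7: "(\<Sum>h\<in>HS. formS h) = \<theta>\<^sup>2 * Q3 - c * \<theta> / 2 * (\<Sum>h\<in>HS. xp h)"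
    by (simp only: sum_subtractf sum_distrib_left[symmetric] sum_HS_pX)
  have "(\<Sum>h\<in>U. form h) + 2 * (\<Sum>h\<in>HS. formS h) =
    5 / 2 * \<theta>\<^sup>2 * Q3 - c * \<theta> * ((\<Sum>h\<in>U. xp h) + (\<Sum>h\<in>HS. xp h)) + 2 * c * \<theta>\<^sup>2 * (c * Q3 + \<theta> * Q4) +
    3 / 2 * \<theta>\<^sup>2 * (c * c * Q3 + 2 * c * \<theta> * Q4 + \<theta>\<^sup>2 * Q5)"
    unfolding 1 2 3 4 6 7 by (simp add: algebra_simps)
  also have "\<dots> = 15 / 4 * \<theta>\<^sup>2 * Q3 + 9 / 2 * c * \<theta> ^ 3 * Q4 + 3 / 2 * \<theta> ^ 4 * Q5"
  proof -
    define k where "k = c"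
    have k: "k * (k * z) = z / 2" for z by (simp add: k_def)
    show ?thesis unfolding sum_xp k_def[symmetric]
      by (simp add: algebra_simps power2_eq_square power3_eq_cube power4_eq_xxxx k)
  qed
  finally show ?thesis .
qed

section \<open>Crude bounds that pay for the exceptional edges\<close>

lemma cor_\<mu>: "h \<in> H \<Longrightarrow> cor B (\<mu> h) = cor B h"
  by (simp add: cor_def nb_def mult.commute)

text \<open>The weights \<open>Q s\<close> are nonnegative with mean 1, so \<open>cor\<close> is an
  average of signs.\<close>

lemma cor_abs:
  assumes h: "h \<in> H" and B: "\<And>x. x \<in> V0 \<Longrightarrow> \<bar>B x\<bar> \<le> 1"
  shows "\<bar>cor B h\<bar> \<le> 1"
proof -
  define Q where "Q = (\<lambda>s. \<Prod>x\<in>V0. 1 + B x * real_of_int (s x))"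
  have le: "of_int (s (fst h) * s (nb h)) * Q s \<le> Q s" "- Q s \<le> of_int (s (fst h) * s (nb h)) * Q s" if s: "s \<in> spins V" for s
  proof -
    have "0 \<le> Q s" unfolding Q_def
    proof (rule prod_nonneg)
      fix x assume x: "x \<in> V0"
      then have "s x = -1 \<or> s x = 1" using spins_mem[OF s] V0 by blast
      then show "0 \<le> 1 + B x * real_of_int (s x)" using B[OF x] by auto
    qed
    moreover have "s (fst h) = -1 \<or> s (fst h) = 1" "s (nb h) = -1 \<or> s (nb h) = 1"
      using spins_mem[OF s fst_V[OF h]] spins_mem[OF s nb_V[OF h]] by auto
    ultimately show "of_int (s (fst h) * s (nb h)) * Q s \<le> Q s" "- Q s \<le> of_int (s (fst h) * s (nb h)) * Q s" by auto
  qed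
  have "cor B h \<le> moment V \<psi> Q" unfolding cor_def Q_def[symmetric]
    using le by (intro moment_mono) (auto simp: Q_def)
  moreover have "moment V \<psi> (\<lambda>s. - 1 * Q s) \<le> cor B h" unfolding cor_def
    using le by (intro moment_mono) (auto simp: Q_def)
  moreover have "moment V \<psi> Q = 1" unfolding Q_def by (rule moment_agree)
  ultimately show ?thesis unfolding moment_cmult by simp
qed

lemma form_abs:
  assumes h: "h \<in> U"
  shows "\<bar>form h\<bar> \<le> 12"
proof -
  have H: "h \<in> H" "\<mu> h \<in> H" using h \<mu>_U by (auto simp: U_def)
  have pp: "\<bar>p u\<bar> \<le> 1" for u by (simp add: p_abs)
  have t2: "\<bar>\<theta>\<^sup>2\<bar> \<le> 1" by (simp add: \<theta>_sq)
  have t2': "\<bar>\<theta>\<^sup>2 / 2\<bar> \<le> 1" "\<bar>3 / 2 * \<theta>\<^sup>2\<bar> \<le> 1" by (simp_all add: \<theta>_sq)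
  have ct: "\<bar>c * \<theta> / 2\<bar> \<le> 1" using abs_mult_le[OF c_abs \<theta>_abs] by simp
  have ct2: "\<bar>c * \<theta>\<^sup>2\<bar> \<le> 1" using abs_mult_le[OF c_abs t2] by simp
  have "\<bar>\<theta>\<^sup>2 / 2 * p (fst h) * p (nb h)\<bar> \<le> 1 * 1 * 1"
    by (intro abs_mult_le t2' pp)
  moreover have "\<bar>c * \<theta> / 2 * (xp h + xp (\<mu> h))\<bar> \<le> 1 * 2"
    using xp_abs[of h] xp_abs[of "\<mu> h"] by (intro abs_mult_le ct) linarith
  moreover have "\<bar>c * \<theta>\<^sup>2 * (p (nb h) * xs h + p (fst h) * xs (\<mu> h))\<bar> \<le> 1 * 4"
  proof (intro abs_mult_le ct2)
    have "\<bar>p (nb h) * xs h\<bar> \<le> 1 * 2" "\<bar>p (fst h) * xs (\<mu> h)\<bar> \<le> 1 * 2"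
      by (intro abs_mult_le pp xs_abs H)+
    then show "\<bar>p (nb h) * xs h + p (fst h) * xs (\<mu> h)\<bar> \<le> 4" by linarith
  qed
  moreover have "\<bar>3 / 2 * \<theta>\<^sup>2 * xs h * xs (\<mu> h)\<bar> \<le> 1 * 2 * 2"
    by (intro abs_mult_le t2' xs_abs H)
  ultimately show ?thesis unfolding form_def by linarith
qed

lemma formS_abs:
  assumes h: "h \<in> HS"
  shows "\<bar>formS h\<bar> \<le> 3"
proof -
  have H: "h \<in> H" using h by (auto simp: HS_def)
  have pp: "\<bar>p u\<bar> \<le> 1" for u by (simp add: p_abs)
  have ct: "\<bar>c * \<theta> / 2\<bar> \<le> 1" using abs_mult_le[OF c_abs \<theta>_abs] by simp
  have "\<bar>\<theta> * p (fst h) * xs h\<bar> \<le> 1 * 1 * 2" by (intro abs_mult_le \<theta>_abs pp xs_abs H)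
  moreover have "\<bar>c * \<theta> / 2 * xp h\<bar> \<le> 1 * 1" by (intro abs_mult_le ct xp_abs)
  ultimately show ?thesis unfolding formS_def by linarith
qed

definition "gap h = cor S h - cor (\<lambda>_. 0) h"

lemma gap_abs: "h \<in> H \<Longrightarrow> \<bar>gap h\<bar> \<le> 2"
  using cor_abs[of h S] cor_abs[of h "\<lambda>_. 0"] S_abs unfolding gap_def by fastforce

lemma sum_gap_U: "\<bar>(\<Sum>h\<in>U. gap h) - (\<Sum>h\<in>U. form h)\<bar> \<le> 14 * card Bad"
proof -
  have "(\<Sum>h\<in>U. gap h) - (\<Sum>h\<in>U. form h) = (\<Sum>h\<in>U. gap h - form h)" by (simp add: sum_subtractf)
  also have "\<dots> = (\<Sum>h\<in>Bad. gap h - form h)"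
    by (rule sum.mono_neutral_right) (auto simp: Bad_def gap_def cor_good)
  also have "\<bar>\<dots>\<bar> \<le> (\<Sum>h\<in>Bad. \<bar>gap h - form h\<bar>)" by (rule sum_abs)
  \<comment> \<open>14 adds the bound 12 for \<open>form\<close> and the bound 2 for
    \<open>gap\<close>.\<close>
  also have "\<dots> \<le> (\<Sum>h\<in>Bad. 14)"
  proof (rule sum_mono)
    fix h assume "h \<in> Bad"
    then have "h \<in> U" "h \<in> H" by (auto simp: Bad_def U_def)
    then show "\<bar>gap h - form h\<bar> \<le> 14" using form_abs[of h] gap_abs[of h] by linarith
  qed
  finally show ?thesis by simp
qed

text \<open>The exceptional star edges lie in \<open>Y\<close>, where all of \<open>oth h\<close> is
  bad. Choosing one element of \<open>oth h\<close> injects \<open>Y\<close> into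
  \<open>Bad\<close>, because the chosen half-edge starts at the leaf, which determines
  \<open>h\<close>.\<close>

lemma sum_gap_HS: "\<bar>(\<Sum>h\<in>HS. gap h) - (\<Sum>h\<in>HS. formS h)\<bar> \<le> 5 * card Bad"
proof -
  define Y where "Y = {h\<in>HS. oth h \<subseteq> Bad}"
  have good: "gap h = formS h" if "h \<in> HS - Y" for h
  proof -
    have "\<not> oth h \<subseteq> Bad" using that by (simp add: Y_def)
    then obtain g where "g \<in> oth h" "g \<notin> Bad" by blast
    then have "good g" using oth_HS[of h] that by (auto simp: Bad_def)
    then show ?thesis using cor_star[of h g] that \<open>g \<in> oth h\<close> by (simp add: gap_def)
  qed
  have "card Y \<le> card Bad"
  proof (rule card_inj_on_le[where f = "\<lambda>h. SOME g. g \<in> oth h"])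
    have some: "(SOME g. g \<in> oth h) \<in> oth h" if "h \<in> Y" for h
    proof -
      have "card (oth h) = 2" using that card_oth[of h] by (auto simp: Y_def HS_def)
      then have "oth h \<noteq> {}" by auto
      then show ?thesis by (simp add: some_in_eq)
    qed
    show "inj_on (\<lambda>h. SOME g. g \<in> oth h) Y"
    proof (rule inj_onI)
      fix h h' assume hh: "h \<in> Y" "h' \<in> Y" "(SOME g. g \<in> oth h) = (SOME g. g \<in> oth h')"
      then have "(SOME g. g \<in> oth h) \<in> oth h" "(SOME g. g \<in> oth h) \<in> oth h'" using some[OF hh(1)] some[OF hh(2)] by auto
      then have "fst h = fst h'" by (simp add: oth_def)
      then show "h = h'" using bij_fst_HS hh by (auto simp: bij_betw_def Y_def inj_on_def)
    qed
    show "(\<lambda>h. SOME g. g \<in> oth h) ` Y \<subseteq> Bad"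
    proof (rule image_subsetI)
      fix h assume "h \<in> Y"
      then show "(SOME g. g \<in> oth h) \<in> Bad" using some[of h] unfolding Y_def by blast
    qed
  qed simp
  have "(\<Sum>h\<in>HS. gap h) - (\<Sum>h\<in>HS. formS h) = (\<Sum>h\<in>HS. gap h - formS h)" by (simp add: sum_subtractf)
  also have "\<dots> = (\<Sum>h\<in>Y. gap h - formS h)"
    using good by (intro sum.mono_neutral_right) (auto simp: Y_def)
  also have "\<bar>\<dots>\<bar> \<le> (\<Sum>h\<in>Y. \<bar>gap h - formS h\<bar>)" by (rule sum_abs)
  also have "\<dots> \<le> (\<Sum>h\<in>Y. 5)"
  proof (rule sum_mono)
    fix h assume "h \<in> Y"
    then have "h \<in> HS" "h \<in> H" by (auto simp: Y_def HS_def)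
    then show "\<bar>gap h - formS h\<bar> \<le> 5" using formS_abs[of h] gap_abs[of h] by linarith
  qed
  finally show ?thesis using \<open>card Y \<le> card Bad\<close> by simp
qed

lemma Q_abs: "\<bar>Q3\<bar> \<le> paths3" "\<bar>Q4\<bar> \<le> paths4" "\<bar>Q5\<bar> \<le> paths5"
proof -
  have pi: "\<bar>p u\<bar> = ind u" for u by (simp add: p_abs ind_def)
  have ind0: "ind u \<ge> 0" for u by (simp add: ind_def)
  have "\<bar>Q3\<bar> \<le> (\<Sum>g\<in>U. \<bar>p (fst g) * p (nb g)\<bar>)" unfolding Q3_def by (rule sum_abs)
  then show "\<bar>Q3\<bar> \<le> paths3" by (simp add: paths3_def abs_mult pi)
  have "\<bar>Q4\<bar> \<le> (\<Sum>g\<in>U. \<bar>p (nb g) * X g\<bar>)" unfolding Q4_def by (rule sum_abs)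
  also have "\<dots> \<le> paths4" unfolding paths4_def abs_mult pi sum_distrib_left[symmetric]
    by (intro sum_mono mult_left_mono X_abs ind0)
  finally show "\<bar>Q4\<bar> \<le> paths4" .
  have "\<bar>Q5\<bar> \<le> (\<Sum>g\<in>U. \<bar>X g * X (\<mu> g)\<bar>)" unfolding Q5_def by (rule sum_abs)
  also have "\<dots> \<le> (\<Sum>g\<in>U. (\<Sum>h\<in>oth g \<inter> U. ind (nb h)) * (\<Sum>h'\<in>oth (\<mu> g) \<inter> U. ind (nb h')))"
    unfolding abs_mult by (intro sum_mono mult_mono X_abs) (auto intro: sum_nonneg ind0)
  also have "\<dots> = paths5" unfolding paths5_def sum_product ..
  finally show "\<bar>Q5\<bar> \<le> paths5" .
qed

text \<open>The 24 is 14 for the free edges plus twice 5 for the star edges, which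
  \<open>sum_H\<close> counts with weight two.\<close>

lemma outcome_bound:
  "projected_energy V E V0 \<sigma> \<psi> - energy V E \<psi> \<le>
     (15 / 4 * \<theta>\<^sup>2 * paths3 + 9 / 2 * c * \<bar>\<theta>\<bar> ^ 3 * paths4 + 3 / 2 * \<theta> ^ 4 * paths5 + 24 * card Bad) / 4"
proof -
  have arith: "- (g + 2 * g') \<le> w1 + w2 + w3 + 24 * b"
    if "- (g - f) \<le> 14 * b" "- (g' - f') \<le> 5 * b" "f + 2 * f' = u1 + u2 + u3" "- u1 \<le> w1" "- u2 \<le> w2" "- u3 \<le> w3"
    for g g' f f' u1 u2 u3 w1 w2 w3 b :: real
    using that by linarith
  have "projected_energy V E V0 \<sigma> \<psi> - energy V E \<psi> = - (\<Sum>h\<in>H. gap h) / 4"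
    unfolding energy_gap[OF \<sigma>] gap_def S_def[abs_def] by (simp add: sum_subtractf)
  also have "(\<Sum>h\<in>H. gap h) = (\<Sum>h\<in>U. gap h) + 2 * (\<Sum>h\<in>HS. gap h)"
    by (rule sum_H) (simp add: gap_def cor_\<mu>)
  finally have eq: "projected_energy V E V0 \<sigma> \<psi> - energy V E \<psi> = - ((\<Sum>h\<in>U. gap h) + 2 * (\<Sum>h\<in>HS. gap h)) / 4" .
  have neg_le: "- (a * q) \<le> a * w" if "0 \<le> a" "\<bar>q\<bar> \<le> w" for a q w :: real
    using mult_left_mono[OF abs_le_D2[OF that(2)] that(1)] by simp
  have b1: "- (15 / 4 * \<theta>\<^sup>2 * Q3) \<le> 15 / 4 * \<theta>\<^sup>2 * paths3"
    by (rule neg_le[OF _ Q_abs(1)]) simp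
  have b3: "- (3 / 2 * \<theta> ^ 4 * Q5) \<le> 3 / 2 * \<theta> ^ 4 * paths5"
    by (rule neg_le[OF _ Q_abs(3)]) simp
  have b2: "- (9 / 2 * c * \<theta> ^ 3 * Q4) \<le> 9 / 2 * c * \<bar>\<theta>\<bar> ^ 3 * paths4"
  proof -
    have "- (9 / 2 * c * \<theta> ^ 3 * Q4) \<le> \<bar>9 / 2 * c * \<theta> ^ 3\<bar> * \<bar>Q4\<bar>"
      unfolding abs_mult[symmetric] by (rule order_trans[OF abs_ge_minus_self]) simp
    also have "\<dots> \<le> \<bar>9 / 2 * c * \<theta> ^ 3\<bar> * paths4" by (intro mult_left_mono Q_abs) auto
    finally show ?thesis by (simp add: abs_mult power_abs)
  qed
  show ?thesis
    unfolding eq of_nat_mult of_nat_numeral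
    by (rule divide_right_mono[OF arith[OF abs_le_D2[OF sum_gap_U, unfolded of_nat_mult of_nat_numeral]
      abs_le_D2[OF sum_gap_HS, unfolded of_nat_mult of_nat_numeral] sum_forms b1 b2 b3]]) simp
qed

end

section \<open>Averaging over matchings with prescribed stars\<close>

text \<open>Distinctness makes the list a partial matching, whose completions can be counted.
  Coinciding half-edges count as a miss; the walks lost in this way are charged separately in
  \<open>S4_le\<close> and \<open>S5_le\<close>.\<close>

definition hit :: "'a set set \<Rightarrow> ('a \<times> 'a) list \<Rightarrow> real" where
  "hit M xs = of_bool (distinct (map fst xs @ map snd xs) \<and> (\<forall>(a, b)\<in>set xs. {a, b} \<in> M))"

lemma hit_nonneg [simp]: "hit M xs \<ge> 0"
  by (simp add: hit_def)

lemma pairs_perfect_matching: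
  "distinct (map fst xs @ map snd xs) \<Longrightarrow>
     (\<lambda>(a, b). {a, b}) ` set xs \<in> perfect_matchings (set (map fst xs @ map snd xs))"
proof (induction xs)
  case (Cons x xs)
  obtain a b where x: "x = (a, b)" by (cases x)
  have "{{a, b}} \<in> perfect_matchings {a, b}" using Cons.prems x by (auto intro!: singleton_perfect_matching)
  moreover have "(\<lambda>(a, b). {a, b}) ` set xs \<in> perfect_matchings (set (map fst xs @ map snd xs))"
    using Cons by auto
  moreover have "{a, b} \<inter> set (map fst xs @ map snd xs) = {}"
    using Cons.prems x by auto
  ultimately have "{{a, b}} \<union> (\<lambda>(a, b). {a, b}) ` set xs \<in> perfect_matchings ({a, b} \<union> set (map fst xs @ map snd xs))"
    by (rule perfect_matching_Un)
  moreover have "{a, b} \<union> set (map fst xs @ map snd xs) = set (map fst (x # xs) @ map snd (x # xs))"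
    using x by auto
  ultimately show ?case using x by simp
qed simp

text \<open>The quotient of the double factorials is the product of the largest \<open>j\<close>
  factors among \<open>2 * m - 1\<close>, \<open>2 * m - 3\<close>, \<open>2 * m - 5\<close>, each
  at least \<open>2 * m - 5\<close>. Three factors suffice because a path of five edges has three
  free edges.\<close>

lemma odd_fact_ratio:
  assumes "j \<le> 3" "m \<ge> 3"
  shows "real (odd_fact (m - j)) * (2 * real m - 5) ^ j \<le> real (odd_fact m)"
proof -
  obtain r where m: "m = r + 3" using assms(2) by (metis add.commute le_Suc_ex)
  define x where "x = real r"
  have x: "x \<ge> 0" by (simp add: x_def)
  have s: "r + 3 = Suc (r + 2)" "r + 2 = Suc (r + 1)" "r + 1 = Suc r" by simp_all
  have "odd_fact (r + 3) = (2 * (r + 2) + 1) * odd_fact (r + 2)" by (simp only: s(1) odd_fact_Suc)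
  then have o3: "real (odd_fact (r + 3)) = (2 * x + 5) * real (odd_fact (r + 2))" by (simp add: x_def algebra_simps del: odd_fact_Suc)
  have "odd_fact (r + 2) = (2 * (r + 1) + 1) * odd_fact (r + 1)" by (simp only: s(2) odd_fact_Suc)
  then have o2: "real (odd_fact (r + 2)) = (2 * x + 3) * real (odd_fact (r + 1))" by (simp add: x_def algebra_simps del: odd_fact_Suc)
  have "odd_fact (r + 1) = (2 * r + 1) * odd_fact r" by (simp only: s(3) odd_fact_Suc)
  then have o1: "real (odd_fact (r + 1)) = (2 * x + 1) * real (odd_fact r)" by (simp add: x_def algebra_simps del: odd_fact_Suc)
  have base: "2 * real m - 5 = 2 * x + 1" by (simp add: m x_def)
  consider "j = 0" | "j = 1" | "j = 2" | "j = 3" using assms(1) by linarith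
  then show ?thesis
  proof cases
    case 1
    then show ?thesis by simp
  next
    case 2
    then have j: "m - j = r + 2" using m by simp
    have "real (odd_fact (r + 2)) * (2 * x + 1) \<le> real (odd_fact (r + 2)) * (2 * x + 5)"
      by (intro mult_left_mono) auto
    then show ?thesis unfolding base j unfolding m o3 using 2 by (simp only: power_one_right mult.commute)
  next
    case 3
    then have j: "m - j = r + 1" using m by simp
    have "real (odd_fact (r + 1)) * (2 * x + 1)\<^sup>2 \<le> real (odd_fact (r + 1)) * ((2 * x + 5) * (2 * x + 3))"
      using x by (intro mult_left_mono) (auto simp: power2_eq_square algebra_simps)
    then show ?thesis unfolding base j unfolding m o3 o2 using 3 by (simp only: mult_ac)
  next
    case 4
    then have j: "m - j = r" using m by simp
    have "(2 * x + 1) ^ 3 = (2 * x + 1) * (2 * x + 1) * (2 * x + 1)" by (simp add: power3_eq_cube)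
    also have "\<dots> \<le> (2 * x + 5) * (2 * x + 3) * (2 * x + 1)"
      using x by (intro mult_mono) auto
    finally have "real (odd_fact r) * (2 * x + 1) ^ 3 \<le> real (odd_fact r) * ((2 * x + 5) * (2 * x + 3) * (2 * x + 1))"
      by (intro mult_left_mono) auto
    then show ?thesis unfolding base j unfolding m o3 o2 o1 using 4 by (simp only: mult_ac)
  qed
qed

section \<open>Matchings that share their stars\<close>

context matched_stars begin

definition "Stars = (\<lambda>h. {h, \<mu> h}) ` {h\<in>H. fst h \<in> V0}"
text \<open>The class over which the average is taken: all members have the same leaves and the same
  \<open>par\<close>, and a uniform member matches the remaining half-edges uniformly.\<close>

definition "Fam = {M' \<in> perfect_matchings H. Stars \<subseteq> M'}"

lemma finite_Fam [simp]: "finite Fam"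
  by (simp add: Fam_def)

lemma Stars_eq: "Stars = {p\<in>M. p \<inter> half_edges V0 3 \<noteq> {}}"
proof
  show "Stars \<subseteq> {p\<in>M. p \<inter> half_edges V0 3 \<noteq> {}}"
    using partner_in[OF M] by (auto simp: Stars_def H_def half_edges_def)
  show "{p\<in>M. p \<inter> half_edges V0 3 \<noteq> {}} \<subseteq> Stars"
  proof
    fix p assume p: "p \<in> {p\<in>M. p \<inter> half_edges V0 3 \<noteq> {}}"
    then obtain h where h: "h \<in> p" "h \<in> half_edges V0 3" by auto
    then have hH: "h \<in> {h\<in>H. fst h \<in> V0}" using V0 by (auto simp: H_def half_edges_def)
    then have "p = {h, \<mu> h}" using perfect_matchings_unique[OF M, of p "{h, \<mu> h}" h] p h partner_in[OF M, of h] by auto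
    then show "p \<in> Stars" using hH unfolding Stars_def by blast
  qed
qed

lemma M_Fam: "M \<in> Fam"
  using M Stars_eq by (auto simp: Fam_def)

lemma Stars_matching: "Stars \<in> perfect_matchings (H - {h\<in>H. fst h \<notin> V0 \<and> nb h \<notin> V0})"
proof (rule perfect_matchingsI)
  show "\<Union>Stars = H - {h\<in>H. fst h \<notin> V0 \<and> nb h \<notin> V0}"
  proof
    show "\<Union>Stars \<subseteq> H - {h\<in>H. fst h \<notin> V0 \<and> nb h \<notin> V0}" by (auto simp: Stars_def nb_def)
    show "H - {h\<in>H. fst h \<notin> V0 \<and> nb h \<notin> V0} \<subseteq> \<Union>Stars"
    proof
      fix h assume h: "h \<in> H - {h\<in>H. fst h \<notin> V0 \<and> nb h \<notin> V0}"
      show "h \<in> \<Union>Stars"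
      proof (cases "fst h \<in> V0")
        case False
        then have "\<mu> h \<in> {h\<in>H. fst h \<in> V0}" "h = \<mu> (\<mu> h)" using h by (auto simp: nb_def)
        then show ?thesis unfolding Stars_def by blast
      next
        case True
        then show ?thesis using h by (intro UnionI[of "{h, \<mu> h}"]) (auto simp: Stars_def)
      qed
    qed
  qed
  have sub: "Stars \<subseteq> M" by (auto simp: Stars_eq)
  show "disjoint Stars" using perfect_matchingsD(2)[OF M] sub by (auto simp: disjoint_def)
  show "card q = 2" if "q \<in> Stars" for q using that sub perfect_matchingsD(3)[OF M] by auto
qed

lemma partner_Fam:
  assumes "M' \<in> Fam" "h \<in> H" "fst h \<in> V0"
  shows "partner M' h = \<mu> h"
  using assms partner_eq_iff[of M' H h "\<mu> h"] by (auto simp: Fam_def Stars_def)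

lemma matched_stars_Fam: "M' \<in> Fam \<Longrightarrow> matched_stars n V0 M'"
proof
  assume M': "M' \<in> Fam"
  then show "M' \<in> perfect_matchings (half_edges {1..n} 3)" by (simp add: Fam_def H_def V_def)
  show "V0 \<subseteq> {1..n}" by (rule V0')
  have "h \<in> H \<and> fst h \<in> V0" if "h \<in> half_edges V0 3" for h
    using that V0 by (auto simp: half_edges_def H_def)
  then show "two_independent 3 M' V0"
    using ind partner_Fam[OF M'] unfolding two_independent_def inj_on_def by auto
qed

lemma Fam_eq:
  assumes "M' \<in> Fam"
  shows "matched_stars.N n V0 M' = N" "u \<in> N \<Longrightarrow> matched_stars.par n V0 M' u = par u"
    "matched_stars.Fam n V0 M' = Fam" "h \<in> H \<Longrightarrow> matched_stars.nb M' h \<in> V0 \<longleftrightarrow> nb h \<in> V0"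
proof -
  interpret M': matched_stars n V0 M' by (rule matched_stars_Fam[OF assms])
  have nb': "M'.nb h = nb h" if "h \<in> H" "fst h \<in> V0" for h
    using partner_Fam[OF assms that] by (simp add: M'.nb_def nb_def)
  show N: "M'.N = N" unfolding M'.N_def N_def using nb' by (intro image_cong) auto
  show "M'.par u = par u"
  proof -
    have "(\<lambda>h. h \<in> H \<and> fst h \<in> V0 \<and> M'.nb h = u) = (\<lambda>h. h \<in> H \<and> fst h \<in> V0 \<and> nb h = u)"
      using nb' by (auto simp: fun_eq_iff)
    then show ?thesis by (simp add: M'.par_def par_def)
  qed
  have "M'.Stars = Stars" unfolding M'.Stars_def Stars_def
    using partner_Fam[OF assms] by (intro image_cong) auto
  then show "M'.Fam = Fam" by (simp add: M'.Fam_def Fam_def)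
  show "M'.nb h \<in> V0 \<longleftrightarrow> nb h \<in> V0" if h: "h \<in> H"
  proof
    assume a: "nb h \<in> V0"
    then have "\<mu> h \<in> H" "fst (\<mu> h) \<in> V0" using h by (auto simp: nb_def)
    then have "partner M' (\<mu> h) = h" using partner_Fam[OF assms] h by simp
    then have "partner M' h = \<mu> h" using M'.\<mu>_\<mu>[of "\<mu> h"] h by auto
    then show "M'.nb h \<in> V0" using a by (simp add: M'.nb_def nb_def)
  next
    assume a: "M'.nb h \<in> V0"
    then have m: "partner M' h \<in> H" "fst (partner M' h) \<in> V0" using h M'.\<mu>_H[of h] by (auto simp: M'.nb_def)
    then have "\<mu> (partner M' h) = h" using partner_Fam[OF assms m] M'.\<mu>_\<mu>[of h] h by auto
    then have "\<mu> h = partner M' h" using \<mu>_\<mu>[OF m(1)] by simp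
    then show "nb h \<in> V0" using a by (simp add: M'.nb_def nb_def)
  qed
qed

end

section \<open>Numbers of free half-edges and probabilities of prescribed pairs\<close>

context qaoa_stars begin

lemma card_U: "card U + 6 * card V0 = 3 * n"
proof -
  have "card H = 3 * n" by (simp add: H_def half_edges_def card_cartesian_product)
  moreover have "card {h\<in>H. fst h \<in> V0} = 3 * card V0"
  proof -
    have "{h\<in>H. fst h \<in> V0} = V0 \<times> {1..3}" using V0 by (auto simp: H_def half_edges_def)
    then show ?thesis by (simp add: card_cartesian_product)
  qed
  moreover have "card HS = card {h\<in>H. fst h \<in> V0}"
    by (rule bij_betw_same_card[of \<mu>], rule bij_betwI[where g = \<mu>]) (auto simp: HS_def nb_def)
  moreover have "card H = card (U \<union> HS) + card {h\<in>H. fst h \<in> V0}"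
  proof -
    have "H = {h\<in>H. fst h \<notin> V0} \<union> {h\<in>H. fst h \<in> V0}" by auto
    then have "card H = card {h\<in>H. fst h \<notin> V0} + card {h\<in>H. fst h \<in> V0}"
      by (metis (no_types, lifting) Collect_disj_eq card_Un_disjoint disjoint_iff finite_H finite_Un mem_Collect_eq)
    then show ?thesis by (simp only: U_HS(1))
  qed
  moreover have "card (U \<union> HS) = card U + card HS" by (rule card_Un_disjoint) (auto simp: U_HS(2))
  ultimately show ?thesis by simp
qed

lemma card_HS: "card HS = 3 * card V0"
proof -
  have "{h\<in>H. fst h \<in> V0} = V0 \<times> {1..3}" using V0 by (auto simp: H_def half_edges_def)
  moreover have "card HS = card {h\<in>H. fst h \<in> V0}"
    by (rule bij_betw_same_card[of \<mu>], rule bij_betwI[where g = \<mu>]) (auto simp: HS_def nb_def)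
  ultimately show ?thesis by (simp add: card_cartesian_product)
qed

definition "UP = {h\<in>U. fst h \<in> N}"

lemma finite_UP [simp]: "finite UP"
  by (simp add: UP_def)

lemma card_UP: "card UP = 6 * card V0"
proof -
  have "real (card UP) = (\<Sum>g\<in>U. of_bool (fst g \<in> N))" by (simp add: UP_def of_bool_def sum.If_cases Int_def)
  also have "\<dots> = (\<Sum>h\<in>HS. \<Sum>g\<in>oth h \<inter> U. of_bool (fst g \<in> N))"
    by (rule sum_HS_oth[symmetric]) simp
  also have "\<dots> = (\<Sum>h\<in>HS. 2)"
  proof (rule sum.cong[OF refl])
    fix h assume h: "h \<in> HS"
    have "(\<Sum>g\<in>oth h \<inter> U. of_bool (fst g \<in> N)) = (\<Sum>g\<in>oth h. 1 :: real)"
      using h oth_HS[OF h] V0_half_edge_at(1)[of h] by (intro sum.cong) (auto simp: oth_def HS_def)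
    then show "(\<Sum>g\<in>oth h \<inter> U. of_bool (fst g \<in> N)) = (2 :: real)" using card_oth[of h] h by (simp add: HS_def)
  qed
  finally show ?thesis by (simp add: card_HS)
qed

text \<open>Ordered pairs of free half-edges at one vertex: each of the \<open>3 * card V0\<close>
  leaves has two, with one companion each, and each of the other \<open>n - 4 * card V0\<close>
  vertices outside \<open>V0\<close> has three, with two companions each.\<close>

lemma sum_card_oth_U: "(\<Sum>g\<in>U. real (card (oth g \<inter> U))) \<le> 6 * real n - 18 * real (card V0)"
proof -
  have "real (card (oth g \<inter> U)) \<le> 2 - of_bool (fst g \<in> N)" if g: "g \<in> U" for g
  proof (cases "fst g \<in> N")
    case True
    then obtain h where h: "h \<in> H" "fst h = fst g" "nb h \<in> V0" using N_half_edge by metis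
    have "h \<in> oth g - U" using h g by (auto simp: oth_def U_def)
    then have "oth g \<inter> U \<subset> oth g" by auto
    then have "card (oth g \<inter> U) < card (oth g)" by (intro psubset_card_mono) auto
    then show ?thesis using True card_oth[of g] g by (simp add: U_def)
  next
    case False
    have "card (oth g \<inter> U) \<le> card (oth g)" by (intro card_mono) auto
    then show ?thesis using False card_oth[of g] g by (simp add: U_def)
  qed
  then have "(\<Sum>g\<in>U. real (card (oth g \<inter> U))) \<le> (\<Sum>g\<in>U. 2 - of_bool (fst g \<in> N))"
    by (intro sum_mono) auto
  also have "\<dots> = 2 * real (card U) - real (card UP)"
    by (simp add: sum_subtractf UP_def of_bool_def sum.If_cases Int_def)
  also have "\<dots> = 6 * real n - 18 * real (card V0)"
    using card_U card_UP by (simp add: of_nat_add[symmetric] of_nat_mult[symmetric] algebra_simps flip: of_nat_add)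
  finally show ?thesis .
qed

lemma H_minus_U: "H - (H - U) = U"
  by (auto simp: U_def)

lemma even_card_U: "even (card U)"
proof -
  have "M - Stars \<in> perfect_matchings (H - (H - U))"
    using Stars_matching M_Fam by (intro perfect_matching_Diff[OF M]) (auto simp: U_def Fam_def)
  then have W: "M - Stars \<in> perfect_matchings U" by (simp only: H_minus_U)
  have "card U = (\<Sum>q\<in>M - Stars. card q)"
    using perfect_matchingsD(1,2)[OF W] card_Union_disjoint[of "M - Stars"] finite_subset[OF perfect_matchingsD(4)[OF W] finite_U]
    by (metis disjnt_def disjoint_def pairwise_def)
  also have "\<dots> = 2 * card (M - Stars)" using perfect_matchingsD(3)[OF W] by simp
  finally show ?thesis by simp
qed

text \<open>With \<open>card U = 2 * m\<close>, prescribing \<open>j\<close> disjoint pairs besides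
  the stars leaves \<open>odd_fact (m - j)\<close> of the \<open>odd_fact m\<close> members of the
  family.\<close>

lemma sum_Fam_hit:
  assumes xs: "length xs \<le> 3" "set xs \<subseteq> U \<times> U" and U: "card U \<ge> 6"
  shows "(\<Sum>M'\<in>Fam. hit M' xs) \<le> (1 / (real (card U) - 5)) ^ length xs * real (card Fam)"
proof (cases "distinct (map fst xs @ map snd xs)")
  case False
  then have "hit M' xs = 0" for M' by (simp only: hit_def simp_thms of_bool_eq)
  then show ?thesis using U by simp
next
  case True
  obtain m where m: "card U = 2 * m" using even_card_U by (elim evenE)
  define Q where "Q = (\<lambda>(a, b). {a, b}) ` set xs"
  define C where "C = set (map fst xs @ map snd xs)"
  define j where "j = length xs"
  have Q: "Q \<in> perfect_matchings C" unfolding Q_def C_def by (rule pairs_perfect_matching[OF True])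
  have C: "C \<subseteq> U" using xs(2) by (auto simp: C_def)
  have cC: "card C = 2 * j" unfolding C_def using distinct_card[OF True] by (simp add: j_def)
  have S: "Stars \<in> perfect_matchings (H - U)" using Stars_matching by (simp add: U_def)
  have cH: "card H = 2 * (m + 3 * card V0)" "card (H - U) = 2 * (3 * card V0)"
  proof -
    have "card H = 3 * n" by (simp add: H_def half_edges_def card_cartesian_product)
    moreover have "card (H - U) = card H - card U" by (rule card_Diff_subset) (auto simp: U_def)
    ultimately show "card H = 2 * (m + 3 * card V0)" "card (H - U) = 2 * (3 * card V0)"
      using card_U m by auto
  qed
  have fam: "card Fam = odd_fact m"
    using card_perfect_matchings_superset[OF finite_H cH(1) S _ cH(2)] by (simp add: Fam_def Diff_subset)
  have "Stars \<union> Q \<in> perfect_matchings ((H - U) \<union> C)" using C by (intro perfect_matching_Un[OF S Q]) auto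
  moreover have "(H - U) \<union> C \<subseteq> H" using C by (auto simp: U_def)
  moreover have "card ((H - U) \<union> C) = 2 * (3 * card V0 + j)"
    using C cH cC finite_subset[OF C] by (subst card_Un_disjoint) auto
  ultimately have "card {M' \<in> perfect_matchings H. Stars \<union> Q \<subseteq> M'} = odd_fact (m + 3 * card V0 - (3 * card V0 + j))"
    using finite_H cH(1) by (intro card_perfect_matchings_superset)
  then have num: "card {M'\<in>Fam. Q \<subseteq> M'} = odd_fact (m - j)"
    by (simp add: Fam_def conj_assoc Un_subset_iff)
  have "(\<Sum>M'\<in>Fam. hit M' xs) = (\<Sum>M'\<in>Fam. of_bool (Q \<subseteq> M'))"
    using True by (intro sum.cong refl) (auto simp: hit_def Q_def)
  also have "\<dots> = real (odd_fact (m - j))"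
    unfolding num[symmetric] by (simp add: of_bool_def sum.If_cases Int_def)
  also have "\<dots> \<le> real (odd_fact m) / (2 * real m - 5) ^ j"
    using odd_fact_ratio[of j m] xs U m by (simp add: field_simps j_def)
  finally show ?thesis using m by (simp add: fam j_def power_divide)
qed

text \<open>The path counts above, with the condition that both ends lie in \<open>N\<close> replaced by an
  arbitrary relation between the ends: \<open>same_star\<close> below accounts for the short cycles that make
  an edge bad.\<close>

definition "S3 R = (\<Sum>g\<in>U. of_bool (R (fst g) (nb g)) :: real)"
definition "S4 R = (\<Sum>g\<in>U. \<Sum>h\<in>oth g \<inter> U. of_bool (R (nb g) (nb h)) :: real)"
definition "S5 R = (\<Sum>g\<in>U. \<Sum>h\<in>oth g \<inter> U. \<Sum>h'\<in>oth (\<mu> g) \<inter> U. of_bool (R (nb h) (nb h')) :: real)"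
definition "targets R = {(a, b). a \<in> U \<and> b \<in> U \<and> R (fst a) (fst b)}"

text \<open>Equality of vertices after the leaves of each star are identified. A walk whose ends are
  related closes a short cycle.\<close>

definition "same_star u u' \<longleftrightarrow> u = u' \<or> (u \<in> N \<and> u' \<in> N \<and> par u = par u')"

section \<open>Path counts as sums of indicators of prescribed pairs\<close>

lemma finite_targets [simp]: "finite (targets R)"
  by (rule finite_subset[of _ "U \<times> U"]) (auto simp: targets_def)

lemma U_H: "h \<in> U \<Longrightarrow> h \<in> H"
  by (simp add: U_def)

lemma mem_targets: "(a, b) \<in> targets R \<longleftrightarrow> a \<in> U \<and> b \<in> U \<and> R (fst a) (fst b)"
  by (simp add: targets_def)

lemma partner_U:
  assumes "h \<in> U"
  shows "\<mu> (\<mu> h) = h" "\<mu> h \<noteq> h" "{h, \<mu> h} \<in> M"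
  using U_H[OF assms] partner_neq[OF M, of h] partner_in[OF M, of h] by auto

lemma hit_1: "g \<in> U \<Longrightarrow> hit M [(g, \<mu> g)] = 1"
  using partner_U[of g] by (auto simp: hit_def)

lemma hit_2:
  assumes "g \<in> U" "h \<in> U" "g \<noteq> h" "h \<noteq> \<mu> g"
  shows "hit M [(g, \<mu> g), (h, \<mu> h)] = 1"
  using assms partner_U[of g] partner_U[of h] by (auto simp: hit_def)

lemma hit_3:
  assumes "g \<in> U" "h \<in> U" "h' \<in> U" "g \<noteq> h" "h \<noteq> \<mu> g" "g \<noteq> h'" "h' \<noteq> \<mu> g" "h \<noteq> h'" "h' \<noteq> \<mu> h"
  shows "hit M [(g, \<mu> g), (h, \<mu> h), (h', \<mu> h')] = 1"
  using assms partner_U[of g] partner_U[of h] partner_U[of h'] by (auto simp: hit_def)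

lemma S3_le: "S3 R \<le> (\<Sum>(a, b)\<in>targets R. hit M [(a, b)])"
proof -
  have "S3 R = (\<Sum>g\<in>{g\<in>U. R (fst g) (nb g)}. hit M [(g, \<mu> g)])"
    by (simp add: S3_def of_bool_def sum.If_cases Int_def hit_1)
  also have "\<dots> = (\<Sum>(a, b)\<in>(\<lambda>g. (g, \<mu> g)) ` {g\<in>U. R (fst g) (nb g)}. hit M [(a, b)])"
    by (subst sum.reindex) (auto simp: inj_on_def)
  also have "\<dots> \<le> (\<Sum>(a, b)\<in>targets R. hit M [(a, b)])"
    by (rule sum_mono2) (auto simp: mem_targets \<mu>_U nb_def)
  finally show ?thesis .
qed

text \<open>The two half-edges lie on different edges unless \<open>h = \<mu> g\<close>, that is,
  unless they form a loop. Loops are counted by \<open>S3 same_star\<close>.\<close>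

lemma S4_le: "S4 R \<le> (\<Sum>g\<in>U. \<Sum>h\<in>oth g \<inter> U. \<Sum>(a, b)\<in>targets R. hit M [(g, a), (h, b)]) + S3 same_star"
proof -
  have "(\<Sum>h\<in>oth g \<inter> U. of_bool (R (nb g) (nb h))) \<le>
     (\<Sum>h\<in>oth g \<inter> U. \<Sum>(a, b)\<in>targets R. hit M [(g, a), (h, b)]) + of_bool (same_star (fst g) (nb g))" (is "?l \<le> ?r")
    if g: "g \<in> U" for g
  proof -
    have "of_bool (R (nb g) (nb h)) \<le> (\<Sum>(a, b)\<in>targets R. hit M [(g, a), (h, b)]) + of_bool (h = \<mu> g)"
      if h: "h \<in> oth g \<inter> U" for h
    proof (cases "R (nb g) (nb h) \<and> h \<noteq> \<mu> g")
      case True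
      then have "hit M [(g, \<mu> g), (h, \<mu> h)] \<le> (\<Sum>(a, b)\<in>targets R. hit M [(g, a), (h, b)])"
        using g h member_le_sum[of "(\<mu> g, \<mu> h)" "targets R" "\<lambda>(a, b). hit M [(g, a), (h, b)]"]
        by (auto simp: mem_targets \<mu>_U nb_def)
      then show ?thesis using True g h hit_2[of g h] by (auto simp: oth_def)
    next
      case False
      then have "of_bool (R (nb g) (nb h)) \<le> (of_bool (h = \<mu> g) :: real)" by auto
      moreover have "0 \<le> (\<Sum>(a, b)\<in>targets R. hit M [(g, a), (h, b)])" by (intro sum_nonneg) auto
      ultimately show ?thesis by linarith
    qed
    then have "?l \<le> (\<Sum>h\<in>oth g \<inter> U. (\<Sum>(a, b)\<in>targets R. hit M [(g, a), (h, b)]) + of_bool (h = \<mu> g))"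
      by (rule sum_mono)
    also have "\<dots> = (\<Sum>h\<in>oth g \<inter> U. \<Sum>(a, b)\<in>targets R. hit M [(g, a), (h, b)]) + of_bool (\<mu> g \<in> oth g \<inter> U)"
      by (simp add: sum.distrib of_bool_def)
    also have "\<dots> \<le> ?r" by (auto simp: oth_def same_star_def nb_def of_bool_def)
    finally show ?thesis .
  qed
  then show ?thesis unfolding S4_def S3_def sum.distrib[symmetric] by (rule sum_mono)
qed

text \<open>The three half-edges lie on three different edges unless \<open>g\<close> is a loop or
  has a parallel edge. Such a \<open>g\<close> has at most 2 * 2 continuations and is counted by
  \<open>S3 same_star\<close> or \<open>S4 same_star\<close>. The partner of \<open>g\<close>
  becomes a summation variable \<open>g1\<close>, so that the index sets no longer depend on the
  matching.\<close>

lemma S5_le: "S5 R \<le> (\<Sum>g\<in>U. \<Sum>g1\<in>U. \<Sum>h\<in>oth g \<inter> U. \<Sum>h'\<in>oth g1 \<inter> U. \<Sum>(a, b)\<in>targets R. hit M [(g, g1), (h, a), (h', b)])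
   + 4 * (S3 same_star + S4 same_star)"
proof -
  define W where "W = (\<lambda>g g1. \<Sum>h\<in>oth g \<inter> U. \<Sum>h'\<in>oth g1 \<inter> U. \<Sum>(a, b)\<in>targets R. hit M [(g, g1), (h, a), (h', b)])"
  have W0: "W g g1 \<ge> 0" for g g1 unfolding W_def by (intro sum_nonneg) auto
  define e where "e = (\<lambda>g. of_bool (same_star (fst g) (nb g)) + (\<Sum>h\<in>oth g \<inter> U. of_bool (same_star (nb g) (nb h)) :: real))"
  have e0: "e g \<ge> 0" for g unfolding e_def by (auto intro!: add_nonneg_nonneg sum_nonneg)
  have "(\<Sum>h\<in>oth g \<inter> U. \<Sum>h'\<in>oth (\<mu> g) \<inter> U. of_bool (R (nb h) (nb h'))) \<le> (\<Sum>g1\<in>U. W g g1) + 4 * e g" (is "?l \<le> _")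
    if g: "g \<in> U" for g
  proof -
    have card2: "card (oth h \<inter> U) \<le> 2" if "h \<in> U" for h
      using card_oth[OF U_H[OF that]] card_mono[OF finite_oth, of "oth h \<inter> U" h] by auto
    have "?l \<le> W g (\<mu> g) + 4 * e g"
    proof (cases "fst g = nb g \<or> (\<exists>h\<in>oth g \<inter> U. nb h = nb g)")
      case True
      have "?l \<le> (\<Sum>h\<in>oth g \<inter> U. \<Sum>h'\<in>oth (\<mu> g) \<inter> U. 1)" by (intro sum_mono) auto
      also have "\<dots> = real (card (oth g \<inter> U) * card (oth (\<mu> g) \<inter> U))" by simp
      also have "\<dots> \<le> real (2 * 2)"
        by (intro of_nat_mono mult_le_mono card2 \<mu>_U g)
      also have "\<dots> \<le> 4 * e g"
      proof -
        have "1 \<le> e g"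
        proof (cases "fst g = nb g")
          case True
          then show ?thesis unfolding e_def by (simp add: same_star_def sum_nonneg)
        next
          case False
          then obtain h where h: "h \<in> oth g \<inter> U" "nb h = nb g" using True by auto
          have "of_bool (same_star (nb g) (nb h)) \<le> (\<Sum>h\<in>oth g \<inter> U. of_bool (same_star (nb g) (nb h)) :: real)"
            by (rule member_le_sum[OF h(1)]) auto
          moreover have "same_star (nb g) (nb h)" using h(2) by (simp add: same_star_def)
          ultimately show ?thesis unfolding e_def by (simp add: add_increasing)
        qed
        then show ?thesis by simp
      qed
      finally show ?thesis using W0[of g "\<mu> g"] by simp
    next
      case False
      have "?l \<le> W g (\<mu> g)" unfolding W_def
      proof (intro sum_mono)
        fix h h' assume h: "h \<in> oth g \<inter> U" and h': "h' \<in> oth (\<mu> g) \<inter> U"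
        have ne: "g \<noteq> h" "h' \<noteq> \<mu> g" "fst h = fst g" "fst h' = nb g" using h h' by (auto simp: oth_def nb_def)
        have ne2: "h \<noteq> \<mu> g" "g \<noteq> h'" "h \<noteq> h'" using ne False by (auto simp: nb_def)
        have ne3: "h' \<noteq> \<mu> h" using ne False h by (auto simp: nb_def)
        show "of_bool (R (nb h) (nb h')) \<le> (\<Sum>(a, b)\<in>targets R. hit M [(g, \<mu> g), (h, a), (h', b)])"
        proof (cases "R (nb h) (nb h')")
          case True
          then have "hit M [(g, \<mu> g), (h, \<mu> h), (h', \<mu> h')] \<le> (\<Sum>(a, b)\<in>targets R. hit M [(g, \<mu> g), (h, a), (h', b)])"
            using h h' member_le_sum[of "(\<mu> h, \<mu> h')" "targets R" "\<lambda>(a, b). hit M [(g, \<mu> g), (h, a), (h', b)]"]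
            by (auto simp: mem_targets \<mu>_U nb_def)
          then show ?thesis using hit_3[OF g _ _ ne(1) ne2(1,2) ne(2) ne2(3) ne3] True h h' by simp
        next
          case False
          have "0 \<le> (\<Sum>(a, b)\<in>targets R. hit M [(g, \<mu> g), (h, a), (h', b)])" by (intro sum_nonneg) auto
          then show ?thesis using False by simp
        qed
      qed
      then show ?thesis using e0[of g] by simp
    qed
    moreover have "W g (\<mu> g) \<le> (\<Sum>g1\<in>U. W g g1)"
      by (rule member_le_sum) (auto simp: \<mu>_U g W0)
    ultimately show ?thesis by linarith
  qed
  then have "S5 R \<le> (\<Sum>g\<in>U. (\<Sum>g1\<in>U. W g g1) + 4 * e g)" unfolding S5_def by (rule sum_mono)
  also have "\<dots> = (\<Sum>g\<in>U. \<Sum>g1\<in>U. W g g1) + 4 * (S3 same_star + S4 same_star)"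
    by (simp add: sum.distrib e_def S3_def S4_def sum_distrib_left)
  finally show ?thesis by (simp only: W_def)
qed

lemma card_at: "card {g\<in>U. fst g = u} \<le> 3"
proof -
  have "{g\<in>U. fst g = u} \<subseteq> {u} \<times> {1..3}" by (auto simp: U_def mem_H)
  from card_mono[OF _ this] show ?thesis by (simp add: card_cartesian_product)
qed

text \<open>At most three vertices are related to a given one, with at most three free half-edges
  each.\<close>

lemma card_targets_same_star: "card (targets same_star) \<le> 9 * card U"
proof -
  have cls: "card {b\<in>U. same_star u (fst b)} \<le> 9" for u
  proof -
    define C where "C = insert u (if u \<in> N then {u'\<in>N. par u' = par u} else {})"
    have cC: "card C \<le> 3 \<and> finite C"
    proof (cases "u \<in> N")
      case True
      have "{u'\<in>N. par u' = par u} \<subseteq> nb ` ({par u} \<times> {1..3})"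
      proof
        fix u' assume u': "u' \<in> {u'\<in>N. par u' = par u}"
        then obtain h where h: "h \<in> H" "fst h \<in> V0" "nb h = u'" "par u' = fst h" by (blast elim: N_E)
        have "fst h = par u" using h(4) u' by simp
        then have "h \<in> {par u} \<times> {1..3}" using h(1) by (cases h) (auto simp: mem_H)
        then show "u' \<in> nb ` ({par u} \<times> {1..3})" using h(3) by auto
      qed
      from surj_card_le[OF _ this] have "card {u'\<in>N. par u' = par u} \<le> 3"
        by (simp add: card_cartesian_product)
      moreover have "C = {u'\<in>N. par u' = par u}" using True by (auto simp: C_def)
      ultimately show ?thesis by simp
    qed (simp add: C_def)
    have "{b\<in>U. same_star u (fst b)} \<subseteq> C \<times> {1..3}" by (auto simp: U_def mem_H same_star_def C_def)
    then have "card {b\<in>U. same_star u (fst b)} \<le> card (C \<times> {1..3::nat})" using cC by (intro card_mono) auto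
    also have "\<dots> \<le> 9" using cC by (simp add: card_cartesian_product)
    finally show ?thesis .
  qed
  have "targets same_star = (SIGMA a:U. {b\<in>U. same_star (fst a) (fst b)})" by (auto simp: targets_def)
  then have "card (targets same_star) = (\<Sum>a\<in>U. card {b\<in>U. same_star (fst a) (fst b)})" by (simp add: card_SigmaI)
  also have "\<dots> \<le> (\<Sum>a\<in>U. 9)" by (intro sum_mono cls)
  finally show ?thesis by simp
qed

text \<open>Every failure of \<open>good\<close> relates, by equality or through a common star, two
  vertices on or next to the edge. Such a pair is joined by a walk of one, two or three free edges,
  which gives the three alternatives.\<close>

lemma Bad_cases:
  assumes g: "g \<in> U" and bad: "\<not> good g"
  shows "(\<exists>h\<in>U. fst h \<in> {fst g, nb g} \<and> (same_star (fst h) (nb h) \<or> (\<exists>h'\<in>oth h \<inter> U. same_star (nb h) (nb h')))) \<or>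
    (\<exists>h\<in>oth g \<inter> U. \<exists>h'\<in>oth (\<mu> g) \<inter> U. same_star (nb h) (nb h'))"
proof (rule ccontr)
  assume neg: "\<not> ?thesis"
  have n1: "\<not> same_star (fst h) (nb h)" if "h \<in> U" "fst h = fst g \<or> fst h = nb g" for h using neg that by auto
  have n2: "\<not> same_star (nb h) (nb h')" if "h \<in> U" "fst h = fst g \<or> fst h = nb g" "h' \<in> U" "fst h' = fst h" "h' \<noteq> h" for h h'
    using neg that by (fastforce simp: oth_def dest: U_H)
  have gU: "\<mu> g \<in> U" "fst (\<mu> g) = nb g" "nb (\<mu> g) = fst g" using \<mu>_U[OF g] g by (auto simp: nb_def U_def)
  have sym: "same_star a b \<Longrightarrow> same_star b a" for a b by (auto simp: same_star_def)
  have n3: "\<not> same_star (nb h) (nb h')" if "h \<in> U" "h' \<in> U" "fst h = fst g" "fst h' = nb g" "h \<noteq> g" "h' \<noteq> \<mu> g" for h h'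
  proof -
    have "h \<in> oth g \<inter> U" "h' \<in> oth (\<mu> g) \<inter> U" using that gU by (auto simp: oth_def dest: U_H)
    then show ?thesis using neg by blast
  qed
  have uv: "\<not> same_star (fst g) (nb g)" using n1[OF g] by simp
  then have "fst g \<noteq> nb g" by (auto simp: same_star_def)
  have only: "h = g \<or> h = \<mu> g" if h: "h \<in> H" "fst h \<in> {fst g, nb g}" "nb h \<in> {fst g, nb g}" for h
  proof (rule ccontr)
    assume hn: "\<not> (h = g \<or> h = \<mu> g)"
    have hU: "h \<in> U" using h g by (auto simp: U_def)
    have "fst h \<noteq> nb h" using n1[OF hU] h by (auto simp: same_star_def)
    then consider "fst h = fst g" "nb h = nb g" | "fst h = nb g" "nb h = fst g" using h by auto
    then show False
    proof cases
      case 1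
      then show False using n2[OF g _ hU] hn by (auto simp: same_star_def)
    next
      case 2
      then show False using n2[OF gU(1) _ hU] hn gU by (auto simp: same_star_def)
    qed
  qed
  define Q where "Q = core_edges {fst g, nb g}"
  have Q: "h \<in> U \<and> (fst h = fst g \<or> fst h = nb g) \<and> h \<noteq> g \<and> h \<noteq> \<mu> g" if "h \<in> Q" for h
    using that g gU by (auto simp: Q_def core_edges_def U_def)
  have QQ: "\<not> same_star (nb h) (nb h')" if h: "h \<in> Q" "h' \<in> Q" "h \<noteq> h'" for h h'
  proof (cases "fst h = fst h'")
    case True
    show ?thesis by (rule n2) (use Q[OF h(1)] Q[OF h(2)] h(3) True in simp_all)
  next
    case False
    then consider "fst h = fst g" "fst h' = nb g" | "fst h = nb g" "fst h' = fst g"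
      using Q[OF h(1)] Q[OF h(2)] by auto
    then show ?thesis
    proof cases
      case 1
      then show ?thesis using n3[of h h'] Q[OF h(1)] Q[OF h(2)] by auto
    next
      case 2
      then have "\<not> same_star (nb h') (nb h)" using n3[of h' h] Q[OF h(1)] Q[OF h(2)] by auto
      then show ?thesis using sym by blast
    qed
  qed
  have CQ: "\<not> same_star a (nb h)" if h: "h \<in> Q" "a \<in> {fst g, nb g}" for h a
  proof (cases "a = fst h")
    case True
    then show ?thesis using n1[of h] Q[OF h(1)] by auto
  next
    case False
    then consider "fst h = fst g" "a = nb g" | "fst h = nb g" "a = fst g" using Q[OF h(1)] h(2) by auto
    then show ?thesis
    proof cases
      case 1
      then show ?thesis using n2[OF g, of h] Q[OF h(1)] by auto
    next
      case 2
      then show ?thesis using n2[OF gU(1), of h] Q[OF h(1)] gU by auto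
    qed
  qed
  have "inj_on nb Q" using QQ by (auto simp: inj_on_def same_star_def)
  moreover have "inj_on par (({fst g, nb g} \<union> nb ` Q) \<inter> N)"
  proof (rule inj_onI, rule ccontr)
    fix a b assume a: "a \<in> ({fst g, nb g} \<union> nb ` Q) \<inter> N" and b: "b \<in> ({fst g, nb g} \<union> nb ` Q) \<inter> N"
      and "par a = par b" and ab: "a \<noteq> b"
    then have s: "same_star a b" "same_star b a" by (auto simp: same_star_def)
    consider "a \<in> {fst g, nb g}" "b \<in> {fst g, nb g}" | h where "h \<in> Q" "nb h = a" "b \<in> {fst g, nb g}"
      | h where "h \<in> Q" "nb h = b" "a \<in> {fst g, nb g}" | h h' where "h \<in> Q" "nb h = a" "h' \<in> Q" "nb h' = b"
      using a b by blast
    then show False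
    proof cases
      case 1
      then show False using uv s ab sym by auto
    next
      case 2
      then show False using CQ[of h b] s by blast
    next
      case 3
      then show False using CQ[of h a] s by blast
    next
      case 4
      then show False using QQ[of h h'] s ab by auto
    qed
  qed
  ultimately have "good g" using \<open>fst g \<noteq> nb g\<close> only by (auto simp: good_def clean_def Q_def)
  then show False using bad by simp
qed

text \<open>A defect found at \<open>fst h\<close> is charged to the at most three half-edges that
  start there and the three that end there, hence 6. A defect across \<open>g\<close> is charged to
  \<open>g\<close> alone.\<close>

lemma card_Bad_le: "real (card Bad) \<le> 6 * S3 same_star + 6 * S4 same_star + S5 same_star"
proof -
  define w where "w = (\<lambda>h. of_bool (same_star (fst h) (nb h)) + (\<Sum>h'\<in>oth h \<inter> U. of_bool (same_star (nb h) (nb h')) :: real))"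
  define W where "W = (\<lambda>u. \<Sum>h\<in>U. if fst h = u then w h else 0)"
  define e where "e = (\<lambda>g. \<Sum>h\<in>oth g \<inter> U. \<Sum>h'\<in>oth (\<mu> g) \<inter> U. of_bool (same_star (nb h) (nb h')) :: real)"
  have w0: "w h \<ge> 0" for h unfolding w_def by (auto intro!: add_nonneg_nonneg sum_nonneg)
  have W0: "W u \<ge> 0" for u unfolding W_def by (auto intro!: sum_nonneg w0)
  have e0: "e g \<ge> 0" for g unfolding e_def by (auto intro!: sum_nonneg)
  have "of_bool (\<not> good g) \<le> W (fst g) + W (nb g) + e g" if g: "g \<in> U" for g
  proof (cases "good g")
    case False
    from Bad_cases[OF g this] show ?thesis
    proof
      assume "\<exists>h\<in>U. fst h \<in> {fst g, nb g} \<and> (same_star (fst h) (nb h) \<or> (\<exists>h'\<in>oth h \<inter> U. same_star (nb h) (nb h')))"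
      then obtain h where h: "h \<in> U" "fst h \<in> {fst g, nb g}" "same_star (fst h) (nb h) \<or> (\<exists>h'\<in>oth h \<inter> U. same_star (nb h) (nb h'))" by auto
      have "1 \<le> w h"
      proof (cases "same_star (fst h) (nb h)")
        case True
        then show ?thesis unfolding w_def by (simp add: sum_nonneg)
      next
        case False
        then obtain h' where h': "h' \<in> oth h \<inter> U" "same_star (nb h) (nb h')" using h by auto
        have "of_bool (same_star (nb h) (nb h')) \<le> (\<Sum>h'\<in>oth h \<inter> U. of_bool (same_star (nb h) (nb h')) :: real)"
          by (rule member_le_sum[OF h'(1)]) auto
        then show ?thesis using h' unfolding w_def by simp
      qed
      also have "w h \<le> W (fst h)"
        using member_le_sum[of h U "\<lambda>h'. if fst h' = fst h then w h' else 0"] h w0 by (auto simp: W_def)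
      also have "W (fst h) \<le> W (fst g) + W (nb g)" using h(2) W0 by auto
      finally show ?thesis using e0[of g] False by simp
    next
      assume "\<exists>h\<in>oth g \<inter> U. \<exists>h'\<in>oth (\<mu> g) \<inter> U. same_star (nb h) (nb h')"
      then obtain h h' where h: "h \<in> oth g \<inter> U" "h' \<in> oth (\<mu> g) \<inter> U" "same_star (nb h) (nb h')" by auto
      have "of_bool (same_star (nb h) (nb h')) \<le> (\<Sum>h'\<in>oth (\<mu> g) \<inter> U. of_bool (same_star (nb h) (nb h')) :: real)"
        by (rule member_le_sum[OF h(2)]) auto
      also have "\<dots> \<le> e g" unfolding e_def
        by (rule member_le_sum[OF h(1)]) (auto intro!: sum_nonneg)
      finally show ?thesis using h(3) W0[of "fst g"] W0[of "nb g"] False by simp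
    qed
  qed (auto intro!: add_nonneg_nonneg W0 e0)
  then have "(\<Sum>g\<in>U. of_bool (\<not> good g)) \<le> (\<Sum>g\<in>U. W (fst g) + W (nb g) + e g)" by (rule sum_mono)
  also have "(\<Sum>g\<in>U. of_bool (\<not> good g)) = real (card Bad)"
    by (simp add: Bad_def of_bool_def sum.If_cases Int_def)
  also have "(\<Sum>g\<in>U. W (fst g) + W (nb g) + e g) = (\<Sum>g\<in>U. W (fst g)) + (\<Sum>g\<in>U. W (fst (\<mu> g))) + (\<Sum>g\<in>U. e g)"
    by (simp add: sum.distrib nb_def)
  also have "(\<Sum>g\<in>U. W (fst (\<mu> g))) = (\<Sum>g\<in>U. W (fst g))" by (rule sum_U_\<mu>)
  also have "(\<Sum>g\<in>U. W (fst g)) = (\<Sum>h\<in>U. \<Sum>g\<in>U. if fst h = fst g then w h else 0)"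
    unfolding W_def by (rule sum.swap)
  also have "\<dots> = (\<Sum>h\<in>U. real (card {g\<in>U. fst g = fst h}) * w h)"
    by (simp add: sum.If_cases Int_def eq_commute)
  also have "\<dots> \<le> (\<Sum>h\<in>U. 3 * w h)"
    using card_at by (intro sum_mono mult_right_mono w0) (simp add: numeral_eq_of_nat)
  also have "\<dots> = 3 * S3 same_star + 3 * S4 same_star" by (simp add: w_def sum.distrib S3_def S4_def sum_distrib_left)
  finally show ?thesis by (simp add: S5_def e_def)
qed

end

lemma sum_swap_le:
  fixes f :: "'a \<Rightarrow> 'b \<Rightarrow> real"
  assumes "\<And>x. x \<in> A \<Longrightarrow> (\<Sum>i\<in>I. f i x) \<le> C x"
  shows "(\<Sum>i\<in>I. \<Sum>x\<in>A. f i x) \<le> (\<Sum>x\<in>A. C x)"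
  by (subst sum.swap) (rule sum_mono[OF assms])

section \<open>Averages over one family\<close>

context qaoa_stars begin

lemma qaoa_stars_Fam: "M' \<in> Fam \<Longrightarrow> qaoa_stars n V0 M' \<beta> \<gamma>"
  by (intro qaoa_stars.intro matched_stars_Fam qaoa_stars_axioms.intro \<beta> \<gamma>)

lemma Fam_U:
  assumes "M' \<in> Fam"
  shows "qaoa_stars.U n V0 M' = U" "qaoa_stars.targets n V0 M' R = targets R" "qaoa_stars.same_star n V0 M' = same_star"
proof -
  interpret M': qaoa_stars n V0 M' \<beta> \<gamma> by (rule qaoa_stars_Fam[OF assms])
  show U: "M'.U = U" unfolding M'.U_def U_def using Fam_eq(4)[OF assms] by auto
  show "M'.targets R = targets R" unfolding M'.targets_def targets_def U ..
  show "M'.same_star = same_star" unfolding fun_eq_iff M'.same_star_def same_star_def Fam_eq(1)[OF assms]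
    using Fam_eq(2)[OF assms] by auto
qed

definition "F = real (card Fam)"
text \<open>The cost of each prescribed pair in \<open>sum_Fam_hit\<close>, valid for up to three
  pairs.\<close>

definition "\<rho> = 1 / (real (card U) - 5)"
text \<open>It depends only on the family: the number of ways to continue an edge at a given side,
  summed over all candidates for that side.\<close>

definition "Y = (\<Sum>g\<in>U. real (card (oth g \<inter> U)))"

lemma avg_S3:
  assumes "card U \<ge> 6"
  shows "(\<Sum>M'\<in>Fam. qaoa_stars.S3 n V0 M' R) \<le> card (targets R) * \<rho> * F"
proof -
  have "(\<Sum>M'\<in>Fam. qaoa_stars.S3 n V0 M' R) \<le> (\<Sum>M'\<in>Fam. \<Sum>(a, b)\<in>targets R. hit M' [(a, b)])"
    using qaoa_stars.S3_le[OF qaoa_stars_Fam] Fam_U by (intro sum_mono) force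
  also have "\<dots> \<le> (\<Sum>(a, b)\<in>targets R. \<rho> * F)"
  proof (rule sum_swap_le)
    fix ab assume "ab \<in> targets R"
    then obtain a b where ab: "ab = (a, b)" "a \<in> U" "b \<in> U" by (auto simp: targets_def)
    show "(\<Sum>M'\<in>Fam. case ab of (a, b) \<Rightarrow> hit M' [(a, b)]) \<le> (case ab of (a, b) \<Rightarrow> \<rho> * F)"
      using sum_Fam_hit[of "[(a, b)]", folded \<rho>_def F_def] assms ab by (simp add: power2_eq_square power3_eq_cube mult_ac)
  qed
  finally show ?thesis by (simp add: case_prod_unfold mult_ac)
qed

lemma avg_S4:
  assumes "card U \<ge> 6"
  shows "(\<Sum>M'\<in>Fam. qaoa_stars.S4 n V0 M' R) \<le> (Y * card (targets R) * \<rho>\<^sup>2 + card (targets same_star) * \<rho>) * F"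
proof -
  have "(\<Sum>M'\<in>Fam. qaoa_stars.S4 n V0 M' R) \<le> (\<Sum>M'\<in>Fam. (\<Sum>g\<in>U. \<Sum>h\<in>oth g \<inter> U. \<Sum>(a, b)\<in>targets R. hit M' [(g, a), (h, b)])
      + qaoa_stars.S3 n V0 M' same_star)"
  proof (rule sum_mono)
    fix M' assume "M' \<in> Fam"
    from qaoa_stars.S4_le[OF qaoa_stars_Fam[OF this], of R] Fam_U[OF this]
    show "qaoa_stars.S4 n V0 M' R \<le> (\<Sum>g\<in>U. \<Sum>h\<in>oth g \<inter> U. \<Sum>(a, b)\<in>targets R. hit M' [(g, a), (h, b)])
      + qaoa_stars.S3 n V0 M' same_star" by simp
  qed
  also have "\<dots> = (\<Sum>M'\<in>Fam. \<Sum>g\<in>U. \<Sum>h\<in>oth g \<inter> U. \<Sum>(a, b)\<in>targets R. hit M' [(g, a), (h, b)])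
      + (\<Sum>M'\<in>Fam. qaoa_stars.S3 n V0 M' same_star)" by (rule sum.distrib)
  also have "\<dots> \<le> (\<Sum>g\<in>U. \<Sum>h\<in>oth g \<inter> U. \<Sum>(a, b)\<in>targets R. \<rho>\<^sup>2 * F) + card (targets same_star) * \<rho> * F"
  proof (intro add_mono sum_swap_le avg_S3 assms)
    fix g h ab assume g: "g \<in> U" "h \<in> oth g \<inter> U" and "ab \<in> targets R"
    then obtain a b where ab: "ab = (a, b)" "a \<in> U" "b \<in> U" by (auto simp: targets_def)
    show "(\<Sum>M'\<in>Fam. case ab of (a, b) \<Rightarrow> hit M' [(g, a), (h, b)]) \<le> (case ab of (a, b) \<Rightarrow> \<rho>\<^sup>2 * F)"
      using sum_Fam_hit[of "[(g, a), (h, b)]", folded \<rho>_def F_def] assms ab g by (simp add: power2_eq_square power3_eq_cube mult_ac)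
  qed
  also have "(\<Sum>g\<in>U. \<Sum>h\<in>oth g \<inter> U. \<Sum>(a, b)\<in>targets R. \<rho>\<^sup>2 * F) = Y * (card (targets R) * (\<rho>\<^sup>2 * F))"
    unfolding Y_def sum_distrib_right by (simp add: case_prod_unfold)
  finally show ?thesis by (simp add: algebra_simps)
qed

lemma avg_S5:
  assumes "card U \<ge> 6"
  shows "(\<Sum>M'\<in>Fam. qaoa_stars.S5 n V0 M' R) \<le>
    (Y\<^sup>2 * card (targets R) * \<rho> ^ 3 + 4 * (Y * card (targets same_star) * \<rho>\<^sup>2 + 2 * card (targets same_star) * \<rho>)) * F"
proof -
  have "(\<Sum>M'\<in>Fam. qaoa_stars.S5 n V0 M' R) \<le> (\<Sum>M'\<in>Fam. (\<Sum>g\<in>U. \<Sum>g1\<in>U. \<Sum>h\<in>oth g \<inter> U. \<Sum>h'\<in>oth g1 \<inter> U. \<Sum>(a, b)\<in>targets R. hit M' [(g, g1), (h, a), (h', b)])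
      + 4 * (qaoa_stars.S3 n V0 M' same_star + qaoa_stars.S4 n V0 M' same_star))"
  proof (rule sum_mono)
    fix M' assume "M' \<in> Fam"
    from qaoa_stars.S5_le[OF qaoa_stars_Fam[OF this], of R] Fam_U[OF this]
    show "qaoa_stars.S5 n V0 M' R \<le> (\<Sum>g\<in>U. \<Sum>g1\<in>U. \<Sum>h\<in>oth g \<inter> U. \<Sum>h'\<in>oth g1 \<inter> U. \<Sum>(a, b)\<in>targets R. hit M' [(g, g1), (h, a), (h', b)])
      + 4 * (qaoa_stars.S3 n V0 M' same_star + qaoa_stars.S4 n V0 M' same_star)" by simp
  qed
  also have "\<dots> = (\<Sum>M'\<in>Fam. \<Sum>g\<in>U. \<Sum>g1\<in>U. \<Sum>h\<in>oth g \<inter> U. \<Sum>h'\<in>oth g1 \<inter> U. \<Sum>(a, b)\<in>targets R. hit M' [(g, g1), (h, a), (h', b)])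
      + 4 * ((\<Sum>M'\<in>Fam. qaoa_stars.S3 n V0 M' same_star) + (\<Sum>M'\<in>Fam. qaoa_stars.S4 n V0 M' same_star))"
    by (simp only: sum.distrib sum_distrib_left distrib_left)
  also have "\<dots> \<le> (\<Sum>g\<in>U. \<Sum>g1\<in>U. \<Sum>h\<in>oth g \<inter> U. \<Sum>h'\<in>oth g1 \<inter> U. \<Sum>(a, b)\<in>targets R. \<rho> ^ 3 * F) +
     4 * (card (targets same_star) * \<rho> * F + (Y * card (targets same_star) * \<rho>\<^sup>2 + card (targets same_star) * \<rho>) * F)"
  proof (intro add_mono mult_left_mono sum_swap_le avg_S3 avg_S4 assms)
    fix g g1 h h' ab assume g: "g \<in> U" "g1 \<in> U" "h \<in> oth g \<inter> U" "h' \<in> oth g1 \<inter> U" and "ab \<in> targets R"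
    then obtain a b where ab: "ab = (a, b)" "a \<in> U" "b \<in> U" by (auto simp: targets_def)
    show "(\<Sum>M'\<in>Fam. case ab of (a, b) \<Rightarrow> hit M' [(g, g1), (h, a), (h', b)]) \<le> (case ab of (a, b) \<Rightarrow> \<rho> ^ 3 * F)"
      using sum_Fam_hit[of "[(g, g1), (h, a), (h', b)]", folded \<rho>_def F_def] assms ab g by (simp add: power2_eq_square power3_eq_cube mult_ac)
  qed simp
  also have "(\<Sum>g\<in>U. \<Sum>g1\<in>U. \<Sum>h\<in>oth g \<inter> U. \<Sum>h'\<in>oth g1 \<inter> U. \<Sum>(a, b)\<in>targets R. \<rho> ^ 3 * F) = Y\<^sup>2 * (card (targets R) * (\<rho> ^ 3 * F))"
  proof -
    define C where "C = card (targets R) * (\<rho> ^ 3 * F)"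
    have "(\<Sum>h\<in>oth g \<inter> U. \<Sum>h'\<in>oth g1 \<inter> U. \<Sum>(a, b)\<in>targets R. \<rho> ^ 3 * F) =
      real (card (oth g \<inter> U)) * real (card (oth g1 \<inter> U)) * C" for g g1
      by (simp add: case_prod_unfold C_def)
    then have "(\<Sum>g\<in>U. \<Sum>g1\<in>U. \<Sum>h\<in>oth g \<inter> U. \<Sum>h'\<in>oth g1 \<inter> U. \<Sum>(a, b)\<in>targets R. \<rho> ^ 3 * F) =
      (\<Sum>g\<in>U. \<Sum>g1\<in>U. real (card (oth g \<inter> U)) * real (card (oth g1 \<inter> U))) * C"
      by (simp only: sum_distrib_right)
    then show ?thesis unfolding Y_def power2_eq_square sum_product C_def .
  qed
  finally show ?thesis by (simp add: algebra_simps)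
qed

definition "both_N u v \<longleftrightarrow> u \<in> N \<and> v \<in> N"

lemma card_targets_both_N: "card (targets both_N) = (6 * card V0)\<^sup>2"
proof -
  have "targets both_N = UP \<times> UP" by (auto simp: targets_def both_N_def UP_def)
  then show ?thesis by (simp add: card_cartesian_product card_UP power2_eq_square)
qed

lemma paths_eq: "paths3 = S3 both_N" "paths4 = S4 both_N" "paths5 = S5 both_N"
proof -
  have "ind u * ind v = of_bool (both_N u v)" for u v by (simp add: ind_def both_N_def)
  then show "paths3 = S3 both_N" "paths4 = S4 both_N" "paths5 = S5 both_N"
    by (simp_all only: paths3_def paths4_def paths5_def S3_def S4_def S5_def)
qed

definition "gap_max = Max ((\<lambda>\<sigma>. projected_energy V E V0 \<sigma> \<psi>) ` spins V0) - energy V E \<psi>"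

lemma gap_max_le:
  "gap_max \<le> (15 / 4 * \<theta>\<^sup>2 * S3 both_N + 9 / 2 * c * \<bar>\<theta>\<bar> ^ 3 * S4 both_N + 3 / 2 * \<theta> ^ 4 * S5 both_N
     + 24 * (6 * S3 same_star + 6 * S4 same_star + S5 same_star)) / 4" (is "_ \<le> ?b")
proof -
  have "projected_energy V E V0 \<sigma> \<psi> \<le> energy V E \<psi> + ?b" if "\<sigma> \<in> spins V0" for \<sigma>
  proof -
    interpret qaoa_outcome n V0 M \<beta> \<gamma> \<sigma> by unfold_locales (rule that)
    have "projected_energy V E V0 \<sigma> \<psi> - energy V E \<psi> \<le>
        (15 / 4 * \<theta>\<^sup>2 * S3 both_N + 9 / 2 * c * \<bar>\<theta>\<bar> ^ 3 * S4 both_N + 3 / 2 * \<theta> ^ 4 * S5 both_N + 24 * real (card Bad)) / 4"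
      using outcome_bound unfolding paths_eq by (simp only: of_nat_mult of_nat_numeral)
    also have "\<dots> \<le> ?b" by (intro divide_right_mono add_left_mono mult_left_mono card_Bad_le) auto
    finally show ?thesis by linarith
  qed
  moreover have "spins V0 \<noteq> {}" by (simp add: spins_def PiE_eq_empty_iff)
  ultimately have "Max ((\<lambda>\<sigma>. projected_energy V E V0 \<sigma> \<psi>) ` spins V0) \<le> energy V E \<psi> + ?b"
    by (subst Max_le_iff) auto
  then show ?thesis unfolding gap_max_def by linarith
qed

text \<open>From \<open>card U \<ge> 10\<close> follows \<open>card U * \<rho> \<le> 2\<close>,
  hence 18 for the related targets and a factor \<open>Y * \<rho> \<le> 4\<close> for every further
  edge, giving 72 and 288. The other constants are 432 = 4 * (72 + 2 * 18), 90 = 72 + 18, 720 = 288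
  + 432 and 1368 = 6 * 18 + 6 * 90 + 720.\<close>

lemma avg_gap_max:
  assumes U: "card U \<ge> 10"
  defines "J \<equiv> (6 * real (card V0))\<^sup>2" and "y \<equiv> 6 * real n - 18 * real (card V0)"
  shows "(\<Sum>M'\<in>Fam. qaoa_stars.gap_max n V0 M' \<beta> \<gamma>) \<le>
    (15 / 4 * \<theta>\<^sup>2 * (J * \<rho>) + 9 / 2 * c * \<bar>\<theta>\<bar> ^ 3 * (y * J * \<rho>\<^sup>2 + 18)
      + 3 / 2 * \<theta> ^ 4 * (y\<^sup>2 * J * \<rho> ^ 3 + 432) + 24 * 1368) / 4 * F"
proof -
  have U6: "card U \<ge> 6" using U by simp
  have c0: "c \<ge> 0" by simp
  have F0: "F \<ge> 0" by (simp add: F_def)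
  have \<rho>0: "\<rho> > 0" using U by (simp add: \<rho>_def)
  have U\<rho>: "real (card U) * \<rho> \<le> 2" using U by (simp add: \<rho>_def field_simps)
  have Y0: "Y \<ge> 0" by (simp add: Y_def sum_nonneg)
  have Yy: "Y \<le> y" unfolding Y_def y_def by (rule sum_card_oth_U)
  have YU: "Y \<le> 2 * card U"
  proof -
    have "real (card (oth g \<inter> U)) \<le> 2" if "g \<in> U" for g
      using card_oth[OF U_H[OF that]] card_mono[OF finite_oth, of "oth g \<inter> U" g] by auto
    then have "Y \<le> (\<Sum>g\<in>U. 2)" unfolding Y_def by (rule sum_mono)
    then show ?thesis by simp
  qed
  have Y\<rho>: "Y * \<rho> \<le> 4"
  proof -
    have "Y * \<rho> \<le> 2 * real (card U) * \<rho>" using mult_right_mono[OF YU, of \<rho>] \<rho>0 by simp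
    then show ?thesis using U\<rho> by linarith
  qed
  have T\<rho>: "card (targets same_star) * \<rho> \<le> 18"
  proof -
    have "real (card (targets same_star)) \<le> 9 * real (card U)" using card_targets_same_star by (simp flip: of_nat_mult)
    then have "card (targets same_star) * \<rho> \<le> 9 * real (card U) * \<rho>" using \<rho>0 by (intro mult_right_mono) auto
    then show ?thesis using U\<rho> by linarith
  qed
  have T0: "0 \<le> card (targets same_star) * \<rho>" using \<rho>0 by simp
  have YT: "Y * card (targets same_star) * \<rho>\<^sup>2 \<le> 72"
    using mult_mono[OF Y\<rho> T\<rho>] Y0 T0 by (simp add: power2_eq_square mult_ac)
  have YYT: "Y\<^sup>2 * card (targets same_star) * \<rho> ^ 3 \<le> 288"
    using mult_mono[OF Y\<rho> YT] Y0 \<rho>0 by (simp add: power2_eq_square power3_eq_cube mult_ac)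
  have J: "real (card (targets both_N)) = J"
    unfolding card_targets_both_N J_def by (simp only: of_nat_power of_nat_mult of_nat_numeral)
  have J0: "J \<ge> 0" by (simp add: J_def)
  have a1: "(\<Sum>M'\<in>Fam. qaoa_stars.S3 n V0 M' both_N) \<le> (J * \<rho>) * F" using avg_S3[OF U6, of both_N] by (simp add: J)
  have a2: "(\<Sum>M'\<in>Fam. qaoa_stars.S4 n V0 M' both_N) \<le> (y * J * \<rho>\<^sup>2 + 18) * F"
  proof (rule order_trans[OF avg_S4[OF U6, of both_N]], rule mult_right_mono[OF add_mono[OF _ T\<rho>] F0])
    show "Y * card (targets both_N) * \<rho>\<^sup>2 \<le> y * J * \<rho>\<^sup>2" unfolding J by (intro mult_right_mono Yy J0) simp
  qed
  have a3: "(\<Sum>M'\<in>Fam. qaoa_stars.S5 n V0 M' both_N) \<le> (y\<^sup>2 * J * \<rho> ^ 3 + 432) * F"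
  proof (rule order_trans[OF avg_S5[OF U6, of both_N]], rule mult_right_mono[OF add_mono F0])
    show "Y\<^sup>2 * card (targets both_N) * \<rho> ^ 3 \<le> y\<^sup>2 * J * \<rho> ^ 3" unfolding J
      using \<rho>0 by (intro mult_right_mono power_mono Yy Y0 J0) auto
    show "4 * (Y * card (targets same_star) * \<rho>\<^sup>2 + 2 * card (targets same_star) * \<rho>) \<le> 432" using YT T\<rho> by simp
  qed
  have b1: "(\<Sum>M'\<in>Fam. qaoa_stars.S3 n V0 M' same_star) \<le> 18 * F"
    by (rule order_trans[OF avg_S3[OF U6]]) (intro mult_right_mono T\<rho> F0)
  have b2: "(\<Sum>M'\<in>Fam. qaoa_stars.S4 n V0 M' same_star) \<le> 90 * F"
    by (rule order_trans[OF avg_S4[OF U6]], rule mult_right_mono[OF _ F0]) (use YT T\<rho> in linarith)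
  have b3: "(\<Sum>M'\<in>Fam. qaoa_stars.S5 n V0 M' same_star) \<le> 720 * F"
    by (rule order_trans[OF avg_S5[OF U6]], rule mult_right_mono[OF _ F0]) (use YT YYT T\<rho> in simp)
  have "(\<Sum>M'\<in>Fam. qaoa_stars.gap_max n V0 M' \<beta> \<gamma>) \<le>
    (\<Sum>M'\<in>Fam. (15 / 4 * \<theta>\<^sup>2 * qaoa_stars.S3 n V0 M' both_N + 9 / 2 * c * \<bar>\<theta>\<bar> ^ 3 * qaoa_stars.S4 n V0 M' both_N
      + 3 / 2 * \<theta> ^ 4 * qaoa_stars.S5 n V0 M' both_N
      + 24 * (6 * qaoa_stars.S3 n V0 M' same_star + 6 * qaoa_stars.S4 n V0 M' same_star + qaoa_stars.S5 n V0 M' same_star)) / 4)"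
  proof (rule sum_mono)
    fix M' assume M': "M' \<in> Fam"
    interpret M': qaoa_stars n V0 M' \<beta> \<gamma> by (rule qaoa_stars_Fam[OF M'])
    have "M'.both_N = both_N" unfolding fun_eq_iff M'.both_N_def both_N_def Fam_eq(1)[OF M'] by simp
    then show "M'.gap_max \<le> (15 / 4 * \<theta>\<^sup>2 * M'.S3 both_N + 9 / 2 * c * \<bar>\<theta>\<bar> ^ 3 * M'.S4 both_N
      + 3 / 2 * \<theta> ^ 4 * M'.S5 both_N + 24 * (6 * M'.S3 same_star + 6 * M'.S4 same_star + M'.S5 same_star)) / 4"
      using M'.gap_max_le unfolding Fam_U(3)[OF M'] by simp
  qed
  also have "\<dots> = (15 / 4 * \<theta>\<^sup>2 * (\<Sum>M'\<in>Fam. qaoa_stars.S3 n V0 M' both_N) + 9 / 2 * c * \<bar>\<theta>\<bar> ^ 3 * (\<Sum>M'\<in>Fam. qaoa_stars.S4 n V0 M' both_N)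
      + 3 / 2 * \<theta> ^ 4 * (\<Sum>M'\<in>Fam. qaoa_stars.S5 n V0 M' both_N)
      + 24 * (6 * (\<Sum>M'\<in>Fam. qaoa_stars.S3 n V0 M' same_star) + 6 * (\<Sum>M'\<in>Fam. qaoa_stars.S4 n V0 M' same_star) + (\<Sum>M'\<in>Fam. qaoa_stars.S5 n V0 M' same_star))) / 4"
    by (simp only: sum_divide_distrib[symmetric] sum.distrib sum_distrib_left[symmetric])
  also have "\<dots> \<le> (15 / 4 * \<theta>\<^sup>2 * ((J * \<rho>) * F) + 9 / 2 * c * \<bar>\<theta>\<bar> ^ 3 * ((y * J * \<rho>\<^sup>2 + 18) * F)
      + 3 / 2 * \<theta> ^ 4 * ((y\<^sup>2 * J * \<rho> ^ 3 + 432) * F)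
      + 24 * (6 * (18 * F) + 6 * (90 * F) + 720 * F)) / 4"
    by (intro divide_right_mono add_mono mult_left_mono a1 a2 a3 b1 b2 b3) auto
  also have "\<dots> = (15 / 4 * \<theta>\<^sup>2 * (J * \<rho>) + 9 / 2 * c * \<bar>\<theta>\<bar> ^ 3 * (y * J * \<rho>\<^sup>2 + 18)
      + 3 / 2 * \<theta> ^ 4 * (y\<^sup>2 * J * \<rho> ^ 3 + 432) + 24 * 1368) / 4 * F"
    by (simp only: ring_distribs mult.assoc add_divide_distrib) (simp add: mult_ac)
  finally show ?thesis .
qed

end

section \<open>The threshold\<close>

definition two_independent_matchings :: "nat \<Rightarrow> nat set \<Rightarrow> half_edge set set set" where
  "two_independent_matchings n V0 = {M \<in> perfect_matchings (half_edges {1..n} 3). two_independent 3 M V0}"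

lemma pairing_matching:
  assumes "inj_on f A" "f ` A \<inter> A = {}"
  shows "(\<lambda>h. {h, f h}) ` A \<in> perfect_matchings (A \<union> f ` A)"
proof (rule perfect_matchingsI)
  have ne: "f h \<noteq> h'" if "h \<in> A" "h' \<in> A" for h h' using assms(2) that by auto
  show "disjoint ((\<lambda>h. {h, f h}) ` A)"
    using ne inj_onD[OF assms(1)] by (force simp: disjoint_def)
  show "card p = 2" if "p \<in> (\<lambda>h. {h, f h}) ` A" for p using that ne by (auto simp: card_2_iff)
qed auto

lemma card_half_edges: "card (half_edges V 3) = 3 * card V"
  by (simp add: half_edges_def card_cartesian_product)

lemma card_two_independent_matchings:
  assumes n: "n = 2 * j" and V0: "V0 \<subseteq> {1..n}" and k: "card V0 = k" "2 * k \<le> n"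
  shows "card (two_independent_matchings n V0) = (\<Prod>i<3 * k. n - k - i) * 27 ^ k * odd_fact (3 * j - 3 * k)"
proof -
  define A H W where "A = half_edges V0 3" and "H = half_edges {1..n} 3" and "W = {1..n} - V0"
  have fin: "finite A" "finite H" "finite W" "finite V0"
    using finite_subset[OF V0] by (auto simp: A_def H_def W_def half_edges_def)
  have AH: "A \<subseteq> H" using V0 by (auto simp: A_def H_def half_edges_def)
  have cA: "card A = 3 * k" using k by (simp add: A_def card_half_edges)
  have cH: "card H = 2 * (3 * j)" by (simp add: H_def card_half_edges n)
  have cW: "card W = n - k" using V0 k fin by (simp add: W_def card_Diff_subset)
  \<comment> \<open>\<open>G\<close> chooses distinct end vertices outside \<open>V0\<close> for the
    half-edges at \<open>V0\<close>, and \<open>C\<close> the half-edge used at each of them. The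
    latter gives 3 ^ 3 = 27 per star.\<close>
  define G where "G = {g \<in> A \<rightarrow>\<^sub>E W. inj_on g A}"
  define C where "C = A \<rightarrow>\<^sub>E {1..3 :: nat}"
  define f where "f = (\<lambda>(g, c) (h :: half_edge). (g h, c h) :: half_edge)"
  define P where "P = (\<lambda>gc. (\<lambda>h. {h, f gc h}) ` A)"
  have G: "g h \<in> W" if "g \<in> G" "h \<in> A" for g h using that by (auto simp: G_def)
  have C: "c h \<in> {1..3}" if "c \<in> C" "h \<in> A" for c h using that by (auto simp: C_def)
  have "finite G" by (rule finite_subset[of _ "A \<rightarrow>\<^sub>E W"]) (use fin in \<open>auto simp: G_def intro: finite_PiE\<close>)
  moreover have "finite C" unfolding C_def by (intro finite_PiE fin) auto
  ultimately have finGC: "finite (G \<times> C)" by simp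
  have fH: "f gc ` A \<subseteq> H - A" "inj_on (f gc) A" if "gc \<in> G \<times> C" for gc
  proof -
    define g c where "g = fst gc" and "c = snd gc"
    then have gc: "gc = (g, c)" "g \<in> G" "c \<in> C" using that by auto
    show "f gc ` A \<subseteq> H - A" using G[OF gc(2)] C[OF gc(3)] gc(1) by (fastforce simp: f_def H_def A_def half_edges_def W_def)
    show "inj_on (f gc) A" using gc by (auto simp: f_def G_def inj_on_def)
  qed
  have P: "P gc \<in> perfect_matchings (A \<union> f gc ` A)" if "gc \<in> G \<times> C" for gc
    unfolding P_def using fH[OF that] by (intro pairing_matching) auto
  have each: "card {M \<in> perfect_matchings H. P gc \<subseteq> M} = odd_fact (3 * j - 3 * k)" if "gc \<in> G \<times> C" for gc
  proof (rule card_perfect_matchings_superset[OF fin(2) cH P[OF that]])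
    show "A \<union> f gc ` A \<subseteq> H" using AH fH(1)[OF that] by auto
    have "card (A \<union> f gc ` A) = card A + card (f gc ` A)"
      using fin fH(1)[OF that] by (intro card_Un_disjoint) auto
    then show "card (A \<union> f gc ` A) = 2 * (3 * k)" using card_image[OF fH(2)[OF that]] cA by simp
  qed
  have part: "partner M h = f gc h" if "gc \<in> G \<times> C" "M \<in> perfect_matchings H" "P gc \<subseteq> M" "h \<in> A" for gc M h
    using that AH by (subst partner_eq_iff[OF that(2)]) (auto simp: P_def)
  have eq: "two_independent_matchings n V0 = (\<Union>gc\<in>G \<times> C. {M \<in> perfect_matchings H. P gc \<subseteq> M})"
  proof (intro equalityI subsetI)
    fix M assume "M \<in> two_independent_matchings n V0"
    then have M: "M \<in> perfect_matchings H" "\<And>h. h \<in> A \<Longrightarrow> fst (partner M h) \<notin> V0" "inj_on (\<lambda>h. fst (partner M h)) A"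
      by (auto simp: two_independent_matchings_def two_independent_def H_def A_def)
    define gc where "gc = (restrict (\<lambda>h. fst (partner M h)) A, restrict (\<lambda>h. snd (partner M h)) A)"
    have in_H: "partner M h \<in> H" if "h \<in> A" for h using partner_mem[OF M(1)] that AH by blast
    have "fst (partner M h) \<in> W \<and> snd (partner M h) \<in> {1..3}" if "h \<in> A" for h
      using in_H[OF that] M(2)[OF that] by (cases "partner M h") (auto simp: W_def H_def half_edges_def)
    then have "gc \<in> G \<times> C" using M(3) by (auto simp: gc_def G_def C_def inj_on_def)
    moreover have "P gc \<subseteq> M" using partner_in[OF M(1)] AH by (auto simp: P_def gc_def f_def)
    ultimately show "M \<in> (\<Union>gc\<in>G \<times> C. {M \<in> perfect_matchings H. P gc \<subseteq> M})" using M(1) by blast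
  next
    fix M assume "M \<in> (\<Union>gc\<in>G \<times> C. {M \<in> perfect_matchings H. P gc \<subseteq> M})"
    then obtain g c where gc: "g \<in> G" "c \<in> C" "M \<in> perfect_matchings H" "P (g, c) \<subseteq> M" by blast
    have p: "fst (partner M h) = g h" if "h \<in> A" for h using part[OF _ gc(3,4) that] gc by (simp add: f_def)
    have "two_independent 3 M V0" unfolding two_independent_def A_def[symmetric]
    proof
      show "\<forall>h\<in>A. fst (partner M h) \<notin> V0" using p G[OF gc(1)] by (auto simp: W_def)
      show "inj_on (\<lambda>h. fst (partner M h)) A" using p gc(1) by (auto simp: G_def inj_on_def)
    qed
    then show "M \<in> two_independent_matchings n V0" using gc(3) by (simp add: two_independent_matchings_def H_def)
  qed
  have disj: "{M \<in> perfect_matchings H. P gc \<subseteq> M} \<inter> {M \<in> perfect_matchings H. P gc' \<subseteq> M} = {}"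
    if gc: "gc \<in> G \<times> C" "gc' \<in> G \<times> C" "gc \<noteq> gc'" for gc gc'
  proof (rule ccontr)
    assume "\<not> ?thesis"
    then obtain M where M: "M \<in> perfect_matchings H" "P gc \<subseteq> M" "P gc' \<subseteq> M" by auto
    have e: "f gc h = f gc' h" if "h \<in> A" for h
      using part[OF gc(1) M(1,2) that] part[OF gc(2) M(1,3) that] by simp
    obtain g c g' c' where s: "gc = (g, c)" "gc' = (g', c')" by (cases gc, cases gc') auto
    have "g = g'" by (rule PiE_ext[of _ A "\<lambda>_. W"]) (use gc s e in \<open>auto simp: G_def f_def\<close>)
    moreover have "c = c'" by (rule PiE_ext[of _ A "\<lambda>_. {1..3}"]) (use gc s e in \<open>auto simp: C_def f_def\<close>)
    ultimately show False using gc(3) s by simp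
  qed
  have "card (two_independent_matchings n V0) = (\<Sum>gc\<in>G \<times> C. card {M \<in> perfect_matchings H. P gc \<subseteq> M})"
    unfolding eq using finGC fin disj by (intro card_UN_disjoint) auto
  also have "\<dots> = card G * card C * odd_fact (3 * j - 3 * k)" using each by (simp add: card_cartesian_product)
  also have "card G = (\<Prod>i<3 * k. n - k - i)"
    unfolding G_def using card_inj_on_subset_funcset[OF fin(1,3) order.refl] by (simp add: cA cW atLeast0LessThan)
  also have "card C = 27 ^ k" unfolding C_def using fin by (simp add: card_funcsetE cA power_mult)
  finally show ?thesis .
qed

section \<open>The first moment in closed form\<close>

lemma prod_falling_fact: "l \<le> m \<Longrightarrow> (\<Prod>i<l. m - i) * fact (m - l) = (fact m :: nat)"
proof (induction l)
  case (Suc l)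
  have "(\<Prod>i<Suc l. m - i) * fact (m - Suc l) = (\<Prod>i<l. m - i) * ((m - l) * fact (m - Suc l))" by simp
  also have "(m - l) * fact (m - Suc l) = fact (m - l)"
    using Suc.prems fact_reduce[of "m - l", where 'a = nat] by (simp add: Suc_diff_Suc)
  finally show ?case using Suc by simp
qed simp

lemma expected_two_independent_eq:
  assumes n: "n = 2 * j"
  shows "expected_two_independent 3 n k =
    (\<Sum>V0 | V0 \<subseteq> {1..n} \<and> card V0 = k. real (card (two_independent_matchings n V0))) / odd_fact (3 * j)"
proof -
  define H where "H = half_edges {1..n} 3"
  define PM where "PM = perfect_matchings H"
  have fin: "finite H" by (simp add: H_def half_edges_def)
  have cPM: "card PM = odd_fact (3 * j)" unfolding PM_def using fin
    by (intro card_perfect_matchings) (simp_all add: H_def card_half_edges n)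
  then have "PM \<noteq> {}" using odd_fact_pos[of "3 * j"] by (metis card.empty less_irrefl)
  then have "expected_two_independent 3 n k = (\<Sum>M\<in>PM. real (card {V0. V0 \<subseteq> {1..n} \<and> card V0 = k \<and> two_independent 3 M V0})) / card PM"
    unfolding expected_two_independent_def configuration_model_def PM_def H_def
    by (intro integral_pmf_of_set) (use fin in \<open>auto simp: H_def\<close>)
  also have "(\<Sum>M\<in>PM. real (card {V0. V0 \<subseteq> {1..n} \<and> card V0 = k \<and> two_independent 3 M V0})) =
    (\<Sum>M\<in>PM. \<Sum>V0 | V0 \<subseteq> {1..n} \<and> card V0 = k. of_bool (two_independent 3 M V0))"
    by (simp add: of_bool_def sum.If_cases Int_def conj_assoc)
  also have "\<dots> = (\<Sum>V0 | V0 \<subseteq> {1..n} \<and> card V0 = k. \<Sum>M\<in>PM. of_bool (two_independent 3 M V0))"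
    by (rule sum.swap)
  also have "\<dots> = (\<Sum>V0 | V0 \<subseteq> {1..n} \<and> card V0 = k. real (card (two_independent_matchings n V0)))"
    using fin by (simp add: two_independent_matchings_def of_bool_def sum.If_cases Int_def PM_def H_def)
  finally show ?thesis by (simp add: cPM)
qed

lemma expected_two_independent_3:
  assumes n: "n = 2 * j" and k: "4 * k \<le> n"
  shows "expected_two_independent 3 n k =
    fact n / (fact k * fact (n - 4 * k)) * 27 ^ k * odd_fact (3 * j - 3 * k) / odd_fact (3 * j)"
proof -
  have "(\<Sum>V0 | V0 \<subseteq> {1..n} \<and> card V0 = k. real (card (two_independent_matchings n V0))) =
    real (n choose k) * real ((\<Prod>i<3 * k. n - k - i) * 27 ^ k * odd_fact (3 * j - 3 * k))"
    using card_two_independent_matchings[OF n] k by (simp add: n_subsets)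
  also have "real (n choose k) = fact n / (fact k * fact (n - k))" using k by (intro binomial_fact) simp
  also have "real ((\<Prod>i<3 * k. n - k - i) * 27 ^ k * odd_fact (3 * j - 3 * k)) =
    fact (n - k) / fact (n - 4 * k) * 27 ^ k * odd_fact (3 * j - 3 * k)"
  proof -
    have "real (fact (n - k)) = real ((\<Prod>i<3 * k. n - k - i) * fact (n - k - 3 * k))"
      by (subst prod_falling_fact) (use k in auto)
    moreover have "n - k - 3 * k = n - 4 * k" by simp
    ultimately have "fact (n - k) = real (\<Prod>i<3 * k. n - k - i) * fact (n - 4 * k)" by (simp only: of_nat_mult of_nat_fact)
    then show ?thesis by (simp add: field_simps)
  qed
  finally show ?thesis unfolding expected_two_independent_eq[OF n] by simp
qed

text \<open>The \<open>3 * k\<close> neighbours would have to be distinct vertices among the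
  \<open>n - k\<close> outside \<open>V0\<close>.\<close>

lemma expected_two_independent_0:
  assumes n: "n = 2 * j" and k: "4 * k > n"
  shows "expected_two_independent 3 n k = 0"
proof -
  have "card (two_independent_matchings n V0) = 0" if V0: "V0 \<subseteq> {1..n}" "card V0 = k" for V0
  proof -
    have "\<not> two_independent 3 M V0" if M: "M \<in> perfect_matchings (half_edges {1..n} 3)" for M
    proof
      assume t: "two_independent 3 M V0"
      have "half_edges V0 3 \<subseteq> half_edges {1..n} 3" using V0 by (auto simp: half_edges_def)
      then have "partner M h \<in> half_edges {1..n} 3" if "h \<in> half_edges V0 3" for h
        using partner_mem[OF M] that by blast
      then have "fst (partner M h) \<in> {1..n}" if "h \<in> half_edges V0 3" for h
        using that by (fastforce simp: half_edges_def)
      then have "(\<lambda>h. fst (partner M h)) ` half_edges V0 3 \<subseteq> {1..n} - V0"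
        using t by (auto simp: two_independent_def)
      then have "card (half_edges V0 3) \<le> card ({1..n} - V0)"
        using t by (intro card_inj_on_le[of "\<lambda>h. fst (partner M h)"]) (auto simp: two_independent_def)
      then have "3 * k \<le> n - k" using V0 finite_subset[OF V0(1)] by (simp add: card_half_edges card_Diff_subset)
      then show False using k by linarith
    qed
    then have "two_independent_matchings n V0 = {}" by (auto simp: two_independent_matchings_def)
    then show ?thesis by simp
  qed
  then show ?thesis unfolding expected_two_independent_eq[OF n] by simp
qed


text \<open>A logarithmic error suffices for exponential rates. The \<open>+ 1\<close> inside the
  logarithm covers \<open>n = 0\<close>, where the main terms vanish.\<close>

lemma ln_fact_bounds:
  fixes n :: nat
  shows
  "real n * ln (real n) - real n \<le> ln (fact n :: real)" "ln (fact n :: real) \<le> real n * ln (real n) - real n + (1 + ln (real n + 1))"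
proof -
  have st: "real n * ln (real n) - real n \<le> ln (fact n :: real) \<and> ln (fact n :: real) \<le> real n * ln (real n) - real n + 1 + ln (real n)" if "n \<ge> 1"
    using that
  proof (induction n rule: nat_induct_at_least)
    case (Suc n)
    define x where "x = real n"
    have x: "x \<ge> 1" using Suc by (simp add: x_def)
    have "ln (fact (Suc n)) = ln (x + 1) + ln (fact n :: real)"
      by (simp add: x_def ln_mult add.commute)
    moreover have "ln ((x + 1) / x) \<le> 1 / x"
      using ln_add_one_self_le_self2[of "1 / x"] x by (simp add: field_simps)
    then have "x * (ln (x + 1) - ln x) \<le> 1" using x by (simp add: ln_div field_simps)
    moreover have "ln (x / (x + 1)) \<le> - (1 / (x + 1))"
      using ln_add_one_self_le_self2[of "- (1 / (x + 1))"] x by (simp add: field_simps)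
    then have "(x + 1) * (ln (x + 1) - ln x) \<ge> 1" using x by (simp add: ln_div field_simps)
    ultimately show ?case using Suc.IH by (simp add: x_def[symmetric] algebra_simps)
  qed simp
  have mono: "ln (real n) \<le> ln (real n + 1)" if "n \<ge> 1" using that by simp
  have "real n * ln (real n) - real n \<le> ln (fact n :: real) \<and> ln (fact n :: real) \<le> real n * ln (real n) - real n + (1 + ln (real n + 1))"
  proof (cases "n = 0")
    case False
    then have "n \<ge> 1" by simp
    from st[OF this] mono[OF this] show ?thesis by linarith
  qed simp
  then show "real n * ln (real n) - real n \<le> ln (fact n :: real)" "ln (fact n :: real) \<le> real n * ln (real n) - real n + (1 + ln (real n + 1))"
    by auto
qed

section \<open>The exponential rate of the first moment\<close>

lemma odd_fact_fact: "odd_fact m * 2 ^ m * fact m = fact (2 * m)"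
proof (induction m)
  case (Suc m)
  have "odd_fact (Suc m) * 2 ^ Suc m * fact (Suc m) = (2 * m + 2) * ((2 * m + 1) * (odd_fact m * 2 ^ m * fact m))"
    by (simp add: algebra_simps)
  also have "\<dots> = fact (2 * Suc m)" unfolding Suc.IH by simp
  finally show ?case .
qed simp

lemma ln_odd_fact_bounds:
  "\<bar>ln (real (odd_fact m)) - (real m * ln (2 * real m) - real m)\<bar> \<le> 1 + ln (2 * real m + 1)"
proof (cases "m = 0")
  case False
  have "ln (real (odd_fact m * 2 ^ m * fact m)) = ln (real (fact (2 * m)))" by (simp only: odd_fact_fact)
  then have "ln (odd_fact m) + m * ln 2 + ln (fact m) = ln (fact (2 * m))"
    by (simp add: ln_mult ln_realpow)
  moreover have l: "ln (2 * real m) = ln 2 + ln m" using False by (simp add: ln_mult)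
  moreover have "real m * ln (2 * real m) = real m * ln 2 + real m * ln m"
    "real (2 * m) * ln (real (2 * m)) = 2 * (real m * ln 2) + 2 * (real m * ln m)"
    by (simp_all only: of_nat_mult of_nat_numeral l) (simp_all add: algebra_simps)
  moreover have "ln (real m + 1) \<le> ln (2 * real m + 1)" by simp
  moreover have "ln (real (2 * m) + 1) = ln (2 * real m + 1)" by simp
  ultimately show ?thesis using ln_fact_bounds[of m] ln_fact_bounds[of "2 * m"]
    unfolding abs_le_iff by linarith
qed simp

text \<open>The limit of the logarithm of the first moment divided by \<open>n\<close>. All terms
  with \<open>ln n\<close> cancel, and the powers of 3 in the two double factorials cancel against
  \<open>27 ^ k\<close>.\<close>

definition rate :: "real \<Rightarrow> real" where
  "rate a = - a * ln a - (1 - 4 * a) * ln (1 - 4 * a) + 3 / 2 * (1 - 2 * a) * ln (1 - 2 * a)"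

lemma ln_expected_two_independent:
  assumes n: "n = 2 * j" "n > 0" and k: "real k = a * n" "0 < a" "a \<le> 1 / 4"
  shows "\<bar>ln (expected_two_independent 3 n k) - n * rate a\<bar> \<le> 5 * (1 + ln (3 * real n + 1))"
    "expected_two_independent 3 n k > 0"
proof -
  have k4: "4 * k \<le> n"
  proof -
    have "4 * real k \<le> n" using k n by (simp add: field_simps)
    then show ?thesis by linarith
  qed
  define p where "p = 3 * j - 3 * k"
  define q where "q = n - 4 * k"
  note E = expected_two_independent_3[OF n(1) k4]
  show "expected_two_independent 3 n k > 0" unfolding E by (auto intro!: divide_pos_pos mult_pos_pos)
  have lnE: "ln (expected_two_independent 3 n k) =
    ln (fact n) - ln (fact k) - ln (fact q) + k * ln 27 + ln (odd_fact p) - ln (odd_fact (3 * j))"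
    unfolding E p_def q_def by (simp add: ln_mult ln_div ln_realpow)
  define x where "x = real n"
  have x: "x > 0" using n by (simp add: x_def)
  have rk: "real k = a * x" and rj: "real (3 * j) = 3 / 2 * x" and rq: "real q = (1 - 4 * a) * x" and rp: "real p = 3 / 2 * (1 - 2 * a) * x"
  proof -
    show "real k = a * x" using k by (simp add: x_def)
    show "real (3 * j) = 3 / 2 * x" by (simp add: x_def n)
    have "real q = x - 4 * real k" using k4 by (simp add: q_def x_def of_nat_diff)
    then show "real q = (1 - 4 * a) * x" using k by (simp add: x_def algebra_simps)
    have "real p = 3 / 2 * x - 3 * real k" using k4 n by (simp add: p_def x_def of_nat_diff)
    then show "real p = 3 / 2 * (1 - 2 * a) * x" using k by (simp add: x_def algebra_simps)
  qed
  define L where "L = ln (3 * x + 1)"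
  \<comment> \<open>At \<open>a = 1 / 4\<close> both sides vanish through the factor in front of the
    logarithm; no set of that size leaves a vertex outside its stars.\<close>
  have lnq: "(1 - 4 * a) * ln ((1 - 4 * a) * x) = (1 - 4 * a) * (ln (1 - 4 * a) + ln x)"
    using x k by (cases "1 - 4 * a = 0") (simp_all add: ln_mult)
  have ln27: "ln 27 = 3 * ln (3 :: real)" using ln_realpow[of 3 3] by simp
  have lnp: "ln (2 * (3 / 2 * (1 - 2 * a) * x)) = ln 3 + ln (1 - 2 * a) + ln x"
  proof -
    have "2 * (3 / 2 * (1 - 2 * a) * x) = 3 * ((1 - 2 * a) * x)" by simp
    also have "ln \<dots> = ln 3 + ln ((1 - 2 * a) * x)" using x k by (intro ln_mult_pos) auto
    also have "ln ((1 - 2 * a) * x) = ln (1 - 2 * a) + ln x" using x k by (intro ln_mult_pos) auto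
    finally show ?thesis by simp
  qed
  have lnj: "ln (2 * (3 / 2 * x)) = ln 3 + ln x" using x by (simp add: ln_mult)
  have lnk: "ln (a * x) = ln a + ln x" using x k by (simp add: ln_mult)
  have b1: "x * ln x - x \<le> ln (fact n)" "ln (fact n) \<le> x * ln x - x + (1 + L)"
    using ln_fact_bounds[of n] x by (auto simp: x_def L_def intro: order_trans)
  have b2: "a * x * (ln a + ln x) - a * x \<le> ln (fact k)" "ln (fact k) \<le> a * x * (ln a + ln x) - a * x + (1 + L)"
  proof -
    have "ln (real k + 1) \<le> L" using k4 by (simp add: L_def x_def)
    then show "a * x * (ln a + ln x) - a * x \<le> ln (fact k)" "ln (fact k) \<le> a * x * (ln a + ln x) - a * x + (1 + L)"
      using ln_fact_bounds[of k] unfolding rk lnk by (simp_all add: add.commute)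
  qed
  have b3: "x * ((1 - 4 * a) * (ln (1 - 4 * a) + ln x)) - (1 - 4 * a) * x \<le> ln (fact q)"
    "ln (fact q) \<le> x * ((1 - 4 * a) * (ln (1 - 4 * a) + ln x)) - (1 - 4 * a) * x + (1 + L)"
  proof -
    have "ln (real q + 1) \<le> L" by (simp add: L_def x_def q_def)
    then show "x * ((1 - 4 * a) * (ln (1 - 4 * a) + ln x)) - (1 - 4 * a) * x \<le> ln (fact q)"
      "ln (fact q) \<le> x * ((1 - 4 * a) * (ln (1 - 4 * a) + ln x)) - (1 - 4 * a) * x + (1 + L)"
      using ln_fact_bounds[of q] unfolding rq lnq[symmetric] by (simp_all add: mult_ac add.commute)
  qed
  have b4: "\<bar>ln (odd_fact p) - (3 / 2 * (1 - 2 * a) * x * (ln 3 + ln (1 - 2 * a) + ln x) - 3 / 2 * (1 - 2 * a) * x)\<bar> \<le> 1 + L"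
  proof -
    have "ln (2 * real p + 1) \<le> L" using n by (simp add: L_def x_def p_def)
    then show ?thesis using ln_odd_fact_bounds[of p] unfolding rp lnp by (simp add: add.commute)
  qed
  have b5: "\<bar>ln (odd_fact (3 * j)) - (3 / 2 * x * (ln 3 + ln x) - 3 / 2 * x)\<bar> \<le> 1 + L"
  proof -
    have "ln (2 * real (3 * j) + 1) \<le> L" using n by (simp add: L_def x_def)
    then show ?thesis using ln_odd_fact_bounds[of "3 * j"] unfolding rj lnj by (simp add: add.commute)
  qed
  have main: "n * rate a = (x * ln x - x) - (a * x * (ln a + ln x) - a * x)
      - (x * ((1 - 4 * a) * (ln (1 - 4 * a) + ln x)) - (1 - 4 * a) * x) + a * x * (3 * ln 3)
      + (3 / 2 * (1 - 2 * a) * x * (ln 3 + ln (1 - 2 * a) + ln x) - 3 / 2 * (1 - 2 * a) * x)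
      - (3 / 2 * x * (ln 3 + ln x) - 3 / 2 * x)"
    unfolding rate_def x_def[symmetric] by algebra
  have arith: "\<bar>x1 - x2 - x3 + y1 - y2\<bar> \<le> 5 * e"
    if "0 \<le> x1" "x1 \<le> e" "0 \<le> x2" "x2 \<le> e" "0 \<le> x3" "x3 \<le> e" "\<bar>y1\<bar> \<le> e" "\<bar>y2\<bar> \<le> e"
    for x1 x2 x3 y1 y2 e :: real
    using that by linarith
  have regroup: "f1 - f2 - f3 + t + o1 - o2 - (A1 - A2 - A3 + t + A4 - A5) =
    (f1 - A1) - (f2 - A2) - (f3 - A3) + (o1 - A4) - (o2 - A5)" for f1 f2 f3 t o1 o2 A1 A2 A3 A4 A5 :: real
    by simp
  have "\<bar>ln (expected_two_independent 3 n k) - n * rate a\<bar> \<le> 5 * (1 + L)"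
    unfolding lnE main ln27 rk regroup
    by (rule arith[OF _ _ _ _ _ _ b4 b5]) (use b1 b2 b3 in linarith)+
  then show "\<bar>ln (expected_two_independent 3 n k) - n * rate a\<bar> \<le> 5 * (1 + ln (3 * real n + 1))"
    by (simp add: L_def x_def)
qed

section \<open>Growth, decay and the sign of the rate\<close>

lemma eventually_log_small:
  assumes "c > 0"
  shows "\<forall>\<^sub>F n in sequentially. 5 * (1 + ln (3 * real n + 1)) \<le> c * real n"
  using assms by real_asymp

lemma even_times_3: "even (n * 3) \<Longrightarrow> \<exists>j. n = 2 * (j :: nat)"
  by (auto elim!: evenE)

lemma growth_of_rate_pos:
  assumes a: "0 < a" "a \<le> 1 / 4" and "rate a > 0"
  shows "exponential_growth 3 a"
  unfolding exponential_growth_def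
proof (intro exI conjI)
  \<comment> \<open>The other half of the rate absorbs the logarithmic error.\<close>
  show "rate a / 2 > 0" using assms by simp
  from eventually_log_small[OF this] eventually_gt_at_top[of 0]
  show "\<forall>\<^sub>F n in sequentially. \<forall>k. even (n * 3) \<and> real k = a * real n \<longrightarrow>
    expected_two_independent 3 n k \<ge> exp (rate a / 2 * real n)"
  proof eventually_elim
    case (elim n)
    show ?case
    proof (intro allI impI, elim conjE)
      fix k assume "even (n * 3)" and k: "real k = a * real n"
      then obtain j where n: "n = 2 * j" using even_times_3 by blast
      note b = ln_expected_two_independent[OF n elim(2) k a]
      have "rate a / 2 * n \<le> ln (expected_two_independent 3 n k)"
        using b(1) elim(1) by (simp add: abs_le_iff algebra_simps)
      then show "exp (rate a / 2 * real n) \<le> expected_two_independent 3 n k"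
        using b(2) by (subst (asm) ln_ge_iff)
    qed
  qed
qed

lemma decay_of_rate_neg:
  assumes a: "0 < a" "a \<le> 1 / 4" and "rate a < 0"
  shows "exponential_decay 3 a"
  unfolding exponential_decay_def
proof (intro exI conjI)
  show c: "- rate a / 2 > 0" using assms by simp
  from eventually_log_small[OF this] eventually_gt_at_top[of 0]
  show "\<forall>\<^sub>F n in sequentially. \<forall>k. even (n * 3) \<and> real k = a * real n \<longrightarrow>
    expected_two_independent 3 n k \<le> exp (- (- rate a / 2) * real n)"
  proof eventually_elim
    case (elim n)
    show ?case
    proof (intro allI impI, elim conjE)
      fix k assume "even (n * 3)" and k: "real k = a * real n"
      then obtain j where n: "n = 2 * j" using even_times_3 by blast
      note b = ln_expected_two_independent[OF n elim(2) k a]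
      have "ln (expected_two_independent 3 n k) \<le> rate a / 2 * n"
        using b(1) elim(1) by (simp add: abs_le_iff algebra_simps)
      then have "exp (ln (expected_two_independent 3 n k)) \<le> exp (rate a / 2 * n)" by simp
      then show "expected_two_independent 3 n k \<le> exp (- (- rate a / 2) * real n)"
        using b(2) by simp
    qed
  qed
qed

lemma decay_of_large:
  assumes "a > 1 / 4"
  shows "exponential_decay 3 a"
  unfolding exponential_decay_def
proof (intro exI[of _ 1] conjI)
  show "\<forall>\<^sub>F n in sequentially. \<forall>k. even (n * 3) \<and> real k = a * real n \<longrightarrow>
    expected_two_independent 3 n k \<le> exp (- 1 * real n)"
    using eventually_gt_at_top[of 0]
  proof eventually_elim
    case (elim n)
    show ?case
    proof (intro allI impI, elim conjE)
      fix k assume "even (n * 3)" and k: "real k = a * real n"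
      then obtain j where n: "n = 2 * j" using even_times_3 by blast
      have "1 / 4 * real n < a * real n" using assms elim by (intro mult_strict_right_mono) auto
      then have "real n < real (4 * k)" using k by simp
      then have "n < 4 * k" by (simp only: of_nat_less_iff)
      then show "expected_two_independent 3 n k \<le> exp (- 1 * real n)"
        using expected_two_independent_0[OF n] by simp
    qed
  qed
qed simp

text \<open>\<open>rate\<close> itself is not monotone, but dividing by \<open>z\<close> keeps its
  sign and simplifies the derivative to
  \<open>(ln (1 - 4 * z) - 3 / 2 * ln (1 - 2 * z)) / z\<^sup>2\<close>. This is negative because
  \<open>(1 - 2 * z) ^ 3 - (1 - 4 * z)\<^sup>2 = z * (2 - 4 * z - 8 * z\<^sup>2)\<close> is positive
  below \<open>1 / 4\<close>.\<close>

lemma rate_ratio_decreasing: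
  assumes "0 < x" "x < y" "y < 1 / 4"
  shows "rate y / y < rate x / x"
proof (rule DERIV_neg_imp_decreasing[OF assms(2)])
  fix z assume z: "x \<le> z" "z \<le> y"
  then have z': "z > 0" "1 - 4 * z > 0" "1 - 2 * z > 0" using assms by auto
  have xlnx: "((\<lambda>x. x * ln x) has_real_derivative (ln x + 1)) (at x)" if "x > 0" for x :: real
    using that by (auto intro!: derivative_eq_intros)
  have d4: "((\<lambda>z. (1 - 4 * z) * ln (1 - 4 * z)) has_real_derivative (ln (1 - 4 * z) + 1) * (- 4)) (at z)"
    by (rule DERIV_chain2[where f = "\<lambda>x. x * ln x" and g = "\<lambda>z. 1 - 4 * z", OF xlnx[OF z'(2)]]) (auto intro!: derivative_eq_intros)
  have d2: "((\<lambda>z. (1 - 2 * z) * ln (1 - 2 * z)) has_real_derivative (ln (1 - 2 * z) + 1) * (- 2)) (at z)"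
    by (rule DERIV_chain2[where f = "\<lambda>x. x * ln x" and g = "\<lambda>z. 1 - 2 * z", OF xlnx[OF z'(3)]]) (auto intro!: derivative_eq_intros)
  have rate_eq: "rate = (\<lambda>z. - (z * ln z) - (1 - 4 * z) * ln (1 - 4 * z) + 3 / 2 * ((1 - 2 * z) * ln (1 - 2 * z)))"
    by (simp add: fun_eq_iff rate_def)
  have "(rate has_real_derivative - (ln z + 1) - (ln (1 - 4 * z) + 1) * (- 4) + 3 / 2 * ((ln (1 - 2 * z) + 1) * (- 2))) (at z)"
    unfolding rate_eq by (intro DERIV_add DERIV_diff DERIV_minus DERIV_cmult xlnx d4 d2 z')
  from DERIV_divide[OF this DERIV_ident] z'(1)
  have "((\<lambda>z. rate z / z) has_real_derivative ((- (ln z + 1) - (ln (1 - 4 * z) + 1) * (- 4) + 3 / 2 * ((ln (1 - 2 * z) + 1) * (- 2))) * z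
      - rate z * 1) / (z * z)) (at z)" by blast
  also have "(- (ln z + 1) - (ln (1 - 4 * z) + 1) * (- 4) + 3 / 2 * ((ln (1 - 2 * z) + 1) * (- 2))) * z - rate z * 1 =
      ln (1 - 4 * z) - 3 / 2 * ln (1 - 2 * z)"
    unfolding rate_def by algebra
  finally have "((\<lambda>z. rate z / z) has_real_derivative (ln (1 - 4 * z) - 3 / 2 * ln (1 - 2 * z)) / z\<^sup>2) (at z)"
    by (simp only: power2_eq_square)
  moreover have "(ln (1 - 4 * z) - 3 / 2 * ln (1 - 2 * z)) / z\<^sup>2 < 0"
  proof (rule divide_neg_pos)
    have "0 < z * (2 - 4 * z - 8 * z\<^sup>2)"
    proof (rule mult_pos_pos)
      have "z\<^sup>2 \<le> z * (1 / 4)" unfolding power2_eq_square using z assms by (intro mult_left_mono) auto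
      then show "0 < 2 - 4 * z - 8 * z\<^sup>2" using z assms by linarith
    qed (use z' in simp)
    then have "(1 - 4 * z)\<^sup>2 < (1 - 2 * z) ^ 3"
      by (simp add: power2_eq_square power3_eq_cube algebra_simps)
    then have "ln ((1 - 4 * z)\<^sup>2) < ln ((1 - 2 * z) ^ 3)" using z' by (subst ln_less_cancel_iff) auto
    then show "ln (1 - 4 * z) - 3 / 2 * ln (1 - 2 * z) < 0" using z' by (simp add: ln_realpow)
  qed (use z' in simp)
  ultimately show "\<exists>d. ((\<lambda>z. rate z / z) has_real_derivative d) (at z) \<and> d < 0" by blast
qed

lemma rate_1_8: "rate (1 / 8) > 0"
proof -
  have l: "ln (1 / 8 :: real) = - 3 * ln 2" "ln (1 / 2 :: real) = - ln 2" "ln (3 / 4 :: real) = ln 3 - 2 * ln 2"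
    using ln_realpow[of 2 3] ln_realpow[of 2 2] by (simp_all add: ln_div)
  have "real 11 * ln 2 = ln (2 ^ 11)" by (simp only: ln_realpow)
  also have "\<dots> < ln (3 ^ 9)" by (subst ln_less_cancel_iff) auto
  also have "\<dots> = real 9 * ln 3" by (simp only: ln_realpow)
  finally have "11 * ln 2 < 9 * ln (3 :: real)" by simp
  moreover have "rate (1 / 8) = (9 * ln 3 - 11 * ln 2) / 8" by (simp add: rate_def l field_simps)
  ultimately show ?thesis by simp
qed

text \<open>\<open>6 / 25\<close> is a simple fraction between the threshold and
  \<open>1 / 4\<close>. Clearing the logarithms leaves the integer inequality
  \<open>13 ^ 39 < 5 ^ 50 * 6 ^ 12\<close>.\<close>

lemma rate_6_25: "rate (6 / 25) < 0"
proof -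
  have l: "ln (6 / 25 :: real) = ln 6 - 2 * ln 5" "ln (1 / 25 :: real) = - 2 * ln 5" "ln (13 / 25 :: real) = ln 13 - 2 * ln 5"
    using ln_realpow[of 5 2] by (simp_all add: ln_div)
  have "real 39 * ln 13 = ln (13 ^ 39)" by (simp only: ln_realpow)
  also have "\<dots> < ln (5 ^ 50 * 6 ^ 12)" by (subst ln_less_cancel_iff) auto
  also have "\<dots> = ln (5 ^ 50) + ln (6 ^ 12)" by (rule ln_mult_pos) auto
  also have "\<dots> = real 50 * ln 5 + real 12 * ln 6" by (simp only: ln_realpow)
  finally have "39 * ln 13 < 50 * ln 5 + 12 * ln (6 :: real)" by simp
  moreover have "rate (6 / 25) = (39 * ln 13 - 50 * ln 5 - 12 * ln 6) / 50" by (simp add: rate_def l field_simps)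
  ultimately show ?thesis by simp
qed

lemma rate_1_4: "rate (1 / 4) < 0"
proof -
  have "ln (1 / 4 :: real) = - 2 * ln 2" "ln (1 / 2 :: real) = - ln 2"
    using ln_realpow[of 2 2] by (simp_all add: ln_div)
  then show ?thesis by (simp add: rate_def)
qed

text \<open>Growth and decay would both hold at every point between \<open>a\<close> and
  \<open>b\<close>. A rational point is chosen, since at irrational densities the asymptotic
  statements are vacuous; even multiples of its denominator then supply arbitrarily large admissible
  \<open>n\<close>.\<close>

lemma threshold_unique:
  assumes "0 < a" and g: "\<And>\<alpha>. 0 < \<alpha> \<Longrightarrow> \<alpha> < b \<Longrightarrow> exponential_growth d \<alpha>"
    and dc: "\<And>\<alpha>. a < \<alpha> \<Longrightarrow> exponential_decay d \<alpha>"
  shows "b \<le> a"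
proof (rule ccontr)
  assume "\<not> b \<le> a"
  then obtain r where r: "a < of_rat r" "of_rat r < b" using of_rat_dense by (meson not_le)
  obtain p q where pq: "r = Fract p q" "q > 0" by (cases r)
  have r0: "of_rat r > (0 :: real)" using r assms(1) by linarith
  have rr: "of_rat r = real_of_int p / real_of_int q" using pq by (simp add: of_rat_rat)
  then have "p > 0" using r0 pq(2) by (simp add: zero_less_divide_iff)
  from g[OF r0 r(2)] obtain c where c: "c > 0" "\<forall>\<^sub>F n in sequentially. \<forall>k. even (n * d) \<and> real k = of_rat r * real n \<longrightarrow>
      expected_two_independent d n k \<ge> exp (c * real n)" unfolding exponential_growth_def by blast
  from dc[OF r(1)] obtain c' where c': "c' > 0" "\<forall>\<^sub>F n in sequentially. \<forall>k. even (n * d) \<and> real k = of_rat r * real n \<longrightarrow>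
      expected_two_independent d n k \<le> exp (- c' * real n)" unfolding exponential_decay_def by blast
  from eventually_conj[OF c(2) c'(2)] obtain N where N: "\<And>n k. n \<ge> N \<Longrightarrow> even (n * d) \<Longrightarrow> real k = of_rat r * real n \<Longrightarrow>
      exp (c * real n) \<le> expected_two_independent d n k \<and> expected_two_independent d n k \<le> exp (- c' * real n)"
    unfolding eventually_sequentially by (metis (no_types, lifting))
  define n where "n = 2 * nat q * Suc N"
  define k where "k = 2 * nat p * Suc N"
  have "N \<le> Suc N" by simp
  also have "Suc N \<le> n" unfolding n_def using pq(2) by (cases "nat q") auto
  finally have nN: "N \<le> n" .
  have n0: "n > 0" using pq(2) by (simp add: n_def)
  have "real k = of_rat r * real n" using pq(2) \<open>p > 0\<close> by (simp add: rr n_def k_def field_simps)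
  from N[OF nN _ this] have "exp (c * real n) \<le> expected_two_independent d n k" "expected_two_independent d n k \<le> exp (- c' * real n)"
    by (simp_all add: n_def)
  then have "exp (c * real n) \<le> exp (- c' * real n)" by (rule order_trans)
  then have "c * real n \<le> - c' * real n" by (simp only: exp_le_cancel_iff)
  moreover have "0 < c * real n" "0 < c' * real n" using c(1) c'(1) n0 by simp_all
  ultimately show False by linarith
qed

lemma alpha_star_less: "alpha_star 3 < 1 / 4"
proof -
  have "\<exists>a. 1 / 8 \<le> a \<and> a \<le> 6 / 25 \<and> rate a = 0"
  proof (rule IVT2')
    show "continuous_on {1 / 8..6 / 25} rate" unfolding rate_def by (intro continuous_intros) auto
  qed (use rate_1_8 rate_6_25 in auto)
  then obtain a where a: "1 / 8 \<le> a" "a \<le> 6 / 25" "rate a = 0" by blast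
  have pos: "rate x > 0" if "0 < x" "x < a" for x
    using rate_ratio_decreasing[of x a] that a by (auto simp: zero_less_divide_iff)
  have neg: "rate x < 0" if "a < x" "x < 1 / 4" for x
    using rate_ratio_decreasing[of a x] that a by (auto simp: divide_less_0_iff)
  have growth: "exponential_growth 3 x" if "0 < x" "x < a" for x
    using pos[OF that] that a by (intro growth_of_rate_pos) auto
  have decay: "exponential_decay 3 x" if "a < x" for x
  proof -
    consider "x < 1 / 4" | "x = 1 / 4" | "x > 1 / 4" by linarith
    then show ?thesis
    proof cases
      case 1
      then show ?thesis using neg[OF that] that a by (intro decay_of_rate_neg) auto
    next
      case 2
      show ?thesis unfolding 2 using rate_1_4 by (intro decay_of_rate_neg) auto
    next
      case 3
      then show ?thesis by (rule decay_of_large)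
    qed
  qed
  have "alpha_star 3 = a"
    unfolding alpha_star_def
  proof (rule the_equality)
    show "0 < a \<and> a < 1 / (real 3 + 1) \<and> (\<forall>\<alpha>. 0 < \<alpha> \<and> \<alpha> < a \<longrightarrow> exponential_growth 3 \<alpha>) \<and>
        (\<forall>\<alpha>>a. exponential_decay 3 \<alpha>)" using a growth decay by auto
    fix b assume b: "0 < b \<and> b < 1 / (real 3 + 1) \<and> (\<forall>\<alpha>. 0 < \<alpha> \<and> \<alpha> < b \<longrightarrow> exponential_growth 3 \<alpha>) \<and>
        (\<forall>\<alpha>>b. exponential_decay 3 \<alpha>)"
    show "b = a"
    proof (rule antisym)
      show "b \<le> a" by (rule threshold_unique[where d = 3]) (use a b decay in auto)
      show "a \<le> b" by (rule threshold_unique[where d = 3]) (use a b growth in auto)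
    qed
  qed
  then show ?thesis using a by simp
qed

section \<open>The conditional expectation\<close>

text \<open>The three summands come from the paths of three, four and five edges, over the common
  denominator \<open>(0.5 - a) ^ 3\<close> and without the factor \<open>a\<^sup>2\<close>.
  \<open>\<kappa>\<close> stands for \<open>c * \<bar>\<theta>\<bar> ^ 3\<close>.\<close>

lemma lead_coefficient_le:
  fixes a \<kappa> :: real
  assumes a: "0 < a" "a < 1 / 4" and \<kappa>: "\<kappa> \<le> 0.014256"
  shows "5 / 12 * (0.5 - a)\<^sup>2 + 27 / 4 * \<kappa> * (1 - 3 * a) * (0.5 - a) + (1 - 3 * a)\<^sup>2 / 81
    \<le> 0.18125 - 0.83875 * a + 0.99 * a\<^sup>2"
proof -
  \<comment> \<open>Expanded in the distance \<open>d\<close> to \<open>1 / 4\<close>, every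
    coefficient on the left is at most the corresponding one on the right, so \<open>d > 0\<close>
    suffices. The 0.096228 below is 27/4 times 0.014256.\<close>
  define d where "d = 1 / 4 - a"
  have d: "d > 0" "a = 1 / 4 - d" using a by (auto simp: d_def)
  have "27 / 4 * \<kappa> * ((1 - 3 * a) * (0.5 - a)) \<le> 0.096228 * ((1 - 3 * a) * (0.5 - a))"
    using a \<kappa> by (intro mult_right_mono) auto
  also have "5 / 12 * (0.5 - a)\<^sup>2 + 0.096228 * ((1 - 3 * a) * (0.5 - a)) + (1 - 3 * a)\<^sup>2 / 81
    \<le> 0.18125 - 0.83875 * a + 0.99 * a\<^sup>2"
    unfolding d(2) using d(1) zero_le_power2[of d] by (simp add: power2_eq_square field_simps)
  finally show ?thesis by (simp add: mult.assoc)
qed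

text \<open>\<open>m\<close> is the number of free half-edges, and \<open>t = m / (m - 5)\<close>
  compares \<rho> with \<open>1 / m\<close>; \<open>x \<ge> 7\<close> ensures
  \<open>m \<ge> 10\<close>. Every power of \<open>t\<close> is replaced by
  \<open>t ^ 3 \<le> 1 + 70 / m\<close>. As the main terms are linear in \<open>x\<close>, and so is
  \<open>m\<close>, the excess stays bounded.\<close>

lemma gap_arith:
  fixes a x \<kappa> :: real
  assumes a: "0 < a" "a < 1 / 4" and \<kappa>: "0 \<le> \<kappa>" "\<kappa> \<le> 0.014256" and x: "x \<ge> 7"
  defines "\<rho> \<equiv> 1 / (6 * (0.5 - a) * x - 5)" and "J \<equiv> 36 * a\<^sup>2 * x\<^sup>2" and "y \<equiv> 6 * (1 - 3 * a) * x"
  shows "(15 / 4 * (2 / 27) * (J * \<rho>) + 9 / 2 * \<kappa> * (y * J * \<rho>\<^sup>2 + 18)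
      + 3 / 2 * (4 / 729) * (y\<^sup>2 * J * \<rho> ^ 3 + 432) + 24 * 1368) / 4
    \<le> a\<^sup>2 * (0.18125 - 0.83875 * a + 0.99 * a\<^sup>2) / (0.5 - a) ^ 3 * x + 10000"
proof -
  define h z where "h = 0.5 - a" and "z = 1 - 3 * a"
  define m where "m = 6 * h * x"
  define t where "t = m * \<rho>"
  define cl where "cl = a\<^sup>2 * (0.18125 - 0.83875 * a + 0.99 * a\<^sup>2) / h ^ 3"
  have h: "h > 1 / 4" and z: "z > 0" using a by (auto simp: h_def z_def)
  have m: "m \<ge> 10"
  proof -
    have "1 / 4 * 7 \<le> h * x" using h x by (intro mult_mono) auto
    then show ?thesis by (simp add: m_def)
  qed
  have \<rho>: "\<rho> = t / m" "\<rho> = 1 / (m - 5)" using m a by (auto simp: t_def \<rho>_def m_def h_def)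
  have t: "1 \<le> t" "t \<le> 2" "t - 1 \<le> 10 / m" using m by (auto simp: t_def \<rho>(2) field_simps)
  have t3: "t ^ 3 \<le> 1 + 70 / m"
  proof -
    have "t ^ 3 - 1 = (t - 1) * (t * t + t + 1)" by (simp add: power3_eq_cube algebra_simps)
    also have "\<dots> \<le> 10 / m * (2 * 2 + 2 + 1)" using t m by (intro mult_mono add_mono) auto
    finally show ?thesis by simp
  qed
  have t13: "t \<le> t ^ 3" "t\<^sup>2 \<le> t ^ 3" using t power_increasing[of 1 3 t] power_increasing[of 2 3 t] by auto
  define A1 A2 A3 where "A1 = 6 * a\<^sup>2 / h" and "A2 = 6 * z * a\<^sup>2 / h\<^sup>2" and "A3 = 6 * z\<^sup>2 * a\<^sup>2 / h ^ 3"
  have A0: "A1 \<ge> 0" "A2 \<ge> 0" "A3 \<ge> 0" using h z by (auto simp: A1_def A2_def A3_def)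
  have e: "J * \<rho> = A1 * x * t" "y * J * \<rho>\<^sup>2 = A2 * x * t\<^sup>2" "y\<^sup>2 * J * \<rho> ^ 3 = A3 * x * t ^ 3"
    using h x unfolding \<rho>(1) J_def y_def m_def A1_def A2_def A3_def z_def[symmetric]
    by (simp_all add: field_simps power2_eq_square power3_eq_cube)
  define S where "S = 15 / 4 * (2 / 27) * A1 + 9 / 2 * \<kappa> * A2 + 3 / 2 * (4 / 729) * A3"
  have S0: "S \<ge> 0" unfolding S_def using A0 \<kappa> by (intro add_nonneg_nonneg mult_nonneg_nonneg) auto
  have S: "S / 4 \<le> cl"
  proof -
    have "S / 4 = a\<^sup>2 * (5 / 12 * h\<^sup>2 + 27 / 4 * \<kappa> * z * h + z\<^sup>2 / 81) / h ^ 3"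
      using h unfolding S_def A1_def A2_def A3_def by (simp add: field_simps power2_eq_square power3_eq_cube)
    also have "\<dots> \<le> cl" unfolding cl_def h_def z_def
      using h by (intro divide_right_mono mult_left_mono lead_coefficient_le a \<kappa>) (auto simp: h_def)
    finally show ?thesis .
  qed
  have cl1: "cl \<le> 1"
  proof -
    have "a * a \<le> 1 / 4 * (1 / 4)" using a by (intro mult_mono) auto
    then have "a\<^sup>2 \<le> 1 / 16" by (simp add: power2_eq_square)
    moreover have "1 / 4 * (1 / 4) * (1 / 4) \<le> h * h * h" using h by (intro mult_mono) auto
    then have "1 / 64 \<le> h ^ 3" by (simp add: power3_eq_cube)
    moreover have "a\<^sup>2 * (0.18125 - 0.83875 * a + 0.99 * a\<^sup>2) \<le> 1 / 16 * (1 / 4)"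
    proof (rule mult_mono)
      have "0 \<le> (1 / 4 - a)\<^sup>2" by simp
      then show "0 \<le> 0.18125 - 0.83875 * a + 0.99 * a\<^sup>2" using a by (simp add: power2_eq_square field_simps)
    qed (use a \<open>a\<^sup>2 \<le> 1 / 16\<close> in auto)
    ultimately show ?thesis using h by (simp add: cl_def field_simps)
  qed
  have Sx: "S * x * t ^ 3 \<le> 4 * cl * x + 200"
  proof -
    have "S * x * t ^ 3 \<le> S * x * (1 + 70 / m)" using S0 x t3 by (intro mult_left_mono) auto
    also have "\<dots> = S * x + S * (70 / (6 * h))" using x h by (simp add: m_def field_simps)
    also have "S * x \<le> 4 * cl * x" using S x by (intro mult_right_mono) auto
    also have "S * (70 / (6 * h)) \<le> 4 * (70 / (6 * (1 / 4)))"
      using S cl1 S0 h by (intro mult_mono divide_left_mono) auto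
    finally show ?thesis by simp
  qed
  have "15 / 4 * (2 / 27) * (J * \<rho>) + 9 / 2 * \<kappa> * (y * J * \<rho>\<^sup>2 + 18) + 3 / 2 * (4 / 729) * (y\<^sup>2 * J * \<rho> ^ 3 + 432)
    \<le> 15 / 4 * (2 / 27) * (A1 * x * t ^ 3) + 9 / 2 * \<kappa> * (A2 * x * t ^ 3 + 18) + 3 / 2 * (4 / 729) * (A3 * x * t ^ 3 + 432)"
    unfolding e using A0 x \<kappa> t13 by (intro add_mono mult_left_mono) auto
  also have "\<dots> = S * x * t ^ 3 + 81 * \<kappa> + 3 / 2 * (4 / 729) * 432" by (simp add: S_def algebra_simps)
  also have "\<dots> \<le> 4 * cl * x + 210" using Sx \<kappa> by simp
  \<comment> \<open>After division by 4, the 10000 covers 210 / 4 and 24 * 1368 / 4 = 8208.\<close>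
  finally show ?thesis by (simp add: cl_def h_def)
qed

text \<open>A bound on the mean over each class of a partition bounds the overall mean. The classes
  will be the families of matchings with equal stars.\<close>

lemma sum_le_by_classes:
  fixes f :: "'a \<Rightarrow> real" and b :: real
  assumes T: "finite T" and C: "\<And>x. x \<in> T \<Longrightarrow> x \<in> C x" "\<And>x. x \<in> T \<Longrightarrow> C x \<subseteq> T"
    "\<And>x y. x \<in> T \<Longrightarrow> y \<in> C x \<Longrightarrow> C y = C x"
    and le: "\<And>x. x \<in> T \<Longrightarrow> (\<Sum>y\<in>C x. f y) \<le> b * real (card (C x))"
  shows "(\<Sum>x\<in>T. f x) \<le> b * real (card T)"
proof -
  have cls: "{y \<in> T. C y = C x} = C x" if "x \<in> T" for x
    using C(1) C(2)[OF that] C(3)[OF that] by auto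
  have grp: "(\<Sum>x\<in>T. g x) = (\<Sum>c\<in>C ` T. \<Sum>y\<in>c. g y)" for g :: "'a \<Rightarrow> real"
  proof -
    have "(\<Sum>x\<in>T. g x) = (\<Sum>c\<in>C ` T. \<Sum>y\<in>{y \<in> T. C y = c}. g y)"
      using T by (intro sum.group[symmetric]) auto
    also have "\<dots> = (\<Sum>c\<in>C ` T. \<Sum>y\<in>c. g y)" using cls by (intro sum.cong) auto
    finally show ?thesis .
  qed
  have "(\<Sum>x\<in>T. f x) \<le> (\<Sum>c\<in>C ` T. b * real (card c))" unfolding grp using le by (intro sum_mono) auto
  also have "\<dots> = b * (\<Sum>x\<in>T. 1)" unfolding grp[of "\<lambda>_. 1"] by (simp add: sum_distrib_left)
  finally show ?thesis by simp
qed

section \<open>From the average over a family to the conditional expectation\<close>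

context qaoa_stars begin

lemma c_\<theta>_bounds: "0 \<le> c * \<bar>\<theta>\<bar> ^ 3" "c * \<bar>\<theta>\<bar> ^ 3 \<le> 0.014256"
proof -
  show "0 \<le> c * \<bar>\<theta>\<bar> ^ 3" by simp
  have "\<bar>\<theta>\<bar> = c * (2 / 3 / sqrt 3)" by (simp add: \<theta>_eq)
  then have "c * \<bar>\<theta>\<bar> = (c * c) * (2 / 3 / sqrt 3)" by (simp only: mult.assoc)
  also have "c * c = 1 / 2" by simp
  finally have c\<theta>: "c * \<bar>\<theta>\<bar> = 1 / (3 * sqrt 3)" by simp
  have "c * \<bar>\<theta>\<bar> ^ 3 = (c * \<bar>\<theta>\<bar>) * \<bar>\<theta>\<bar>\<^sup>2" by (simp add: power3_eq_cube power2_eq_square)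
  also have "\<dots> = 1 / (3 * sqrt 3) * (2 / 27)" by (simp only: c\<theta> power2_abs \<theta>_sq)
  finally have eq: "c * \<bar>\<theta>\<bar> ^ 3 = 2 / (81 * sqrt 3)" by simp
  \<comment> \<open>0.014256 is \<open>2 / (81 * sqrt 3)\<close> rounded up in the sixth decimal, so
    a five-decimal lower bound for \<open>sqrt 3\<close> is enough.\<close>
  have "1.73205 \<le> sqrt (3 :: real)" by (rule real_le_rsqrt) (simp add: power2_eq_square)
  then show "c * \<bar>\<theta>\<bar> ^ 3 \<le> 0.014256" unfolding eq by (simp add: field_simps)
qed

lemma avg_gap_max_asymptotic:
  fixes a :: real
  assumes a: "0 < a" "a < 1 / 4" and k: "real (card V0) = a * real n" and n: "n \<ge> 7"
  shows "(\<Sum>M'\<in>Fam. qaoa_stars.gap_max n V0 M' \<beta> \<gamma>) \<le>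
    (a\<^sup>2 * (0.18125 - 0.83875 * a + 0.99 * a\<^sup>2) / (0.5 - a) ^ 3 * real n + 10000) * real (card Fam)"
proof -
  define x where "x = real n"
  have x: "x \<ge> 7" using n by (simp add: x_def)
  have "real (card U + 6 * card V0) = real (3 * n)" by (simp only: card_U)
  then have U: "real (card U) = 6 * (0.5 - a) * x" using k by (simp add: x_def algebra_simps)
  have "6 * (1 / 4) * 7 \<le> 6 * (0.5 - a) * x" using a x by (intro mult_mono) auto
  then have "card U \<ge> 10" using U by linarith
  note avg_gap_max[OF this]
  also have "(6 * real (card V0))\<^sup>2 = 36 * a\<^sup>2 * x\<^sup>2" unfolding k by (simp add: x_def power_mult_distrib)
  also have "6 * real n - 18 * real (card V0) = 6 * (1 - 3 * a) * x" unfolding k by (simp add: x_def algebra_simps)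
  also have "9 / 2 * c * \<bar>\<theta>\<bar> ^ 3 = 9 / 2 * (c * \<bar>\<theta>\<bar> ^ 3)" by simp
  also have "\<theta> ^ 4 = 4 / 729"
  proof -
    have "\<theta> ^ 4 = (\<theta>\<^sup>2)\<^sup>2" by simp
    then show ?thesis unfolding \<theta>_sq by (simp add: power2_eq_square)
  qed
  also note \<theta>_sq
  also note mult_right_mono[OF gap_arith[OF a c_\<theta>_bounds x, folded U \<rho>_def]]
  finally show ?thesis by (simp add: F_def x_def)
qed

end

text \<open>Conditioning the uniform matching gives the uniform distribution on \<open>T\<close>,
  which is nonempty since \<open>4 * card V0 \<le> n\<close>. \<open>T\<close> is partitioned into
  the families, and each of them satisfies the bound on average.\<close>

lemma mean_gap_le:
  fixes n :: nat and V0 :: "nat set" and a :: real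
  assumes even: "even (n * 3)" and V0: "V0 \<subseteq> {1..n}" and a: "0 < a" "a < 1 / 4"
    and k: "real (card V0) = a * real n" and n7: "n \<ge> 7"
  shows "measure_pmf.expectation
         (cond_pmf (configuration_model n 3) {M. two_independent 3 M V0})
         (\<lambda>M. let V = {1..n}; E = multigraph_of M;
                  \<psi> = qaoa_state (- pi / 4) (arctan (1 / sqrt 2)) V E
              in Max ((\<lambda>\<sigma>. projected_energy V E V0 \<sigma> \<psi>) ` spins V0) - energy V E \<psi>)
       \<le> a\<^sup>2 * (0.18125 - 0.83875 * a + 0.99 * a\<^sup>2) / (0.5 - a) ^ 3 * real n + 10000"
    (is "measure_pmf.expectation _ ?f \<le> ?b")
proof -
  define PM where "PM = perfect_matchings (half_edges {1..n} 3)"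
  define T where "T = two_independent_matchings n V0"
  obtain j where n: "n = 2 * j" using even_times_3[OF even] by blast
  have "4 * real (card V0) \<le> real n" using a k n7 by simp
  then have k4: "4 * card V0 \<le> n" by linarith
  have finPM: "finite PM" by (simp add: PM_def half_edges_def)
  have T: "T = PM \<inter> {M. two_independent 3 M V0}"
    by (auto simp: T_def two_independent_matchings_def PM_def)
  have memT: "M \<in> T \<longleftrightarrow> M \<in> PM \<and> two_independent 3 M V0" for M by (simp add: T)
  have "card T = (\<Prod>i<3 * card V0. n - card V0 - i) * 27 ^ card V0 * odd_fact (3 * j - 3 * card V0)"
    unfolding T_def using k4 by (intro card_two_independent_matchings[OF n V0 refl]) auto
  also have "\<dots> > 0" using k4 by (auto intro!: prod_pos)
  finally have T0: "card T > 0" .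
  then have finT: "finite T" and neT: "T \<noteq> {}" by (auto simp: card_gt_0_iff)
  have nePM: "PM \<noteq> {}" using neT T by auto
  have cond: "cond_pmf (configuration_model n 3) {M. two_independent 3 M V0} = pmf_of_set T"
  proof -
    have ne: "set_pmf (pmf_of_set PM) \<inter> {M. two_independent 3 M V0} \<noteq> {}"
      using neT unfolding set_pmf_of_set[OF nePM finPM] T .
    have "pmf (cond_pmf (pmf_of_set PM) {M. two_independent 3 M V0}) M = pmf (pmf_of_set T) M" for M
    proof -
      have prob: "measure_pmf.prob (pmf_of_set PM) {M. two_independent 3 M V0} = real (card T) / real (card PM)"
        by (simp add: measure_pmf_of_set[OF nePM finPM] T)
      have "card PM > 0" using nePM finPM by (simp add: card_gt_0_iff)
      then show ?thesis unfolding pmf_cond[OF ne] prob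
        using T0 memT[of M] by (auto simp: pmf_of_set[OF nePM finPM] pmf_of_set[OF neT finT] indicator_def)
    qed
    then show ?thesis unfolding configuration_model_def PM_def[symmetric] by (rule pmf_eqI)
  qed
  have "measure_pmf.expectation (pmf_of_set T) ?f = (\<Sum>M\<in>T. ?f M) / real (card T)"
    by (rule integral_pmf_of_set[OF neT finT])
  also have "(\<Sum>M\<in>T. ?f M) \<le> ?b * real (card T)"
  proof (rule sum_le_by_classes[OF finT, where C = "matched_stars.Fam n V0"])
    fix M assume M: "M \<in> T"
    interpret qaoa_stars n V0 M "- pi / 4" "arctan (1 / sqrt 2)"
      by unfold_locales (use M V0 in \<open>auto simp: T PM_def\<close>)
    have f: "?f M' = qaoa_stars.gap_max n V0 M' (- pi / 4) (arctan (1 / sqrt 2))" if M': "M' \<in> Fam" for M'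
    proof -
      interpret M': qaoa_stars n V0 M' "- pi / 4" "arctan (1 / sqrt 2)" by (rule qaoa_stars_Fam[OF M'])
      show ?thesis unfolding M'.gap_max_def M'.V_def Let_def ..
    qed
    show "M \<in> Fam" by (rule M_Fam)
    show "Fam \<subseteq> T"
    proof
      fix M' assume M': "M' \<in> Fam"
      interpret M': matched_stars n V0 M' "- pi / 4" "arctan (1 / sqrt 2)" by (rule matched_stars_Fam[OF M'])
      show "M' \<in> T" using M'.M' M'.ind by (simp add: T PM_def)
    qed
    show "matched_stars.Fam n V0 M' = Fam" if "M' \<in> Fam" for M' by (rule Fam_eq(3)[OF that])
    have "(\<Sum>M'\<in>Fam. ?f M') = (\<Sum>M'\<in>Fam. qaoa_stars.gap_max n V0 M' (- pi / 4) (arctan (1 / sqrt 2)))"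
      by (rule sum.cong[OF refl f])
    also have "\<dots> \<le> ?b * real (card Fam)" by (rule avg_gap_max_asymptotic[OF a k n7])
    finally show "(\<Sum>M'\<in>Fam. ?f M') \<le> ?b * real (card Fam)" .
  qed
  finally show ?thesis unfolding cond using T0 by (simp add: divide_right_mono)
qed

theorem proposition16:
  fixes \<alpha> :: real
  assumes "0 < \<alpha>" and "\<alpha> < alpha_star 3"
  shows "\<exists>R :: nat \<Rightarrow> real. R \<in> O(\<lambda>_. 1) \<and>
    (\<forall>(n::nat) (V0::nat set).
       even (n * 3) \<and> V0 \<subseteq> {1..n} \<and> real (card V0) = \<alpha> * real n \<longrightarrow>
       measure_pmf.expectation
         (cond_pmf (configuration_model n 3) {M. two_independent 3 M V0})
         (\<lambda>M. let V = {1..n}; E = multigraph_of M;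
                  \<psi> = qaoa_state (- pi / 4) (arctan (1 / sqrt 2)) V E
              in Max ((\<lambda>\<sigma>. projected_energy V E V0 \<sigma> \<psi>) ` spins V0) - energy V E \<psi>)
       \<le> \<alpha>\<^sup>2 * (0.18125 - 0.83875 * \<alpha> + 0.99 * \<alpha>\<^sup>2) / (0.5 - \<alpha>) ^ 3 * real n + R n)"
proof -
  have a: "0 < \<alpha>" "\<alpha> < 1 / 4" using assms alpha_star_less by auto
  define X where "X = (\<lambda>n V0. measure_pmf.expectation
         (cond_pmf (configuration_model n 3) {M. two_independent 3 M V0})
         (\<lambda>M. let V = {1..n}; E = multigraph_of M;
                  \<psi> = qaoa_state (- pi / 4) (arctan (1 / sqrt 2)) V E
              in Max ((\<lambda>\<sigma>. projected_energy V E V0 \<sigma> \<psi>) ` spins V0) - energy V E \<psi>))"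
  define b where "b = \<alpha>\<^sup>2 * (0.18125 - 0.83875 * \<alpha> + 0.99 * \<alpha>\<^sup>2) / (0.5 - \<alpha>) ^ 3"
  \<comment> \<open>For the finitely many \<open>n < 7\<close> the remainder is defined large enough
    for every \<open>V0\<close> at once; only its constant value from 7 on matters for
    \<open>R \<in> O(\<lambda>_. 1)\<close>.\<close>
  define R where "R = (\<lambda>n. if n < 7 then \<Sum>V0\<in>Pow {1..n}. \<bar>X n V0 - b * real n\<bar> else 10000)"
  have "R \<in> O(\<lambda>_. 1)"
  proof (rule bigoI[of _ 10000])
    show "\<forall>\<^sub>F n in sequentially. norm (R n) \<le> 10000 * norm (1 :: real)"
      using eventually_ge_at_top[of 7] by eventually_elim (simp add: R_def)
  qed
  moreover have "X n V0 \<le> b * real n + R n"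
    if "even (n * 3)" "V0 \<subseteq> {1..n}" "real (card V0) = \<alpha> * real n" for n V0
  proof (cases "n < 7")
    case True
    have "\<bar>X n V0 - b * real n\<bar> \<le> R n"
      using True that(2) member_le_sum[of V0 "Pow {1..n}" "\<lambda>V0. \<bar>X n V0 - b * real n\<bar>"] by (simp add: R_def)
    then show ?thesis by linarith
  next
    case False
    then show ?thesis using mean_gap_le[OF that(1,2) a that(3)] by (simp add: X_def b_def R_def)
  qed
  ultimately show ?thesis unfolding X_def b_def by blast
qed

end
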